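(* Let $(X,* )$ be a pointed fibrant bisimplicial set and let $m\ge 1$, $n\ge 1$. Then the Bott-Chern product $\star$ turns the Bott-Chern homotopy set $\pi^{\mathrm{BC}}_{m,n}(X,* )$ into a monoid.
   Context: **Notation.** A bisimplicial set $X$ has face and degeneracy maps $d_i,s_i$ in the first index and $\overline d_j,\overline s_j$ in the second. For simplicial sets $A,B$, the bisimplicial set $A\boxtimes B$ is $(A\boxtimes B)_{m,n}=A_m\times B_n$. $\Delta^{m,n}=\Delta^m\boxtimes\Delta^n$; elements of $X_{m,n}$ are identified with maps $\Delta^{m,n}\to X$, so for $\theta:\Delta^{m,n}\to X$ the faces $d_i\theta:\Delta^{m-1,n}\to X$, $\overline d_j\theta:\Delta^{m,n-1}\to X$ (and degeneracies) make sense. $d_i\Delta^m\subset\Delta^m$ is the $i$-th face and $\Lambda^m_k=\bigcup_{i\ne k}d_i\Delta^m$. $\delta\Delta^{m,n}=\partial\Delta^m\boxtimes\Delta^n\cup\Delta^m\boxtimes\partial\Delta^n$. **Fibrancy.** Anodyne extensions are the monomorphisms in the saturated class generated by $\Lambda^m_k\boxtimes\Delta^n\cup\Delta^m\boxtimes\Lambda^n_l\to\Delta^m\boxtimes\Delta^n$ ($m,n\ge1$, $0\le k\le m$, $0\le l\le n$). A map is a fibration if it has the right lifting property against all anodyne extensions; $X$ is fibrant if $X\to\Delta^{0,0}$ is a fibration. A pointed bisimplicial set has a chosen vertex $*:\Delta^{0,0}\to X$; any constant map $K\to\Delta^{0,0}\to X$ is also written $*$. **Homotopy.** For $h:K\times\Delta^{1,1}\to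 X$, face and degeneracy operators in the $\Delta^{1,1}$-direction carry a hat. $h$ is a homotopy from $\alpha$ to $\beta$ ($\alpha,\beta:K\to X$) if $\hat d_0h=\hat{\overline s}_0\alpha$, $\hat{\overline d}_0h=\hat s_0\alpha$ (i.e. these restrictions are $\alpha$ composed with the projection to $K$) and $\hat d_1\hat{\overline d}_1h=\beta$. For $L\subset K$, a map $\alpha:K\to X$ rel $L$ is one with $\alpha|_L=*$; a homotopy rel $L$ between two such maps is a homotopy $h$ with $h|_{L\times\Delta^{1,1}}=*$. If $X$ is fibrant this is an equivalence relation. $\pi^{\mathrm{BC}}_{m,n}(X,* )$ is the set of relative homotopy classes of maps $\Delta^{m,n}\to X$ rel $\delta\Delta^{m,n}$. **Bott-Chern product** ($m,n\ge1$). Given $\alpha,\beta:\Delta^{m,n}\to X$ rel $\delta\Delta^{m,n}$, choose (by fibrancy) $\theta:\Delta^{m+1,n+1}\to X$ with $d_i\theta=*$ for $0\le i<m-1$; $\overline d_j\theta=*$ for $0\le j<n-1$; $d_{m-1}\theta=\overline s_{n-1}\alpha$, $\overline d_{n-1}\theta=s_{m-1}\alpha$; $d_{m+1}\theta=\overline s_n\beta$, $\overline d_{n+1}\theta=s_m\beta$. Then $[\alpha]\star[\beta]:=[d_m\overline d_n\theta]$ (this is a map rel $\delta\Delta^{m,n}$ and its class depends only on $[\alpha],[\beta]$). *)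

theory Defs
  imports
    "HOL-Algebra.Group"
    "HOL-Library.FuncSet"
    "HOL-Library.Infinite_Typeclass"
begin

section \<open>Simplicial and bisimplicial sets\<close>

text \<open>A morphism \<open>[p] \<rightarrow> [m]\<close> of the simplex category is the list of its \<open>p + 1\<close> values.
  Faces and degeneracies of a (bi)simplicial set are the actions of cofaces and codegeneracies.\<close>

definition simplex_mor :: "nat \<Rightarrow> nat \<Rightarrow> nat list set" where
  "simplex_mor p m = {u. length u = Suc p \<and> sorted u \<and> set u \<subseteq> {..m}}"

definition simplex_id :: "nat \<Rightarrow> nat list" where
  "simplex_id m = [0..<Suc m]"

definition simplex_comp :: "nat list \<Rightarrow> nat list \<Rightarrow> nat list" where
  "simplex_comp u w = map (\<lambda>i. u ! i) w"

text \<open>\<open>sact A m u\<close> is the map \<open>A\<^sub>m \<rightarrow> A\<^sub>p\<close> induced by \<open>u : [p] \<rightarrow> [m]\<close>; similarly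
  \<open>bact X m n u v\<close> is the map \<open>X\<^sub>m\<^sub>,\<^sub>n \<rightarrow> X\<^sub>p\<^sub>,\<^sub>q\<close> induced by \<open>u : [p] \<rightarrow> [m]\<close> and \<open>v : [q] \<rightarrow> [n]\<close>.\<close>

record 'a sset =
  scells :: "nat \<Rightarrow> 'a set"
  sact :: "nat \<Rightarrow> nat list \<Rightarrow> 'a \<Rightarrow> 'a"

record 'a bisset =
  bcells :: "nat \<Rightarrow> nat \<Rightarrow> 'a set"
  bact :: "nat \<Rightarrow> nat \<Rightarrow> nat list \<Rightarrow> nat list \<Rightarrow> 'a \<Rightarrow> 'a"

definition bisimplicial_set :: "'a bisset \<Rightarrow> bool" where
  "bisimplicial_set X \<longleftrightarrow>
     (\<forall>m n p q. \<forall>u\<in>simplex_mor p m. \<forall>v\<in>simplex_mor q n. \<forall>x\<in>bcells X m n.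
        bact X m n u v x \<in> bcells X p q) \<and>
     (\<forall>m n. \<forall>x\<in>bcells X m n. bact X m n (simplex_id m) (simplex_id n) x = x) \<and>
     (\<forall>m n p q r s. \<forall>u\<in>simplex_mor p m. \<forall>v\<in>simplex_mor q n.
        \<forall>w\<in>simplex_mor r p. \<forall>z\<in>simplex_mor s q. \<forall>x\<in>bcells X m n.
          bact X p q w z (bact X m n u v x) = bact X m n (simplex_comp u w) (simplex_comp v z) x)"

definition std_simplex :: "nat \<Rightarrow> nat list sset" where
  "std_simplex m = \<lparr>scells = (\<lambda>p. simplex_mor p m), sact = (\<lambda>p w u. simplex_comp u w)\<rparr>"

definition simplex_face :: "nat \<Rightarrow> nat \<Rightarrow> nat list sset" where
  "simplex_face i m = (std_simplex m)\<lparr>scells := (\<lambda>p. {u \<in> simplex_mor p m. i \<notin> set u})\<rparr>"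

definition horn :: "nat \<Rightarrow> nat \<Rightarrow> nat list sset" where
  "horn m k =
     (std_simplex m)\<lparr>scells := (\<lambda>p. \<Union>i\<in>{..m} - {k}. scells (simplex_face i m) p)\<rparr>"

definition boundary :: "nat \<Rightarrow> nat list sset" where
  "boundary m = (std_simplex m)\<lparr>scells := (\<lambda>p. \<Union>i\<in>{..m}. scells (simplex_face i m) p)\<rparr>"

definition box :: "'a sset \<Rightarrow> 'b sset \<Rightarrow> ('a \<times> 'b) bisset"  (infixr "\<boxtimes>" 75) where
  "A \<boxtimes> B = \<lparr>bcells = (\<lambda>m n. scells A m \<times> scells B n),
            bact = (\<lambda>m n u v (a, b). (sact A m u a, sact B n v b))\<rparr>"

text \<open>Only used for two bisimplicial subsets of the same bisimplicial set, so that it does not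
  matter which of the two actions is taken.\<close>

definition bis_union :: "'a bisset \<Rightarrow> 'a bisset \<Rightarrow> 'a bisset"  (infixl "\<union>\<^sub>b" 65) where
  "A \<union>\<^sub>b B = A\<lparr>bcells := (\<lambda>m n. bcells A m n \<union> bcells B m n)\<rparr>"

definition bis_prod :: "'a bisset \<Rightarrow> 'b bisset \<Rightarrow> ('a \<times> 'b) bisset"  (infixr "\<times>\<^sub>b" 70) where
  "K \<times>\<^sub>b L = \<lparr>bcells = (\<lambda>m n. bcells K m n \<times> bcells L m n),
             bact = (\<lambda>m n u v (x, y). (bact K m n u v x, bact L m n u v y))\<rparr>"

type_synonym bisimplex = "nat list \<times> nat list"

definition std_bisimplex :: "nat \<Rightarrow> nat \<Rightarrow> bisimplex bisset" where
  "std_bisimplex m n = std_simplex m \<boxtimes> std_simplex n"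

definition std_boundary :: "nat \<Rightarrow> nat \<Rightarrow> bisimplex bisset" where
  "std_boundary m n = boundary m \<boxtimes> std_simplex n \<union>\<^sub>b std_simplex m \<boxtimes> boundary n"

definition std_horn :: "nat \<Rightarrow> nat \<Rightarrow> nat \<Rightarrow> nat \<Rightarrow> bisimplex bisset" where
  "std_horn m k n l = horn m k \<boxtimes> std_simplex n \<union>\<^sub>b std_simplex m \<boxtimes> horn n l"


section \<open>Maps of bisimplicial sets\<close>

text \<open>Maps are extensional (\<open>undefined\<close> outside the cells of their domain), so that equality
  of maps is equality of HOL functions.\<close>

type_synonym ('a, 'b) bmap = "nat \<Rightarrow> nat \<Rightarrow> 'a \<Rightarrow> 'b"

definition bis_hom :: "'a bisset \<Rightarrow> 'b bisset \<Rightarrow> ('a, 'b) bmap set" where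
  "bis_hom X Y = {f. (\<forall>m n. f m n \<in> bcells X m n \<rightarrow>\<^sub>E bcells Y m n) \<and>
     (\<forall>m n p q. \<forall>u\<in>simplex_mor p m. \<forall>v\<in>simplex_mor q n. \<forall>x\<in>bcells X m n.
        f p q (bact X m n u v x) = bact Y m n u v (f m n x))}"

text \<open>\<open>bis_comp X g f\<close> is \<open>g \<circ> f\<close>, where \<open>X\<close> is the domain of \<open>f\<close>.\<close>

definition bis_comp :: "'a bisset \<Rightarrow> ('b, 'c) bmap \<Rightarrow> ('a, 'b) bmap \<Rightarrow> ('a, 'c) bmap" where
  "bis_comp X g f = (\<lambda>m n. compose (bcells X m n) (g m n) (f m n))"

definition bis_restrict :: "('a, 'b) bmap \<Rightarrow> 'a bisset \<Rightarrow> ('a, 'b) bmap" where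
  "bis_restrict f L = (\<lambda>m n. restrict (f m n) (bcells L m n))"

definition bis_id :: "'a bisset \<Rightarrow> ('a, 'a) bmap" where
  "bis_id X = (\<lambda>m n. \<lambda>x\<in>bcells X m n. x)"

definition bis_arrow :: "'a bisset \<Rightarrow> 'b bisset \<Rightarrow> ('a, 'b) bmap \<Rightarrow> bool" where
  "bis_arrow X Y f \<longleftrightarrow> bisimplicial_set X \<and> bisimplicial_set Y \<and> f \<in> bis_hom X Y"

definition bis_iso :: "'a bisset \<Rightarrow> 'b bisset \<Rightarrow> ('a, 'b) bmap \<Rightarrow> bool" where
  "bis_iso X Y f \<longleftrightarrow> bis_arrow X Y f \<and>
     (\<exists>g\<in>bis_hom Y X. bis_comp X g f = bis_id X \<and> bis_comp Y f g = bis_id Y)"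

definition bis_mono :: "'a bisset \<Rightarrow> 'b bisset \<Rightarrow> ('a, 'b) bmap \<Rightarrow> bool" where
  "bis_mono X Y f \<longleftrightarrow> bis_arrow X Y f \<and> (\<forall>m n. inj_on (f m n) (bcells X m n))"

definition to_point :: "'a bisset \<Rightarrow> ('a, bisimplex) bmap" where
  "to_point K = (\<lambda>p q. \<lambda>x\<in>bcells K p q. (replicate (Suc p) 0, replicate (Suc q) 0))"

definition pointed_bisimplicial_set :: "'a bisset \<Rightarrow> (bisimplex, 'a) bmap \<Rightarrow> bool" where
  "pointed_bisimplicial_set X pt \<longleftrightarrow>
     bisimplicial_set X \<and> pt \<in> bis_hom (std_bisimplex 0 0) X"

definition const_map :: "'k bisset \<Rightarrow> (bisimplex, 'a) bmap \<Rightarrow> ('k, 'a) bmap" where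
  "const_map K pt = bis_comp K pt (to_point K)"


section \<open>Faces and degeneracies of maps out of standard bisimplices\<close>

text \<open>Under the identification of \<open>X\<^sub>m\<^sub>,\<^sub>n\<close> with the maps \<open>\<Delta>\<^sup>m\<^sup>,\<^sup>n \<rightarrow> X\<close>, the face
  and degeneracy operators are precomposition with cofaces and codegeneracies. The dimensions
  \<open>m n\<close> are those of the target \<open>X\<^sub>m\<^sub>,\<^sub>n\<close> for the faces, and those of the source for the
  degeneracies.\<close>

definition coface :: "nat \<Rightarrow> nat \<Rightarrow> nat" where
  "coface i x = (if x < i then x else Suc x)"

definition codegen :: "nat \<Rightarrow> nat \<Rightarrow> nat" where
  "codegen i x = (if x \<le> i then x else x - 1)"

definition simplex_map :: "(nat \<Rightarrow> nat) \<Rightarrow> (nat \<Rightarrow> nat) \<Rightarrow> (bisimplex, bisimplex) bmap" where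
  "simplex_map \<phi> \<psi> = (\<lambda>p q (u, v). (map \<phi> u, map \<psi> v))"

definition face1 :: "nat \<Rightarrow> nat \<Rightarrow> nat \<Rightarrow> (bisimplex, 'a) bmap \<Rightarrow> (bisimplex, 'a) bmap" where
  "face1 m n i \<theta> = bis_comp (std_bisimplex m n) \<theta> (simplex_map (coface i) id)"

definition face2 :: "nat \<Rightarrow> nat \<Rightarrow> nat \<Rightarrow> (bisimplex, 'a) bmap \<Rightarrow> (bisimplex, 'a) bmap" where
  "face2 m n j \<theta> = bis_comp (std_bisimplex m n) \<theta> (simplex_map id (coface j))"

definition degen1 :: "nat \<Rightarrow> nat \<Rightarrow> nat \<Rightarrow> (bisimplex, 'a) bmap \<Rightarrow> (bisimplex, 'a) bmap" where
  "degen1 m n i \<alpha> = bis_comp (std_bisimplex (Suc m) n) \<alpha> (simplex_map (codegen i) id)"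

definition degen2 :: "nat \<Rightarrow> nat \<Rightarrow> nat \<Rightarrow> (bisimplex, 'a) bmap \<Rightarrow> (bisimplex, 'a) bmap" where
  "degen2 m n j \<alpha> = bis_comp (std_bisimplex m (Suc n)) \<alpha> (simplex_map id (codegen j))"

text \<open>The faces with a hat, for maps out of \<open>K \<times> \<Delta>\<^sup>m\<^sup>+\<^sup>1\<^sup>,\<^sup>n\<close> and
  \<open>K \<times> \<Delta>\<^sup>m\<^sup>,\<^sup>n\<^sup>+\<^sup>1\<close>.\<close>

definition hat_face1 ::
  "'k bisset \<Rightarrow> nat \<Rightarrow> nat \<Rightarrow> nat \<Rightarrow> ('k \<times> bisimplex, 'a) bmap \<Rightarrow> ('k \<times> bisimplex, 'a) bmap" where
  "hat_face1 K m n i h = bis_comp (K \<times>\<^sub>b std_bisimplex m n) h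
     (\<lambda>p q (x, w). (x, simplex_map (coface i) id p q w))"

definition hat_face2 ::
  "'k bisset \<Rightarrow> nat \<Rightarrow> nat \<Rightarrow> nat \<Rightarrow> ('k \<times> bisimplex, 'a) bmap \<Rightarrow> ('k \<times> bisimplex, 'a) bmap" where
  "hat_face2 K m n j h = bis_comp (K \<times>\<^sub>b std_bisimplex m n) h
     (\<lambda>p q (x, w). (x, simplex_map id (coface j) p q w))"

definition via_proj ::
  "'k bisset \<Rightarrow> nat \<Rightarrow> nat \<Rightarrow> ('k, 'a) bmap \<Rightarrow> ('k \<times> bisimplex, 'a) bmap" where
  "via_proj K m n \<alpha> = bis_comp (K \<times>\<^sub>b std_bisimplex m n) \<alpha> (\<lambda>p q. fst)"


section \<open>Anodyne extensions and fibrations\<close>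

text \<open>Colimits are taken in the category of bisimplicial sets whose cells lie in a fixed type.\<close>

definition is_pushout ::
  "'u bisset \<Rightarrow> 'u bisset \<Rightarrow> 'u bisset \<Rightarrow> 'u bisset \<Rightarrow>
   ('u, 'u) bmap \<Rightarrow> ('u, 'u) bmap \<Rightarrow> ('u, 'u) bmap \<Rightarrow> ('u, 'u) bmap \<Rightarrow> bool" where
  "is_pushout A B C D j f g k \<longleftrightarrow>
     bis_arrow A B j \<and> bis_arrow A C f \<and> bis_arrow B D g \<and> bis_arrow C D k \<and>
     bis_comp A g j = bis_comp A k f \<and>
     (\<forall>(E :: 'u bisset) b c. bis_arrow B E b \<and> bis_arrow C E c \<and> bis_comp A b j = bis_comp A c f \<longrightarrow>
        (\<exists>!e. e \<in> bis_hom D E \<and> bis_comp B e g = b \<and> bis_comp C e k = c))"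

definition is_retract ::
  "'u bisset \<Rightarrow> 'u bisset \<Rightarrow> ('u, 'u) bmap \<Rightarrow> 'u bisset \<Rightarrow> 'u bisset \<Rightarrow> ('u, 'u) bmap \<Rightarrow> bool" where
  "is_retract A' B' j' A B j \<longleftrightarrow>
     bis_arrow A' B' j' \<and> bis_arrow A B j \<and>
     (\<exists>i\<in>bis_hom A' A. \<exists>r\<in>bis_hom A A'. \<exists>i'\<in>bis_hom B' B. \<exists>r'\<in>bis_hom B B'.
        bis_comp A' r i = bis_id A' \<and> bis_comp B' r' i' = bis_id B' \<and>
        bis_comp A' j i = bis_comp A' i' j' \<and> bis_comp A j' r = bis_comp A r' j)"

definition is_sequential_colimit ::
  "(nat \<Rightarrow> 'u bisset) \<Rightarrow> (nat \<Rightarrow> ('u, 'u) bmap) \<Rightarrow> 'u bisset \<Rightarrow> (nat \<Rightarrow> ('u, 'u) bmap) \<Rightarrow> bool" where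
  "is_sequential_colimit A j C c \<longleftrightarrow>
     (\<forall>i. bis_arrow (A i) (A (Suc i)) (j i) \<and> bis_arrow (A i) C (c i) \<and>
          bis_comp (A i) (c (Suc i)) (j i) = c i) \<and>
     (\<forall>(E :: 'u bisset) e. (\<forall>i. bis_arrow (A i) E (e i) \<and> bis_comp (A i) (e (Suc i)) (j i) = e i) \<longrightarrow>
        (\<exists>!f. f \<in> bis_hom C E \<and> (\<forall>i. bis_comp (A i) f (c i) = e i)))"

definition is_coproduct ::
  "'u set \<Rightarrow> ('u \<Rightarrow> 'u bisset) \<Rightarrow> 'u bisset \<Rightarrow> ('u \<Rightarrow> ('u, 'u) bmap) \<Rightarrow> bool" where
  "is_coproduct I A S a \<longleftrightarrow>
     bisimplicial_set S \<and> (\<forall>i\<in>I. bis_arrow (A i) S (a i)) \<and>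
     (\<forall>(E :: 'u bisset) e. bisimplicial_set E \<and> (\<forall>i\<in>I. bis_arrow (A i) E (e i)) \<longrightarrow>
        (\<exists>!f. f \<in> bis_hom S E \<and> (\<forall>i\<in>I. bis_comp (A i) f (a i) = e i)))"

text \<open>\<open>anodyne_saturation A B j\<close>: the map \<open>j : A \<rightarrow> B\<close> lies in the smallest class that
  contains the maps isomorphic to the generators and all isomorphisms, and is closed under
  pushouts, retracts, countable compositions and arbitrary direct sums (saturation in the sense of
  Gabriel--Zisman). Direct sums with index set of the same size as the type of cells exhaust, up to
  isomorphism, those that exist among bisimplicial sets over this type.\<close>

inductive anodyne_saturation :: "'u bisset \<Rightarrow> 'u bisset \<Rightarrow> ('u, 'u) bmap \<Rightarrow> bool" where
  generator:
    "anodyne_saturation A B j"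
    if "1 \<le> m" "1 \<le> n" "k \<le> m" "l \<le> n" "bis_arrow A B j"
      "bis_iso A (std_horn m k n l) f" "bis_iso B (std_bisimplex m n) g"
      "bis_comp A g j = f"
| isomorphism:
    "anodyne_saturation A B j" if "bis_iso A B j"
| pushout:
    "anodyne_saturation C D k" if "anodyne_saturation A B j" "is_pushout A B C D j f g k"
| retract:
    "anodyne_saturation A' B' j'" if "anodyne_saturation A B j" "is_retract A' B' j' A B j"
| countable_composition:
    "anodyne_saturation (A 0) C (c 0)"
    if "\<And>i. anodyne_saturation (A i) (A (Suc i)) (j i)" "is_sequential_colimit A j C c"
| direct_sum:
    "anodyne_saturation S T s"
    if "\<And>i. i \<in> I \<Longrightarrow> anodyne_saturation (A i) (B i) (j i)"
      "is_coproduct I A S a" "is_coproduct I B T b" "bis_arrow S T s"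
      "\<And>i. i \<in> I \<Longrightarrow> bis_comp (A i) s (a i) = bis_comp (A i) (b i) (j i)"

definition anodyne_extension :: "'u bisset \<Rightarrow> 'u bisset \<Rightarrow> ('u, 'u) bmap \<Rightarrow> bool" where
  "anodyne_extension A B j \<longleftrightarrow> anodyne_saturation A B j \<and> bis_mono A B j"

definition right_lifting_property ::
  "'u bisset \<Rightarrow> 'u bisset \<Rightarrow> ('u, 'u) bmap \<Rightarrow> 'a bisset \<Rightarrow> 'b bisset \<Rightarrow> ('a, 'b) bmap \<Rightarrow> bool" where
  "right_lifting_property A B j X Y p \<longleftrightarrow>
     (\<forall>f\<in>bis_hom A X. \<forall>g\<in>bis_hom B Y. bis_comp A p f = bis_comp A g j \<longrightarrow>
        (\<exists>h\<in>bis_hom B X. bis_comp B p h = g \<and> bis_comp A h j = f))"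

text \<open>HOL cannot quantify over all types inside a definition, so the type \<open>'u\<close> of cells of the
  anodyne extensions is a parameter. Every infinite type contains isomorphic copies of all
  generators, and right lifting against the generators implies right lifting against the whole
  saturated class. Hence the notion does not depend on the choice of the infinite type \<open>'u\<close>.\<close>

definition fibration ::
  "('u :: infinite) itself \<Rightarrow> 'a bisset \<Rightarrow> 'b bisset \<Rightarrow> ('a, 'b) bmap \<Rightarrow> bool" where
  "fibration _ X Y p \<longleftrightarrow> bis_arrow X Y p \<and>
     (\<forall>(A :: 'u bisset) B j. anodyne_extension A B j \<longrightarrow> right_lifting_property A B j X Y p)"

definition fibrant :: "('u :: infinite) itself \<Rightarrow> 'a bisset \<Rightarrow> bool" where
  "fibrant U X \<longleftrightarrow> fibration U X (std_bisimplex 0 0) (to_point X)"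


section \<open>Homotopy\<close>

definition is_homotopy ::
  "'k bisset \<Rightarrow> 'a bisset \<Rightarrow> ('k \<times> bisimplex, 'a) bmap \<Rightarrow> ('k, 'a) bmap \<Rightarrow> ('k, 'a) bmap \<Rightarrow> bool" where
  "is_homotopy K X h \<alpha> \<beta> \<longleftrightarrow>
     h \<in> bis_hom (K \<times>\<^sub>b std_bisimplex 1 1) X \<and>
     hat_face1 K 0 1 0 h = via_proj K 0 1 \<alpha> \<and>
     hat_face2 K 1 0 0 h = via_proj K 1 0 \<alpha> \<and>
     hat_face1 K 0 0 1 (hat_face2 K 1 0 1 h) = via_proj K 0 0 \<beta>"

definition maps_rel ::
  "'k bisset \<Rightarrow> 'k bisset \<Rightarrow> 'a bisset \<Rightarrow> (bisimplex, 'a) bmap \<Rightarrow> ('k, 'a) bmap set" where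
  "maps_rel K L X pt = {\<alpha> \<in> bis_hom K X. bis_restrict \<alpha> L = const_map L pt}"

definition homotopy_rel ::
  "'k bisset \<Rightarrow> 'k bisset \<Rightarrow> 'a bisset \<Rightarrow> (bisimplex, 'a) bmap \<Rightarrow>
   (('k, 'a) bmap \<times> ('k, 'a) bmap) set" where
  "homotopy_rel K L X pt = {(\<alpha>, \<beta>). \<alpha> \<in> maps_rel K L X pt \<and> \<beta> \<in> maps_rel K L X pt \<and>
     (\<exists>h. is_homotopy K X h \<alpha> \<beta> \<and>
       bis_restrict h (L \<times>\<^sub>b std_bisimplex 1 1) = const_map (L \<times>\<^sub>b std_bisimplex 1 1) pt)}"


section \<open>Bott-Chern homotopy sets and the Bott-Chern product\<close>

definition BC_maps ::
  "'a bisset \<Rightarrow> (bisimplex, 'a) bmap \<Rightarrow> nat \<Rightarrow> nat \<Rightarrow> (bisimplex, 'a) bmap set" where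
  "BC_maps X pt m n = maps_rel (std_bisimplex m n) (std_boundary m n) X pt"

definition BC_homotopy ::
  "'a bisset \<Rightarrow> (bisimplex, 'a) bmap \<Rightarrow> nat \<Rightarrow> nat \<Rightarrow>
   ((bisimplex, 'a) bmap \<times> (bisimplex, 'a) bmap) set" where
  "BC_homotopy X pt m n = homotopy_rel (std_bisimplex m n) (std_boundary m n) X pt"

definition BC_homotopy_set ::
  "'a bisset \<Rightarrow> (bisimplex, 'a) bmap \<Rightarrow> nat \<Rightarrow> nat \<Rightarrow> (bisimplex, 'a) bmap set set" where
  "BC_homotopy_set X pt m n = BC_maps X pt m n // BC_homotopy X pt m n"

definition BC_fillers ::
  "'a bisset \<Rightarrow> (bisimplex, 'a) bmap \<Rightarrow> nat \<Rightarrow> nat \<Rightarrow> (bisimplex, 'a) bmap \<Rightarrow> (bisimplex, 'a) bmap \<Rightarrow>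
   (bisimplex, 'a) bmap set" where
  "BC_fillers X pt m n \<alpha> \<beta> = {\<theta> \<in> bis_hom (std_bisimplex (m + 1) (n + 1)) X.
     (\<forall>i. i + 1 < m \<longrightarrow> face1 m (n + 1) i \<theta> = const_map (std_bisimplex m (n + 1)) pt) \<and>
     (\<forall>j. j + 1 < n \<longrightarrow> face2 (m + 1) n j \<theta> = const_map (std_bisimplex (m + 1) n) pt) \<and>
     face1 m (n + 1) (m - 1) \<theta> = degen2 m n (n - 1) \<alpha> \<and>
     face2 (m + 1) n (n - 1) \<theta> = degen1 m n (m - 1) \<alpha> \<and>
     face1 m (n + 1) (m + 1) \<theta> = degen2 m n n \<beta> \<and>
     face2 (m + 1) n (n + 1) \<theta> = degen1 m n m \<beta>}"

text \<open>The union of the classes of \<open>d\<^sub>m d\<^sub>n \<theta>\<close> (one face in each direction) over all choices of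
  representatives and fillers. For fibrant \<open>X\<close> the union is an element of the homotopy set exactly if a filler
  exists and the class is independent of the choices; closure of the homotopy set under the
  product therefore includes that the product is well defined.\<close>

definition BC_product ::
  "'a bisset \<Rightarrow> (bisimplex, 'a) bmap \<Rightarrow> nat \<Rightarrow> nat \<Rightarrow>
   (bisimplex, 'a) bmap set \<Rightarrow> (bisimplex, 'a) bmap set \<Rightarrow> (bisimplex, 'a) bmap set" where
  "BC_product X pt m n a b =
     (\<Union>\<alpha>\<in>a. \<Union>\<beta>\<in>b. \<Union>\<theta>\<in>BC_fillers X pt m n \<alpha> \<beta>.
        BC_homotopy X pt m n `` {face1 m n m (face2 (m + 1) n n \<theta>)})"

end

theory Submission
  imports Defs "HOL-Library.Countable"
begin

text \<open>Write \<open>T \<alpha> \<beta> \<gamma>\<close> if \<open>\<gamma>\<close> is the corner \<open>d\<^sub>m d\<^sub>n \<theta>\<close> (one face in each direction) of some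
  filler \<open>\<theta>\<close> for \<open>\<alpha>\<close> and \<open>\<beta>\<close>, and write \<open>*\<close> for the constant map. Values exist by horn filling,
  and degenerate cells show \<open>T * \<alpha> \<alpha>\<close> and \<open>T \<alpha> * \<alpha>\<close>. The core of the proof is two associativity
  laws, each obtained by filling horns one dimension above the fillers: if \<open>T \<alpha> \<beta> \<mu>\<close> and
  \<open>T \<beta> \<gamma> \<nu>\<close>, then \<open>T \<mu> \<gamma> \<rho>\<close> implies \<open>T \<alpha> \<nu> \<rho>\<close>, and \<open>T \<alpha> \<nu> \<rho>\<close> implies \<open>T \<mu> \<gamma> \<rho>\<close>
  (\<open>product_rel_assoc_right\<close>, \<open>product_rel_assoc_left\<close>). With constant entries, these laws
  already say that \<open>T \<alpha> * \<beta>\<close> is an equivalence relation between \<open>\<alpha>\<close> and \<open>\<beta>\<close>, that \<open>T\<close> respects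
  it in all three places, and that any two values for the same factors are equivalent: hence \<open>T\<close>
  makes the set of classes a monoid (\<open>monoid_of_ternary_relation\<close>).

  It remains to see that \<open>T \<alpha> * \<beta>\<close> holds if and only if there is a Bott-Chern homotopy from \<open>\<alpha>\<close>
  to \<open>\<beta>\<close>. A filler becomes a homotopy by pulling it back, in both directions, along the order
  preserving map \<open>[m] \<times> [1] \<rightarrow> [m + 1]\<close> that is the \<open>m\<close>th coface on \<open>[m] \<times> {0}\<close> and the preceding
  coface on \<open>[m] \<times> {1}\<close> (\<open>BC_homotopy_if_product\<close>). Conversely, the prisms in both directions
  cut a homotopy into a grid of \<open>(m + 1)(n + 1)\<close> cells of \<open>X\<^sub>m\<^sub>+\<^sub>1\<^sub>,\<^sub>n\<^sub>+\<^sub>1\<close>. Horn fillings merge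
  the rows of the grid one after the other into a single row, in which the cells have their
  nontrivial faces in the places where a filler has them; in the same way the remaining row is
  merged into a single cell (\<open>collapse_grid\<close>, \<open>product_if_BC_homotopy\<close>).

  All fillings take place between cells, not maps. Cells whose faces outside a window of
  consecutive vertices are base cells again have faces, degeneracies and horn fillers
  (\<open>window_fibrant_cells\<close>). Passing to such windows turns every horn that occurs into one of
  dimension at most three, so that the compatibility of its faces is a matter of finitely many
  simplicial identities.\<close>

section \<open>Monoids from a ternary product relation\<close>

text \<open>The relation \<open>T a o' b\<close> is the equivalence relation, and uniqueness of values up to this
  relation is the second associativity law with \<open>o'\<close> in the place of \<open>c\<close>.\<close>

lemma monoid_of_ternary_relation:
  fixes T :: "'b \<Rightarrow> 'b \<Rightarrow> 'b \<Rightarrow> bool"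
  assumes closed: "\<And>a b c. T a b c \<Longrightarrow> a \<in> S \<and> b \<in> S \<and> c \<in> S"
    and o: "o' \<in> S"
    and ex: "\<And>a b. a \<in> S \<Longrightarrow> b \<in> S \<Longrightarrow> \<exists>c. T a b c"
    and l: "\<And>b. b \<in> S \<Longrightarrow> T o' b b" and r: "\<And>a. a \<in> S \<Longrightarrow> T a o' a"
    and A1: "\<And>a b c m n r. T a b m \<Longrightarrow> T b c n \<Longrightarrow> T m c r \<Longrightarrow> T a n r"
    and A2: "\<And>a b c m n r. T a b m \<Longrightarrow> T b c n \<Longrightarrow> T a n r \<Longrightarrow> T m c r"
    and R: "R = {(a, b). T a o' b}"
    and P: "\<And>A B. A \<subseteq> S \<Longrightarrow> B \<subseteq> S \<Longrightarrow> P A B = (\<Union>a\<in>A. \<Union>b\<in>B. \<Union>c\<in>{c. T a b c}. R `` {c})"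
  shows "monoid \<lparr>carrier = S // R, mult = P, one = R `` {o'}\<rparr>"
proof -
  have uniq: "T n o' c" if "T a b n" "T a b c" for a b n c
  proof -
    have "b \<in> S" using closed that by blast
    from A2[OF that(1) r[OF this] that(2)] show ?thesis .
  qed
  have lr: "T o' a b" if "T a o' b" for a b
    using A1[OF l[of a] r[of a] that] closed that by blast
  have sym: "T b o' a" if "T a o' b" for a b
    using uniq[OF that r] closed that by blast
  have trans: "T a o' c" if "T a o' b" "T b o' c" for a b c
    using uniq[OF sym[OF that(1)] that(2)] .
  have eq: "equiv S R"
  proof (rule equivI)
    show "R \<subseteq> S \<times> S" unfolding R using closed by blast
    show "refl_on S R" unfolding R using r by (blast intro: refl_onI)
    show "sym R" unfolding R using sym by (blast intro: symI)
    show "trans R" unfolding R using trans by (blast intro: transI)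
  qed
  have congl: "T a' b c" if "T a b c" "T a o' a'" for a a' b c
    using A2[OF that(2) l that(1)] closed that by blast
  have congr: "T a b' c" if "T a b c" "T b o' b'" for a b b' c
    using A1[OF r lr[OF that(2)] that(1)] closed that by blast
  have prod: "P (R `` {a}) (R `` {b}) = R `` {c}" if T: "T a b c" for a b c
  proof -
    have sub: "R `` {x} \<subseteq> S" for x using closed by (auto simp: R)
    note P' = P[OF sub sub]
    have *: "R `` {c'} = R `` {c}" if "T a o' a'" "T b o' b'" "T a' b' c'" for a' b' c'
    proof -
      have "T a' b' c" using congl congr T that by blast
      then show ?thesis using uniq[OF that(3)] by (intro equiv_class_eq[OF eq]) (simp add: R)
    qed
    have "a \<in> S" "b \<in> S" using closed T by auto
    then have "P (R `` {a}) (R `` {b}) \<supseteq> R `` {c}"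
      unfolding P' unfolding R using r T by blast
    moreover have "P (R `` {a}) (R `` {b}) \<subseteq> R `` {c}"
    proof
      fix z assume "z \<in> P (R `` {a}) (R `` {b})"
      then obtain a' b' c' where "T a o' a'" "T b o' b'" "T a' b' c'" "z \<in> R `` {c'}"
        unfolding P' unfolding R by blast
      then show "z \<in> R `` {c}" using * by blast
    qed
    ultimately show ?thesis by blast
  qed
  have cls: "R `` {a} \<in> S // R" if "a \<in> S" for a
    using that by (simp add: quotientI)
  show ?thesis
  proof (rule monoidI; simp)
    fix x y assume "x \<in> S // R" "y \<in> S // R"
    then obtain a b where ab: "x = R `` {a}" "y = R `` {b}" "a \<in> S" "b \<in> S"
      by (auto elim!: quotientE)
    obtain c where c: "T a b c" using ex ab by blast
    show "P x y \<in> S // R" using prod[OF c] cls closed[OF c] ab by simp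
  next
    show "R `` {o'} \<in> S // R" using cls o .
  next
    fix x y z assume "x \<in> S // R" "y \<in> S // R" "z \<in> S // R"
    then obtain a b c where abc: "x = R `` {a}" "y = R `` {b}" "z = R `` {c}" "a \<in> S" "b \<in> S"
      "c \<in> S"
      by (auto elim!: quotientE)
    obtain m where m: "T a b m" using ex abc by blast
    obtain n where n: "T b c n" using ex abc by blast
    obtain q where q: "T m c q" using ex abc closed m by blast
    show "P (P x y) z = P x (P y z)"
      using prod m n q A1[OF m n q] abc by simp
  next
    fix x assume "x \<in> S // R"
    then obtain a where a: "x = R `` {a}" "a \<in> S" by (auto elim!: quotientE)
    show "P (R `` {o'}) x = x" "P x (R `` {o'}) = x" using prod l r a by auto
  qed
qed

section \<open>Bisimplicial cells with horn filling\<close>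

text \<open>The cells of all dimensions form one set; \<open>D\<close> is the dimension of a cell in the direction
  considered, so that faces \<open>d\<close> and degeneracies \<open>s\<close> need no dimension as an argument. Nothing
  is assumed about faces or degeneracies whose index is out of range.\<close>

locale simplicial_direction =
  fixes U :: "'c set" and D :: "'c \<Rightarrow> nat" and d s :: "nat \<Rightarrow> 'c \<Rightarrow> 'c"
  assumes d_in: "x \<in> U \<Longrightarrow> 0 < D x \<Longrightarrow> i \<le> D x \<Longrightarrow> d i x \<in> U"
    and D_d: "x \<in> U \<Longrightarrow> 0 < D x \<Longrightarrow> i \<le> D x \<Longrightarrow> D (d i x) = D x - 1"
    and s_in: "x \<in> U \<Longrightarrow> i \<le> D x \<Longrightarrow> s i x \<in> U"
    and D_s: "x \<in> U \<Longrightarrow> i \<le> D x \<Longrightarrow> D (s i x) = Suc (D x)"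
    and d_d: "x \<in> U \<Longrightarrow> i < j \<Longrightarrow> j \<le> D x \<Longrightarrow> 1 < D x \<Longrightarrow> d i (d j x) = d (j - 1) (d i x)"
    and d_s_less: "x \<in> U \<Longrightarrow> i < j \<Longrightarrow> j \<le> D x \<Longrightarrow> d i (s j x) = s (j - 1) (d i x)"
    and d_s_same: "x \<in> U \<Longrightarrow> i \<le> D x \<Longrightarrow> d i (s i x) = x"
    and d_s_Suc: "x \<in> U \<Longrightarrow> i \<le> D x \<Longrightarrow> d (Suc i) (s i x) = x"
    and d_s_greater: "x \<in> U \<Longrightarrow> Suc j < i \<Longrightarrow> i \<le> Suc (D x) \<Longrightarrow> d i (s j x) = s j (d (i - 1) x)"
    and s_s: "x \<in> U \<Longrightarrow> i \<le> j \<Longrightarrow> j \<le> D x \<Longrightarrow> s i (s j x) = s (Suc j) (s i x)"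

locale commuting_directions =
  fixes U :: "'c set" and D D' :: "'c \<Rightarrow> nat" and d s d' s' :: "nat \<Rightarrow> 'c \<Rightarrow> 'c"
  assumes D'_d: "x \<in> U \<Longrightarrow> 0 < D x \<Longrightarrow> i \<le> D x \<Longrightarrow> D' (d i x) = D' x"
    and D'_s: "x \<in> U \<Longrightarrow> i \<le> D x \<Longrightarrow> D' (s i x) = D' x"
    and D_d': "x \<in> U \<Longrightarrow> 0 < D' x \<Longrightarrow> i \<le> D' x \<Longrightarrow> D (d' i x) = D x"
    and D_s': "x \<in> U \<Longrightarrow> i \<le> D' x \<Longrightarrow> D (s' i x) = D x"
    and d_d': "x \<in> U \<Longrightarrow> 0 < D x \<Longrightarrow> i \<le> D x \<Longrightarrow> 0 < D' x \<Longrightarrow> j \<le> D' x \<Longrightarrow> d i (d' j x) = d' j (d i x)"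
    and d_s': "x \<in> U \<Longrightarrow> 0 < D x \<Longrightarrow> i \<le> D x \<Longrightarrow> j \<le> D' x \<Longrightarrow> d i (s' j x) = s' j (d i x)"
    and s_d': "x \<in> U \<Longrightarrow> i \<le> D x \<Longrightarrow> 0 < D' x \<Longrightarrow> j \<le> D' x \<Longrightarrow> s i (d' j x) = d' j (s i x)"
    and s_s': "x \<in> U \<Longrightarrow> i \<le> D x \<Longrightarrow> j \<le> D' x \<Longrightarrow> s i (s' j x) = s' j (s i x)"

text \<open>The cells that are multiples of the base point: \<open>st a b\<close> is the one of dimensions \<open>a\<close> and
  \<open>b\<close>.\<close>

locale base_cells =
  fixes U :: "'c set" and D D' :: "'c \<Rightarrow> nat" and d s :: "nat \<Rightarrow> 'c \<Rightarrow> 'c" and st :: "nat \<Rightarrow> nat \<Rightarrow> 'c"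
  assumes st_in: "st a b \<in> U" and D_st: "D (st a b) = a" and D'_st: "D' (st a b) = b"
    and d_st: "0 < a \<Longrightarrow> i \<le> a \<Longrightarrow> d i (st a b) = st (a - 1) b"
    and s_st: "i \<le> a \<Longrightarrow> s i (st a b) = st (Suc a) b"

text \<open>Compatible cells \<open>F i\<close> (\<open>i \<noteq> k\<close>) and \<open>G j\<close> (\<open>j \<noteq> l\<close>) are the faces of a common cell in the
  first and in the second direction. This is the extension property for the horn
  \<open>\<Lambda>\<^sup>M\<^sub>k \<boxtimes> \<Delta>\<^sup>N \<union> \<Delta>\<^sup>M \<boxtimes> \<Lambda>\<^sup>N\<^sub>l\<close>.\<close>

definition horn_filling where
  "horn_filling U D D' d d' \<longleftrightarrow> (\<forall>M N k l F G.
     0 < M \<longrightarrow> 0 < N \<longrightarrow> k \<le> M \<longrightarrow> l \<le> N \<longrightarrow>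
     (\<forall>i\<le>M. i \<noteq> k \<longrightarrow> F i \<in> U \<and> D (F i) = M - 1 \<and> D' (F i) = N) \<longrightarrow>
     (\<forall>j\<le>N. j \<noteq> l \<longrightarrow> G j \<in> U \<and> D (G j) = M \<and> D' (G j) = N - 1) \<longrightarrow>
     (\<forall>i j. i < j \<longrightarrow> j \<le> M \<longrightarrow> i \<noteq> k \<longrightarrow> j \<noteq> k \<longrightarrow> d i (F j) = d (j - 1) (F i)) \<longrightarrow>
     (\<forall>i j. i < j \<longrightarrow> j \<le> N \<longrightarrow> i \<noteq> l \<longrightarrow> j \<noteq> l \<longrightarrow> d' i (G j) = d' (j - 1) (G i)) \<longrightarrow>
     (\<forall>i\<le>M. \<forall>j\<le>N. i \<noteq> k \<longrightarrow> j \<noteq> l \<longrightarrow> d' j (F i) = d i (G j)) \<longrightarrow>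
     (\<exists>x\<in>U. D x = M \<and> D' x = N \<and> (\<forall>i\<le>M. i \<noteq> k \<longrightarrow> d i x = F i) \<and> (\<forall>j\<le>N. j \<noteq> l \<longrightarrow> d' j x = G j)))"

text \<open>What remains of a pointed fibrant bisimplicial set if its cells are considered on their
  own. The assumptions are symmetric in both directions (\<open>transpose\<close>).\<close>

locale fibrant_cells =
  fst: simplicial_direction U D d s + snd: simplicial_direction U D' d' s' +
  commuting_directions U D D' d s d' s' +
  fst: base_cells U D D' d s st + snd: base_cells U D' D d' s' "\<lambda>a b. st b a"
  for U :: "'c set" and D D' d s d' s' st +
  assumes fill: "horn_filling U D D' d d'"
begin

lemma horn_filling_transpose:
  assumes "horn_filling U D D' d d'"
  shows "horn_filling U D' D d' d"
  unfolding horn_filling_def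
proof (intro allI impI, goal_cases)
  case (1 M N k l F G)
  have "\<exists>x\<in>U. D x = N \<and> D' x = M \<and> (\<forall>i\<le>N. i \<noteq> l \<longrightarrow> d i x = G i) \<and> (\<forall>j\<le>M. j \<noteq> k \<longrightarrow> d' j x = F j)"
    by (rule assms[unfolded horn_filling_def, rule_format]) (use 1 in auto)
  then show ?case by blast
qed

lemma transpose: "fibrant_cells U D' D d' s' d s (\<lambda>a b. st b a)"
proof -
  interpret snd2: commuting_directions U D' D d' s' d s
    by unfold_locales (simp_all add: D_d' D_s' D'_d D'_s d_d' d_s' s_d' s_s')
  show ?thesis
    by unfold_locales (rule horn_filling_transpose[OF fill])
qed

lemma d_s_next: "x \<in> U \<Longrightarrow> i \<le> D x \<Longrightarrow> j = Suc i \<Longrightarrow> d j (s i x) = x"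
  and d'_s'_next: "x \<in> U \<Longrightarrow> i \<le> D' x \<Longrightarrow> j = Suc i \<Longrightarrow> d' j (s' i x) = x"
  by (simp_all add: fst.d_s_Suc snd.d_s_Suc)

text \<open>As rewrite rules, these move faces inside degeneracies, and otherwise the operators of the
  first direction inside those of the second direction.\<close>

lemmas cell_simps = fst.d_in fst.D_d fst.s_in fst.D_s fst.d_d fst.d_s_less fst.d_s_same d_s_next fst.d_s_greater
  snd.d_in snd.D_d snd.s_in snd.D_s snd.d_d snd.d_s_less snd.d_s_same d'_s'_next snd.d_s_greater
  D'_d D'_s D_d' D_s' d_d' d_s' s_d'[symmetric] s_s'
  fst.st_in fst.D_st fst.D'_st fst.d_st fst.s_st snd.d_st snd.s_st

subsection \<open>Windows\<close>

text \<open>A cell lies in \<open>window r t\<close> if all its faces in the first direction are base cells, except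
  possibly those opposite to the vertices from the \<open>r\<close>th one on and before the last \<open>t\<close> ones.
  The faces and degeneracies that belong to vertices in this range preserve the window.\<close>

definition window :: "nat \<Rightarrow> nat \<Rightarrow> 'c set" where
  "window r t = {x \<in> U. r + t \<le> D x \<and>
     (\<forall>i\<le>D x. i < r \<or> D x - t < i \<longrightarrow> d i x = st (D x - 1) (D' x))}"

lemma windowD:
  assumes "x \<in> window r t"
  shows "x \<in> U" "r + t \<le> D x" "i \<le> D x \<Longrightarrow> i < r \<or> D x - t < i \<Longrightarrow> d i x = st (D x - 1) (D' x)"
  using assms by (auto simp: window_def)

lemma windowI:
  assumes "x \<in> U" "r + t \<le> D x"
    and "\<And>i. i < r \<Longrightarrow> d i x = st (D x - 1) (D' x)"
    and "\<And>i. i \<le> D x \<Longrightarrow> D x - t < i \<Longrightarrow> d i x = st (D x - 1) (D' x)"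
  shows "x \<in> window r t"
  using assms by (auto simp: window_def)

text \<open>A horn between cells of the window is filled by adding base cells as the faces opposite to
  the vertices outside of the window.\<close>

lemma window_fibrant_cells:
  "fibrant_cells (window r t) (\<lambda>x. D x - r - t) D' (\<lambda>i. d (r + i)) (\<lambda>i. s (r + i)) d' s'
     (\<lambda>a b. st (r + a + t) b)"
proof -
  let ?W = "window r t" and ?D = "\<lambda>x. D x - r - t"
  note W = windowD(1,2)[where r = r and t = t]
  have le: "r + i \<le> D x" "r + i \<le> D x - t" if "x \<in> ?W" "i \<le> ?D x" for x i
    using W(2)[OF that(1)] that(2) by linarith+
  have d_in: "d (r + i) x \<in> ?W" if x: "x \<in> ?W" and D: "0 < ?D x" and i: "i \<le> ?D x" for x i
  proof (rule windowI)
    note [simp] = W(1)[OF x]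
    have i': "r + i \<le> D x - t" "r + i \<le> D x" "0 < D x" using D i W(2)[OF x] by linarith+
    show "d (r + i) x \<in> U" "r + t \<le> D (d (r + i) x)" using i' D by (simp_all add: cell_simps)
    fix l
    show "d l (d (r + i) x) = st (D (d (r + i) x) - 1) (D' (d (r + i) x))" if "l < r"
    proof -
      have "d l (d (r + i) x) = d (r + i - 1) (d l x)"
        using that D i' by (intro fst.d_d) auto
      then show ?thesis using that i' D windowD(3)[OF x, of l] by (simp add: cell_simps)
    qed
    show "d l (d (r + i) x) = st (D (d (r + i) x) - 1) (D' (d (r + i) x))"
      if l: "l \<le> D (d (r + i) x)" "D (d (r + i) x) - t < l"
    proof -
      have l': "Suc l \<le> D x" "D x - t < Suc l" "r + i < Suc l" "1 < D x"
        using that i' D by (auto simp: cell_simps)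
      have "d l (d (r + i) x) = d (r + i) (d (Suc l) x)"
        using fst.d_d[of x "r + i" "Suc l"] l' by simp
      also have "d (Suc l) x = st (D x - 1) (D' x)" using windowD(3)[OF x] l' by simp
      finally show ?thesis using i' l' by (simp add: cell_simps)
    qed
  qed
  have s_in: "s (r + i) x \<in> ?W" if x: "x \<in> ?W" and i: "i \<le> ?D x" for x i
  proof (rule windowI)
    note [simp] = W(1)[OF x]
    have i': "r + i \<le> D x - t" "r + i \<le> D x" using i W(2)[OF x] by linarith+
    show "s (r + i) x \<in> U" "r + t \<le> D (s (r + i) x)" using i' W[OF x] by (simp_all add: cell_simps)
    fix l
    show "d l (s (r + i) x) = st (D (s (r + i) x) - 1) (D' (s (r + i) x))" if "l < r"
    proof -
      have "d l (s (r + i) x) = s (r + i - 1) (d l x)"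
        using that i' by (intro fst.d_s_less) auto
      then show ?thesis using that i' W[OF x] windowD(3)[OF x, of l] by (simp add: cell_simps)
    qed
    show "d l (s (r + i) x) = st (D (s (r + i) x) - 1) (D' (s (r + i) x))"
      if l: "l \<le> D (s (r + i) x)" "D (s (r + i) x) - t < l"
    proof -
      have l': "l \<le> Suc (D x)" "D x - t < l - 1" "Suc (r + i) < l" "0 < D x"
        using that i' W[OF x] by (auto simp: cell_simps)
      have "d l (s (r + i) x) = s (r + i) (d (l - 1) x)"
        using l' by (intro fst.d_s_greater) auto
      also have "d (l - 1) x = st (D x - 1) (D' x)" using windowD(3)[OF x, of "l - 1"] l' by simp
      finally show ?thesis using i' l' by (simp add: cell_simps)
    qed
  qed
  have d'_in: "d' j x \<in> ?W" if x: "x \<in> ?W" and j: "0 < D' x" "j \<le> D' x" for x j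
  proof -
    note [simp] = W(1)[OF x]
    have "d l (d' j x) = st (D (d' j x) - 1) (D' (d' j x))"
      if "l \<le> D x" "l < r \<or> D x - t < l" for l
    proof -
      have "0 < D x" using that W[OF x] by auto
      then have "d l (d' j x) = d' j (d l x)" using j that by (simp add: cell_simps)
      then show ?thesis using windowD(3)[OF x that] j \<open>0 < D x\<close> by (simp add: cell_simps)
    qed
    then show ?thesis using j W[OF x] by (intro windowI) (auto simp: cell_simps)
  qed
  have s'_in: "s' j x \<in> ?W" if x: "x \<in> ?W" and j: "j \<le> D' x" for x j
  proof -
    note [simp] = W(1)[OF x]
    have "d l (s' j x) = st (D (s' j x) - 1) (D' (s' j x))"
      if "l \<le> D x" "l < r \<or> D x - t < l" for l
    proof -
      have "0 < D x" using that W[OF x] by auto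
      then have "d l (s' j x) = s' j (d l x)" using j that by (simp add: cell_simps)
      then show ?thesis using windowD(3)[OF x that] j \<open>0 < D x\<close> by (simp add: cell_simps)
    qed
    then show ?thesis using j W[OF x] by (intro windowI) (auto simp: cell_simps)
  qed
  interpret W1: simplicial_direction ?W ?D "\<lambda>i. d (r + i)" "\<lambda>i. s (r + i)"
  proof (unfold_locales, goal_cases)
    case (1 x i) then show ?case by (rule d_in)
  next
    case (2 x i) then show ?case using W[of x] le[of x i] by (simp add: cell_simps)
  next
    case (3 x i) then show ?case by (rule s_in)
  next
    case (4 x i) then show ?case using W[of x] le[of x i] by (simp add: cell_simps)
  next
    case (5 x i j) then show ?case using W[of x] le[of x j] fst.d_d[of x "r + i" "r + j"] by simp
  next
    case (6 x i j) then show ?case using W[of x] le[of x j] fst.d_s_less[of x "r + i" "r + j"]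
      by simp
  next
    case (7 x i) then show ?case using W[of x] le[of x i] fst.d_s_same[of x "r + i"] by simp
  next
    case (8 x i) then show ?case using W[of x] le[of x i] fst.d_s_Suc[of x "r + i"] by simp
  next
    case (9 x j i) then show ?case using W[of x] le[of x j] fst.d_s_greater[of x "r + j" "r + i"]
      by simp
  next
    case (10 x i j) then show ?case using W[of x] le[of x j] fst.s_s[of x "r + i" "r + j"] by simp
  qed
  interpret W2: simplicial_direction ?W D' d' s'
  proof (unfold_locales, goal_cases)
    case (1 x i) then show ?case by (rule d'_in)
  next
    case (3 x i) then show ?case by (rule s'_in)
  next
    case (10 x i j) then show ?case using W(1)[of x] snd.s_s by blast
  qed (use W(1) in \<open>simp_all add: cell_simps\<close>)
  interpret W3: commuting_directions ?W ?D D' "\<lambda>i. d (r + i)" "\<lambda>i. s (r + i)" d' s'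
    by (unfold_locales; frule W(1); frule W(2); simp add: le cell_simps)
  have st_W: "st (r + a + t) b \<in> ?W" for a b
    by (rule windowI) (auto simp: cell_simps)
  interpret W4: base_cells ?W ?D D' "\<lambda>i. d (r + i)" "\<lambda>i. s (r + i)" "\<lambda>a b. st (r + a + t) b"
    by unfold_locales (auto simp: cell_simps st_W)
  interpret W5: base_cells ?W D' ?D d' s' "\<lambda>b a. st (r + a + t) b"
    by unfold_locales (auto simp: cell_simps st_W)
  have "horn_filling ?W ?D D' (\<lambda>i. d (r + i)) d'"
    unfolding horn_filling_def
  proof (intro allI impI, goal_cases)
    case (1 M N k l F G)
    note MN = 1(1-4) and F = 1(5)[rule_format] and G = 1(6)[rule_format]
      and FF = 1(7)[rule_format] and GG = 1(8)[rule_format] and FG = 1(9)[rule_format]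
    let ?M = "r + M + t"
    define F' where "F' i = (if i < r \<or> r + M < i then st (?M - 1) N else F (i - r))" for i
    have F': "F' i = st (?M - 1) N" if "i < r \<or> r + M < i" for i using that by (auto simp: F'_def)
    have F'F: "F' i = F (i - r)" if "r \<le> i" "i \<le> r + M" for i using that by (auto simp: F'_def)
    have FW: "F i \<in> U" "D (F i) = ?M - 1" "D' (F i) = N" if "i \<le> M" "i \<noteq> k" for i
      using F[OF that] W[of "F i"] MN by auto
    have GW: "G i \<in> U" "D (G i) = ?M" "D' (G i) = N - 1" if "i \<le> N" "i \<noteq> l" for i
      using G[OF that] W[of "G i"] MN by auto
    have "\<exists>x\<in>U. D x = ?M \<and> D' x = N \<and> (\<forall>i\<le>?M. i \<noteq> r + k \<longrightarrow> d i x = F' i) \<and>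
      (\<forall>j\<le>N. j \<noteq> l \<longrightarrow> d' j x = G j)"
    proof (rule fill[unfolded horn_filling_def, rule_format], goal_cases)
      case 1 then show ?case using MN by simp
    next
      case 2 then show ?case using MN by simp
    next
      case 3 then show ?case using MN by simp
    next
      case 4 then show ?case using MN by simp
    next
      case (5 i)
      then show ?case
        using FW[of "i - r"] MN by (cases "i < r \<or> r + M < i") (auto simp: F' F'F cell_simps)
    next
      case (6 j) then show ?case using GW by blast
    next
      case (7 i j)
      have M1: "1 < ?M" if "i < r \<or> r + M < j" using that MN 7 by auto
      consider "j < r \<or> r + M < i" | "i < r" "r \<le> j" "j \<le> r + M" | "i < r" "r + M < j"
        | "r \<le> i" "i \<le> r + M" "r + M < j" | "r \<le> i" "j \<le> r + M"
        using 7 by linarith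
      then show ?case
      proof cases
        case 1
        then have "F' i = st (?M - 1) N" "F' j = st (?M - 1) N" using 7(1) by (auto simp: F')
        moreover have "1 < ?M" using 1 7 MN by auto
        ultimately show ?thesis using 7 by (simp add: cell_simps)
      next
        case 2
        then have j: "j - r \<le> M" "j - r \<noteq> k" using 7 by auto
        have "d i (F (j - r)) = st (?M - 1 - 1) N"
          using windowD(3)[of "F (j - r)" r t i] F[OF j] FW[OF j] 2 by simp
        moreover have "d (j - 1) (F' i) = st (?M - 1 - 1) N"
          using 2 M1 7 by (simp add: F' cell_simps)
        ultimately show ?thesis using 2 by (simp add: F'F)
      next
        case 3
        then show ?thesis using 7 M1 by (simp add: F' cell_simps)
      next
        case 4
        then have i: "i - r \<le> M" "i - r \<noteq> k" using 7 by auto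
        have "d (j - 1) (F (i - r)) = st (?M - 1 - 1) N"
        proof -
          have "j - 1 \<le> ?M - 1" "?M - 1 - t < j - 1" using 4 7 MN by linarith+
          then show ?thesis
            using windowD(3)[of "F (i - r)" r t "j - 1"] F[OF i] FW[OF i] by simp
        qed
        moreover have "d i (F' j) = st (?M - 1 - 1) N"
          using 4 M1 7 by (simp add: F' cell_simps)
        ultimately show ?thesis using 4 by (simp add: F'F)
      next
        case 5
        then show ?thesis using FF[of "i - r" "j - r"] 7 by (simp add: F'F)
      qed
    next
      case (8 i j) then show ?case using GG by blast
    next
      case (9 i j)
      show ?case
      proof (cases "i < r \<or> r + M < i")
        case True
        have "d i (G j) = st (?M - 1) (N - 1)"
          using windowD(3)[of "G j" r t i] G[of j] GW[of j] True 9 by simp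
        then show ?thesis using 9 MN True by (simp add: F' cell_simps)
      next
        case False
        then have "i - r \<le> M" "i - r \<noteq> k" "r + (i - r) = i" using 9 by auto
        then show ?thesis using FG[of "i - r" j] 9 False by (simp add: F'F)
      qed
    qed
    then obtain x where x: "x \<in> U" "D x = ?M" "D' x = N"
      "\<And>i. i \<le> ?M \<Longrightarrow> i \<noteq> r + k \<Longrightarrow> d i x = F' i" "\<And>j. j \<le> N \<Longrightarrow> j \<noteq> l \<Longrightarrow> d' j x = G j" by blast
    have "x \<in> ?W" using x MN by (intro windowI) (auto simp: F')
    then show ?case using x F'F by (intro bexI[of _ x]) auto
  qed
  then show ?thesis by unfold_locales
qed

end

section \<open>The product in dimensions one and one\<close>

lemma all_le_2: "(\<forall>i\<le>(2::nat). P i) \<longleftrightarrow> P 0 \<and> P 1 \<and> P 2"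
  by (auto simp: numeral_2_eq_2 le_Suc_eq)

lemma all_le_3: "(\<forall>i\<le>(3::nat). P i) \<longleftrightarrow> P 0 \<and> P 1 \<and> P 2 \<and> P 3"
  by (auto simp: eval_nat_numeral le_Suc_eq)

lemma all_less_le_2: "(\<forall>i j. i < j \<longrightarrow> j \<le> (2::nat) \<longrightarrow> P i j) \<longleftrightarrow> P 0 1 \<and> P 0 2 \<and> P 1 2"
  by (auto simp: numeral_2_eq_2 le_Suc_eq less_Suc_eq)

lemma all_less_le_3: "(\<forall>i j. i < j \<longrightarrow> j \<le> (3::nat) \<longrightarrow> P i j) \<longleftrightarrow>
    P 0 1 \<and> P 0 2 \<and> P 0 3 \<and> P 1 2 \<and> P 1 3 \<and> P 2 3"
  by (auto simp: eval_nat_numeral le_Suc_eq less_Suc_eq)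

lemma all_le_1: "(\<forall>i\<le>(1::nat). P i) \<longleftrightarrow> P 0 \<and> P 1"
  by (auto simp: le_Suc_eq)

lemma all_less_le_1: "(\<forall>i j. i < j \<longrightarrow> j \<le> (1::nat) \<longrightarrow> P i j) \<longleftrightarrow> P 0 1"
  by (auto simp: le_Suc_eq)

lemmas bounded_all_simps = all_le_1[simplified] all_less_le_1[simplified] all_le_2 all_le_3 all_less_le_2 all_less_le_3

context fibrant_cells
begin

lemma fill_ex:
  assumes "0 < M" "0 < N" "k \<le> M" "l \<le> N"
    "\<forall>i\<le>M. i \<noteq> k \<longrightarrow> F i \<in> U \<and> D (F i) = M - 1 \<and> D' (F i) = N"
    "\<forall>j\<le>N. j \<noteq> l \<longrightarrow> G j \<in> U \<and> D (G j) = M \<and> D' (G j) = N - 1"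
    "\<forall>i j. i < j \<longrightarrow> j \<le> M \<longrightarrow> i \<noteq> k \<longrightarrow> j \<noteq> k \<longrightarrow> d i (F j) = d (j - 1) (F i)"
    "\<forall>i j. i < j \<longrightarrow> j \<le> N \<longrightarrow> i \<noteq> l \<longrightarrow> j \<noteq> l \<longrightarrow> d' i (G j) = d' (j - 1) (G i)"
    "\<forall>i\<le>M. \<forall>j\<le>N. i \<noteq> k \<longrightarrow> j \<noteq> l \<longrightarrow> d' j (F i) = d i (G j)"
  shows "\<exists>x. x \<in> U \<and> D x = M \<and> D' x = N \<and>
    (\<forall>i\<le>M. i \<noteq> k \<longrightarrow> d i x = F i) \<and> (\<forall>j\<le>N. j \<noteq> l \<longrightarrow> d' j x = G j)"
  by (rule fill[unfolded horn_filling_def Bex_def, rule_format]) (use assms in simp_all)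

text \<open>Cells of dimensions \<open>(1,1)\<close> with trivial boundary, the fillers for two of them, and the
  product as a relation between two factors and a value: the case \<open>m = n = 1\<close> of the Bott-Chern
  product.\<close>

definition sphere where
  "sphere x \<longleftrightarrow> x \<in> U \<and> D x = 1 \<and> D' x = 1 \<and>
     d 0 x = st 0 1 \<and> d 1 x = st 0 1 \<and> d' 0 x = st 1 0 \<and> d' 1 x = st 1 0"

definition filler where
  "filler a b x \<longleftrightarrow> x \<in> U \<and> D x = 2 \<and> D' x = 2 \<and>
     d 0 x = s' 0 a \<and> d' 0 x = s 0 a \<and> d 2 x = s' 1 b \<and> d' 2 x = s 1 b"

definition product_rel where
  "product_rel a b c \<longleftrightarrow> sphere a \<and> sphere b \<and> (\<exists>x. filler a b x \<and> c = d 1 (d' 1 x))"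

lemmas rel_simps = cell_simps sphere_def filler_def

lemma filler_exists:
  assumes "sphere a" "sphere b"
  shows "\<exists>x. filler a b x"
proof -
  have "\<exists>x. x \<in> U \<and> D x = 2 \<and> D' x = 2 \<and>
    (\<forall>i\<le>2. i \<noteq> 1 \<longrightarrow> d i x = [s' 0 a, undefined, s' 1 b] ! i) \<and>
    (\<forall>j\<le>2. j \<noteq> 1 \<longrightarrow> d' j x = [s 0 a, undefined, s 1 b] ! j)"
    by (rule fill_ex) (use assms in \<open>simp_all add: bounded_all_simps rel_simps\<close>)
  then show ?thesis by (auto simp: filler_def bounded_all_simps)
qed

lemma product_rel_sphere:
  assumes "product_rel a b c"
  shows "sphere c"
proof -
  obtain x where x: "filler a b x" "c = d 1 (d' 1 x)" and ab: "sphere a" "sphere b"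
    using assms by (auto simp: product_rel_def)
  note x' = x(1)[unfolded filler_def One_nat_def]
  have "d 1 (d 1 x) = d 1 (d 2 x)" "d' 1 (d' 1 (d 1 x)) = d' 1 (d' 2 (d 1 x))"
    using fst.d_d[of x 1 2] snd.d_d[of "d 1 x" 1 2] x' by (simp_all add: cell_simps)
  moreover have "d' 0 (d 1 x) = d 1 (d' 0 x)" "d' 2 (d 1 x) = d 1 (d' 2 x)"
    using d_d'[of x 1 0] d_d'[of x 1 2] x' by simp_all
  ultimately show ?thesis using x ab by (simp add: rel_simps)
qed

lemma product_rel_unit_left:
  assumes "sphere a"
  shows "product_rel (st 1 1) a a"
proof -
  have "filler (st 1 1) a (s 1 (s' 1 a))" "a = d 1 (d' 1 (s 1 (s' 1 a)))"
    using assms by (simp_all add: rel_simps)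
  moreover have "sphere (st 1 1)" by (simp add: rel_simps)
  ultimately show ?thesis using assms unfolding product_rel_def by blast
qed

lemma product_rel_unit_right:
  assumes "sphere a"
  shows "product_rel a (st 1 1) a"
proof -
  have "filler a (st 1 1) (s 0 (s' 0 a))" "a = d 1 (d' 1 (s 0 (s' 0 a)))"
    using assms by (simp_all add: rel_simps)
  moreover have "sphere (st 1 1)" by (simp add: rel_simps)
  ultimately show ?thesis using assms unfolding product_rel_def by blast
qed

text \<open>The next two lemmas fill the horns in dimensions \<open>(2,3)\<close> that lack the face \<open>1\<close> in the
  first direction, and the face \<open>1\<close> or \<open>2\<close> in the second one.\<close>

lemma extend_2_3_inner:
  assumes "x0 \<in> U" "D x0 = 1" "D' x0 = 3" "x2 \<in> U" "D x2 = 1" "D' x2 = 3"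
    "y0 \<in> U" "D y0 = 2" "D' y0 = 2" "y2 \<in> U" "D y2 = 2" "D' y2 = 2" "y3 \<in> U" "D y3 = 2" "D' y3 = 2"
    "d 1 x0 = d 0 x2"
    "d' 0 y2 = d' 1 y0" "d' 0 y3 = d' 2 y0" "d' 2 y3 = d' 2 y2"
    "d' 0 x0 = d 0 y0" "d' 2 x0 = d 0 y2" "d' 3 x0 = d 0 y3"
    "d' 0 x2 = d 2 y0" "d' 2 x2 = d 2 y2" "d' 3 x2 = d 2 y3"
  shows "\<exists>x. x \<in> U \<and> D x = 2 \<and> D' x = 3 \<and> d 0 x = x0 \<and> d 2 x = x2 \<and>
    d' 0 x = y0 \<and> d' 2 x = y2 \<and> d' 3 x = y3"
proof -
  have "\<exists>x. x \<in> U \<and> D x = 2 \<and> D' x = 3 \<and>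
    (\<forall>i\<le>2. i \<noteq> 1 \<longrightarrow> d i x = [x0, undefined, x2] ! i) \<and>
    (\<forall>j\<le>3. j \<noteq> 1 \<longrightarrow> d' j x = [y0, undefined, y2, y3] ! j)"
    by (rule fill_ex) (use assms in \<open>simp_all add: bounded_all_simps\<close>)
  then show ?thesis by (auto simp: bounded_all_simps)
qed

lemma extend_2_3_last:
  assumes "x0 \<in> U" "D x0 = 1" "D' x0 = 3" "x2 \<in> U" "D x2 = 1" "D' x2 = 3"
    "y0 \<in> U" "D y0 = 2" "D' y0 = 2" "y1 \<in> U" "D y1 = 2" "D' y1 = 2" "y3 \<in> U" "D y3 = 2" "D' y3 = 2"
    "d 1 x0 = d 0 x2"
    "d' 0 y1 = d' 0 y0" "d' 0 y3 = d' 2 y0" "d' 1 y3 = d' 2 y1"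
    "d' 0 x0 = d 0 y0" "d' 1 x0 = d 0 y1" "d' 3 x0 = d 0 y3"
    "d' 0 x2 = d 2 y0" "d' 1 x2 = d 2 y1" "d' 3 x2 = d 2 y3"
  shows "\<exists>x. x \<in> U \<and> D x = 2 \<and> D' x = 3 \<and> d 0 x = x0 \<and> d 2 x = x2 \<and>
    d' 0 x = y0 \<and> d' 1 x = y1 \<and> d' 3 x = y3"
proof -
  have "\<exists>x. x \<in> U \<and> D x = 2 \<and> D' x = 3 \<and>
    (\<forall>i\<le>2. i \<noteq> 1 \<longrightarrow> d i x = [x0, undefined, x2] ! i) \<and>
    (\<forall>j\<le>3. j \<noteq> 2 \<longrightarrow> d' j x = [y0, y1, undefined, y3] ! j)"
    by (rule fill_ex) (use assms in \<open>simp_all add: bounded_all_simps\<close>)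
  then show ?thesis by (auto simp: bounded_all_simps)
qed

text \<open>Label the edges \<open>01\<close>, \<open>12\<close>, \<open>23\<close> of a tetrahedron with \<open>c\<close>, \<open>b\<close>, \<open>a\<close>, and thus the edges
  \<open>02\<close>, \<open>13\<close>, \<open>03\<close> with the products \<open>n\<close>, \<open>m\<close>, \<open>r\<close>. The cell \<open>x\<close> of dimensions \<open>(3,3)\<close> is built
  such that its corner \<open>d i (d' i x)\<close> is a filler with the labels of the face opposite to the
  vertex \<open>i\<close>. The faces \<open>0\<close> and \<open>3\<close> of \<open>x\<close> are degenerate; the third given face in each
  direction, \<open>p\<close> and \<open>q\<close>, is filled first, and both contain the third given filler \<open>t2\<close>. The
  missing corner is the filler sought.\<close>

lemma product_rel_assoc_right:
  assumes ab: "product_rel a b m" and bc: "product_rel b c n" and mc: "product_rel m c r"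
  shows "product_rel a n r"
proof -
  interpret tr: fibrant_cells U D' D d' s' d s "\<lambda>a b. st b a" by (rule transpose)
  obtain t1 where t1: "filler a b t1" "m = d 1 (d' 1 t1)" using ab by (auto simp: product_rel_def)
  obtain t3 where t3: "filler b c t3" "n = d 1 (d' 1 t3)" using bc by (auto simp: product_rel_def)
  obtain t2 where t2: "filler m c t2" "r = d 1 (d' 1 t2)" using mc by (auto simp: product_rel_def)
  have sph: "sphere a" "sphere b" "sphere c" "sphere m" "sphere n"
    using ab bc mc product_rel_sphere[OF bc] by (simp_all add: product_rel_def)
  note facts = t1(1)[unfolded filler_def One_nat_def] t2(1)[unfolded filler_def One_nat_def] t3(1)[unfolded filler_def One_nat_def]
    sph[unfolded sphere_def One_nat_def]
  note [simp] = facts cell_simps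
  have ss: "s 2 (s 0 b) = s 0 (s 1 b)" "s' 2 (s' 0 b) = s' 0 (s' 1 b)" "s 2 (s 1 c) = s 1 (s 1 c)"
    "s' 2 (s' 1 c) = s' 1 (s' 1 c)"
    using fst.s_s[of b 0 1] snd.s_s[of b 0 1] fst.s_s[of c 1 1] snd.s_s[of c 1 1]
    by (simp_all add: numeral_2_eq_2)
  \<comment> \<open>The face \<open>1\<close> of a filler, in either direction, has the two factors and the value as its
    faces.\<close>
  have tt1: "d' 0 (d 1 t1) = a" "d' 2 (d 1 t1) = b" "d' 1 (d 0 t1) = a" "d' 1 (d 2 t1) = b"
    "d' 1 (d 1 t1) = m"
    using d_d'[of t1 1 0] d_d'[of t1 1 2] t1(2) by simp_all
  have tt2: "d 1 (d 1 t1) = st 0 (Suc (Suc 0))" using fst.d_d[of t1 1 2] by simp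
  have tt3: "d' 1 (d' 1 t1) = st (Suc (Suc 0)) 0" using snd.d_d[of t1 1 2] by simp
  note tt = tt1 tt2 tt3
  have "\<exists>p. p \<in> U \<and> D p = 2 \<and> D' p = 3 \<and> d 0 p = s' 0 (d 1 t1) \<and> d 2 p = s' 1 (s' 1 c) \<and>
      d' 0 p = s 0 (d 1 t1) \<and> d' 2 p = t2 \<and> d' 3 p = t3"
    by (rule extend_2_3_inner) (use tt in simp_all)
  then obtain p where p: "p \<in> U" "D p = 2" "D' p = 3" "d 0 p = s' 0 (d 1 t1)"
    "d 2 p = s' 1 (s' 1 c)"
      "d' 0 p = s 0 (d 1 t1)" "d' 2 p = t2" "d' 3 p = t3" by blast
  have "\<exists>q. q \<in> U \<and> D' q = 2 \<and> D q = 3 \<and> d' 0 q = s 0 (d' 1 t1) \<and> d' 2 q = s 1 (s 1 c) \<and>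
      d 0 q = s' 0 (d' 1 t1) \<and> d 2 q = t2 \<and> d 3 q = t3"
    by (rule tr.extend_2_3_inner) (use tt in simp_all)
  then obtain q where q: "q \<in> U" "D q = 3" "D' q = 2" "d' 0 q = s 0 (d' 1 t1)"
    "d' 2 q = s 1 (s 1 c)"
      "d 0 q = s' 0 (d' 1 t1)" "d 2 q = t2" "d 3 q = t3" by blast
  have "\<exists>x. x \<in> U \<and> D x = 3 \<and> D' x = 3 \<and>
    (\<forall>i\<le>3. i \<noteq> 1 \<longrightarrow> d i x = [s' 0 t1, undefined, p, s' 2 t3] ! i) \<and>
    (\<forall>j\<le>3. j \<noteq> 1 \<longrightarrow> d' j x = [s 0 t1, undefined, q, s 2 t3] ! j)"
    by (rule fill_ex) (use p q ss tt in \<open>simp_all add: bounded_all_simps\<close>)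
  then obtain x where x: "x \<in> U" "D x = 3" "D' x = 3" "d 0 x = s' 0 t1" "d 2 x = p"
    "d 3 x = s' 2 t3"
      "d' 0 x = s 0 t1" "d' 2 x = q" "d' 3 x = s 2 t3"
    by (auto simp: bounded_all_simps)
  have xr: "d 0 (d 1 x) = d 0 (d 0 x)" "d 2 (d 1 x) = d 1 (d 3 x)" "d 1 (d 1 x) = d 1 (d 2 x)"
    "d' 0 (d' 1 x) = d' 0 (d' 0 x)" "d' 2 (d' 1 x) = d' 1 (d' 3 x)" "d' 1 (d' 1 x) = d' 1 (d' 2 x)"
    using fst.d_d[of x 0 1] fst.d_d[of x 1 3] fst.d_d[of x 1 2]
      snd.d_d[of x 0 1] snd.d_d[of x 1 3] snd.d_d[of x 1 2] x(1-3) by (simp_all del: cell_simps)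
  let ?t = "d 1 (d' 1 x)"
  have "d 0 ?t = d' 1 (d 0 (d 0 x))" "d 2 ?t = d' 1 (d 1 (d 3 x))" "d 1 ?t = d' 1 (d 1 (d 2 x))"
    using x(1-3) by (simp_all add: xr[unfolded One_nat_def] del: fst.d_d snd.d_d)
  moreover have
    "d' 0 ?t = d 1 (d' 0 (d' 0 x))" "d' 2 ?t = d 1 (d' 1 (d' 3 x))" "d' 1 ?t = d 1 (d' 1 (d' 2 x))"
    using d_d'[of "d' 1 x" 1 0] d_d'[of "d' 1 x" 1 1] d_d'[of "d' 1 x" 1 2]
      xr x(1-3)
    by (simp_all del: d_d' fst.d_d snd.d_d)
  ultimately have "filler a n ?t" "r = d 1 (d' 1 ?t)"
    using t2(2) t3(2) x p q ss fst.d_d[of q 1 2] by (simp_all add: filler_def)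
  then show ?thesis using sph unfolding product_rel_def by blast
qed

text \<open>The same tetrahedron, with the corner opposite to the vertex \<open>1\<close> given and the one
  opposite to the vertex \<open>2\<close> missing.\<close>

lemma product_rel_assoc_left:
  assumes ab: "product_rel a b m" and bc: "product_rel b c n" and an: "product_rel a n r"
  shows "product_rel m c r"
proof -
  interpret tr: fibrant_cells U D' D d' s' d s "\<lambda>a b. st b a" by (rule transpose)
  obtain t1 where t1: "filler a b t1" "m = d 1 (d' 1 t1)" using ab by (auto simp: product_rel_def)
  obtain t3 where t3: "filler b c t3" "n = d 1 (d' 1 t3)" using bc by (auto simp: product_rel_def)
  obtain t2 where t2: "filler a n t2" "r = d 1 (d' 1 t2)" using an by (auto simp: product_rel_def)
  have sph: "sphere a" "sphere b" "sphere c" "sphere m" "sphere n"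
    using ab bc an product_rel_sphere[OF ab] by (simp_all add: product_rel_def)
  note facts = t1(1)[unfolded filler_def One_nat_def] t2(1)[unfolded filler_def One_nat_def] t3(1)[unfolded filler_def One_nat_def]
    sph[unfolded sphere_def One_nat_def]
  note [simp] = facts cell_simps
  have ss: "s 2 (s 0 b) = s 0 (s 1 b)" "s' 2 (s' 0 b) = s' 0 (s' 1 b)" "s 1 (s 0 a) = s 0 (s 0 a)"
    "s' 1 (s' 0 a) = s' 0 (s' 0 a)"
    using fst.s_s[of b 0 1] snd.s_s[of b 0 1] fst.s_s[of a 0 0] snd.s_s[of a 0 0]
    by (simp_all add: numeral_2_eq_2)
  \<comment> \<open>The face \<open>1\<close> of a filler, in either direction, has the two factors and the value as its
    faces.\<close>
  have tt1: "d' 0 (d 1 t3) = b" "d' 2 (d 1 t3) = c" "d' 1 (d 0 t3) = b" "d' 1 (d 2 t3) = c"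
    "d' 1 (d 1 t3) = n"
    using d_d'[of t3 1 0] d_d'[of t3 1 2] t3(2) by simp_all
  have tt2: "d 1 (d 1 t3) = st 0 (Suc (Suc 0))" using fst.d_d[of t3 1 2] by simp
  have tt3: "d' 1 (d' 1 t3) = st (Suc (Suc 0)) 0" using snd.d_d[of t3 1 2] by simp
  note tt = tt1 tt2 tt3
  have "\<exists>p. p \<in> U \<and> D p = 2 \<and> D' p = 3 \<and> d 0 p = s' 0 (s' 0 a) \<and> d 2 p = s' 2 (d 1 t3) \<and>
      d' 0 p = t1 \<and> d' 1 p = t2 \<and> d' 3 p = s 1 (d 1 t3)"
    by (rule extend_2_3_last) (use tt in simp_all)
  then obtain p where p: "p \<in> U" "D p = 2" "D' p = 3" "d 0 p = s' 0 (s' 0 a)"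
    "d 2 p = s' 2 (d 1 t3)"
      "d' 0 p = t1" "d' 1 p = t2" "d' 3 p = s 1 (d 1 t3)" by blast
  have "\<exists>q. q \<in> U \<and> D' q = 2 \<and> D q = 3 \<and> d' 0 q = s 0 (s 0 a) \<and> d' 2 q = s 2 (d' 1 t3) \<and>
      d 0 q = t1 \<and> d 1 q = t2 \<and> d 3 q = s' 1 (d' 1 t3)"
    by (rule tr.extend_2_3_last) (use tt in simp_all)
  then obtain q where q: "q \<in> U" "D q = 3" "D' q = 2" "d' 0 q = s 0 (s 0 a)"
    "d' 2 q = s 2 (d' 1 t3)"
      "d 0 q = t1" "d 1 q = t2" "d 3 q = s' 1 (d' 1 t3)" by blast
  have "\<exists>x. x \<in> U \<and> D x = 3 \<and> D' x = 3 \<and>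
    (\<forall>i\<le>3. i \<noteq> 2 \<longrightarrow> d i x = [s' 0 t1, p, undefined, s' 2 t3] ! i) \<and>
    (\<forall>j\<le>3. j \<noteq> 2 \<longrightarrow> d' j x = [s 0 t1, q, undefined, s 2 t3] ! j)"
    by (rule fill_ex) (use p q ss tt in \<open>simp_all add: bounded_all_simps\<close>)
  then obtain x where x: "x \<in> U" "D x = 3" "D' x = 3" "d 0 x = s' 0 t1" "d 1 x = p"
    "d 3 x = s' 2 t3"
      "d' 0 x = s 0 t1" "d' 1 x = q" "d' 3 x = s 2 t3"
    by (auto simp: bounded_all_simps)
  have xr: "d 0 (d 2 x) = d 1 (d 0 x)" "d 2 (d 2 x) = d 2 (d 3 x)" "d 1 (d 2 x) = d 1 (d 1 x)"
    "d' 0 (d' 2 x) = d' 1 (d' 0 x)" "d' 2 (d' 2 x) = d' 2 (d' 3 x)" "d' 1 (d' 2 x) = d' 1 (d' 1 x)"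
    using fst.d_d[of x 0 2] fst.d_d[of x 2 3] fst.d_d[of x 1 2]
      snd.d_d[of x 0 2] snd.d_d[of x 2 3] snd.d_d[of x 1 2] x(1-3) by (simp_all del: cell_simps)
  let ?t = "d 2 (d' 2 x)"
  have "d 0 ?t = d' 2 (d 1 (d 0 x))" "d 2 ?t = d' 2 (d 2 (d 3 x))" "d 1 ?t = d' 2 (d 1 (d 1 x))"
    using x(1-3) by (simp_all add: xr[unfolded One_nat_def] del: fst.d_d snd.d_d)
  moreover have
    "d' 0 ?t = d 2 (d' 1 (d' 0 x))" "d' 2 ?t = d 2 (d' 2 (d' 3 x))" "d' 1 ?t = d 2 (d' 1 (d' 1 x))"
    using d_d'[of "d' 2 x" 2 0] d_d'[of "d' 2 x" 2 1] d_d'[of "d' 2 x" 2 2] xr x(1-3)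
    by (simp_all del: d_d' fst.d_d snd.d_d)
  ultimately have "filler m c ?t" "r = d 1 (d' 1 ?t)"
    using t1(2) t2(2) x p q ss d_d'[of p 1 1] by (simp_all add: filler_def)
  then show ?thesis using sph unfolding product_rel_def by blast
qed

end

section \<open>Collapsing prisms\<close>

context fibrant_cells
begin

text \<open>Windows in both directions.\<close>

definition window2 :: "nat \<Rightarrow> nat \<Rightarrow> nat \<Rightarrow> nat \<Rightarrow> 'c set" where
  "window2 r t j u = {x \<in> U. r + t \<le> D x \<and> j + u \<le> D' x \<and>
     (\<forall>i\<le>D x. i < r \<or> D x - t < i \<longrightarrow> d i x = st (D x - 1) (D' x)) \<and>
     (\<forall>i\<le>D' x. i < j \<or> D' x - u < i \<longrightarrow> d' i x = st (D x) (D' x - 1))}"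

lemma window2_fibrant_cells:
  "fibrant_cells (window2 r t j u) (\<lambda>x. D x - r - t) (\<lambda>x. D' x - j - u)
     (\<lambda>i. d (r + i)) (\<lambda>i. s (r + i)) (\<lambda>i. d' (j + i)) (\<lambda>i. s' (j + i))
     (\<lambda>a b. st (r + a + t) (j + b + u))"
proof -
  interpret W: fibrant_cells "window r t" "\<lambda>x. D x - r - t" D' "\<lambda>i. d (r + i)" "\<lambda>i. s (r + i)" d' s'
      "\<lambda>a b. st (r + a + t) b"
    by (rule window_fibrant_cells)
  interpret WT: fibrant_cells "window r t" D' "\<lambda>x. D x - r - t" d' s' "\<lambda>i. d (r + i)"
    "\<lambda>i. s (r + i)"
      "\<lambda>b a. st (r + a + t) b"
    by (rule W.transpose)
  have "WT.window j u = window2 r t j u"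
    unfolding WT.window_def window2_def by (auto simp: window_def)
  then show ?thesis
    using fibrant_cells.transpose[OF WT.window_fibrant_cells[of j u]] by simp
qed

text \<open>In the first direction, \<open>x\<close> has the faces \<open>(*, e, b)\<close> and \<open>y\<close> has the faces \<open>(a, e, *)\<close>.
  They are faces \<open>1\<close> and \<open>2\<close> of a tetrahedron, and the other two faces are \<open>(*, a, b)\<close> and
  \<open>(b, b, *)\<close>, where the first is missing (\<open>k = 0\<close>), or \<open>(*, a, a)\<close> and \<open>(a, b, *)\<close>, where the
  second is missing (\<open>k = 3\<close>). In the second direction the face \<open>0\<close> of the tetrahedron is
  prescribed and the face \<open>1\<close> is missing.\<close>

lemma lift_prism:
  fixes k :: nat
  assumes x: "x \<in> U" "D x = 2" "D' x = 1" and y: "y \<in> U" "D y = 2" "D' y = 1"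
    and xy: "d 0 x = st 1 1" "d 2 y = st 1 1" "d 1 x = d 1 y"
    and w: "w \<in> U" "D w = 3" "D' w = 0" "k \<noteq> 0 \<Longrightarrow> d 0 w = s 1 (d' 0 (d 0 y))"
      "d 1 w = d' 0 x" "d 2 w = d' 0 y" "k \<noteq> 3 \<Longrightarrow> d 3 w = s 0 (d' 0 (d 2 x))"
    and k: "k = 0 \<or> k = 3"
  shows "\<exists>z. z \<in> U \<and> D z = 3 \<and> D' z = 1 \<and> d 1 z = x \<and> d 2 z = y \<and> d' 0 z = w \<and>
    (k \<noteq> 0 \<longrightarrow> d 0 z = s 1 (d 0 y)) \<and> (k \<noteq> 3 \<longrightarrow> d 3 z = s 0 (d 2 x))"
proof -
  note [simp] = x y xy[unfolded One_nat_def] cell_simps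
  have "d 0 (d 0 y) = st 0 1" using fst.d_d[of y 0 1] fst.d_d[of x 0 1] by simp
  moreover have "d 1 (d 1 y) = st 0 1" using fst.d_d[of y 1 2] by simp
  moreover have "d 1 (d 2 x) = d 1 (d 1 y)" using fst.d_d[of x 1 2] by simp
  moreover have "d 0 (d' 0 y) = d' 0 (d 0 y)" "d 2 (d' 0 x) = d' 0 (d 2 x)" by simp_all
  ultimately have "\<exists>z. z \<in> U \<and> D z = 3 \<and> D' z = 1 \<and>
    (\<forall>i\<le>3. i \<noteq> k \<longrightarrow> d i z = [s 1 (d 0 y), x, y, s 0 (d 2 x)] ! i) \<and>
    (\<forall>j\<le>1. j \<noteq> 1 \<longrightarrow> d' j z = [w, undefined] ! j)"
    by (intro fill_ex) (use w k in \<open>auto simp: bounded_all_simps\<close>)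
  then obtain z where "z \<in> U" "D z = 3" "D' z = 1"
    "\<forall>i\<le>3. i \<noteq> k \<longrightarrow> d i z = [s 1 (d 0 y), x, y, s 0 (d 2 x)] ! i" "d' 0 z = w" by auto
  then show ?thesis using k
    by (intro exI[of _ z]) (auto simp: all_le_3 simp del: cell_simps xy x y)
qed

text \<open>A cell of dimensions \<open>(m + 1, N)\<close> that joins two cells, its faces \<open>r\<close> and \<open>r + 1\<close>, in the
  first direction, and its faces \<open>j\<close> and \<open>j + 1\<close> in the second direction; the other faces are
  base cells.\<close>

definition prism_cell :: "nat \<Rightarrow> nat \<Rightarrow> nat \<Rightarrow> nat \<Rightarrow> 'c \<Rightarrow> bool" where
  "prism_cell m N r j z \<longleftrightarrow> z \<in> U \<and> D z = Suc m \<and> D' z = N \<and>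
     (\<forall>l\<le>Suc m. l \<noteq> r \<and> l \<noteq> Suc r \<longrightarrow> d l z = st m N) \<and>
     (\<forall>l\<le>N. l \<noteq> j \<and> l \<noteq> Suc j \<longrightarrow> d' l z = st (Suc m) (N - 1))"

text \<open>The tetrahedron of \<open>lift_prism\<close>, with the vertices \<open>r\<close> to \<open>r + 3\<close> of \<open>[m + 2]\<close> as its
  vertices.\<close>

definition prism_filler :: "nat \<Rightarrow> nat \<Rightarrow> nat \<Rightarrow> nat \<Rightarrow> nat \<Rightarrow> 'c \<Rightarrow> 'c \<Rightarrow> 'c \<Rightarrow> bool" where
  "prism_filler k m N r j x y z \<longleftrightarrow> z \<in> U \<and> D z = m + 2 \<and> D' z = N \<and>
     d (r + 1) z = x \<and> d (r + 2) z = y \<and>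
     (k \<noteq> 0 \<longrightarrow> d r z = s (Suc r) (d r y)) \<and> (k \<noteq> 3 \<longrightarrow> d (r + 3) z = s r (d (r + 2) x)) \<and>
     (\<forall>l\<le>m + 2. l < r \<or> r + 3 < l \<longrightarrow> d l z = st (Suc m) N) \<and>
     (\<forall>l\<le>N. l \<noteq> j \<and> l \<noteq> Suc j \<longrightarrow> d' l z = st (m + 2) (N - 1))"

lemma lift_column:
  fixes k :: nat
  assumes r: "r < m" and j: "j < N"
    and x: "prism_cell m N (Suc r) j x" and y: "prism_cell m N r j y"
      and xy: "d (Suc r) x = d (Suc r) y"
    and w: "w \<in> U" "D w = m + 2" "D' w = N - 1"
      "\<And>l. l < r \<Longrightarrow> d l w = st (Suc m) (N - 1)"
      "\<And>l. l \<le> m + 2 \<Longrightarrow> r + 3 < l \<Longrightarrow> d l w = st (Suc m) (N - 1)"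
      "\<And>l. l \<le> N - 1 \<Longrightarrow> l \<noteq> j \<Longrightarrow> d' l w = st (m + 2) (N - 1 - 1)"
      "k \<noteq> 0 \<Longrightarrow> d r w = s (Suc r) (d' j (d r y))"
      "d (r + 1) w = d' j x" "d (r + 2) w = d' j y"
      "k \<noteq> 3 \<Longrightarrow> d (r + 3) w = s r (d' j (d (r + 2) x))"
    and k: "k = 0 \<or> k = 3"
  shows "\<exists>z. prism_filler k m N r j x y z \<and> d' j z = w"
proof -
  let ?t = "m - 1 - r" and ?u = "N - 1 - j"
  let ?W = "window2 r ?t j ?u"
  interpret Z: fibrant_cells ?W "\<lambda>x. D x - r - ?t" "\<lambda>x. D' x - j - ?u"
     "\<lambda>i. d (r + i)" "\<lambda>i. s (r + i)" "\<lambda>i. d' (j + i)" "\<lambda>i. s' (j + i)"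
     "\<lambda>a b. st (r + a + ?t) (j + b + ?u)"
    by (rule window2_fibrant_cells)
  note px = x[unfolded prism_cell_def] and py = y[unfolded prism_cell_def]
  have "x \<in> ?W" "y \<in> ?W" using px py r j by (auto simp: window2_def)
  moreover have "w \<in> ?W" using w r j by (auto simp: window2_def)
  moreover have "r + 1 + ?t = m" "j + 1 + ?u = N" using r j by auto
  ultimately have "\<exists>z. z \<in> ?W \<and> D z - r - ?t = 3 \<and> D' z - j - ?u = 1 \<and>
      d (r + 1) z = x \<and> d (r + 2) z = y \<and> d' (j + 0) z = w \<and>
    (k \<noteq> 0 \<longrightarrow> d (r + 0) z = s (r + 1) (d (r + 0) y)) \<and>
      (k \<noteq> 3 \<longrightarrow> d (r + 3) z = s (r + 0) (d (r + 2) x))"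
    using r j px py xy w k by (intro Z.lift_prism) simp_all
  then obtain z where z: "z \<in> ?W" "D z - r - ?t = 3" "D' z - j - ?u = 1"
      "d (r + 1) z = x" "d (r + 2) z = y" "d' j z = w"
    "k \<noteq> 0 \<Longrightarrow> d r z = s (r + 1) (d r y)" "k \<noteq> 3 \<Longrightarrow> d (r + 3) z = s r (d (r + 2) x)" by auto
  have "z \<in> U" "D z = m + 2" "D' z = N" using z(1-3) r j by (auto simp: window2_def)
  moreover have "(\<forall>l\<le>m + 2. l < r \<or> r + 3 < l \<longrightarrow> d l z = st (Suc m) N)"
    "\<forall>l\<le>N. l \<noteq> j \<and> l \<noteq> Suc j \<longrightarrow> d' l z = st (m + 2) (N - 1)"
    using z(1) calculation r j by (auto simp: window2_def)
  ultimately show ?thesis using z unfolding prism_filler_def by (intro exI[of _ z]) auto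
qed

text \<open>In a row of prism cells, the cell in column \<open>j\<close> shares its face \<open>j + 1\<close> in the second
  direction with the next cell. The fillers \<open>W j\<close> are chosen from left to right: the face that
  \<open>W j\<close> shares with \<open>W (j + 1)\<close> is the base over which the latter is filled. At the left end the
  base is a degeneracy of \<open>v\<close>.\<close>

lemma lift_row:
  fixes k :: nat
  assumes r: "r < m" and cN: "c + w < N" and k: "k = 0 \<or> k = 3"
    and v: "v \<in> U" "D v = m" "D' v = N - 1" "\<And>l. l \<le> m \<Longrightarrow> d l v = st (m - 1) (N - 1)"
      "\<And>l. l \<le> N - 1 \<Longrightarrow> 0 < N - 1 \<Longrightarrow> d' l v = st m (N - 1 - 1)"
    and y: "\<And>j. c \<le> j \<Longrightarrow> j \<le> c + w \<Longrightarrow> prism_cell m N r j (y j)"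
      "\<And>j. c \<le> j \<Longrightarrow> j \<le> c + w \<Longrightarrow> d r (y j) = s' j v"
      "\<And>j. c \<le> j \<Longrightarrow> j < c + w \<Longrightarrow> d' (Suc j) (y j) = d' (Suc j) (y (Suc j))"
      "d' c (y c) = s r v"
    and x: "\<And>j. c \<le> j \<Longrightarrow> j \<le> c + w \<Longrightarrow> prism_cell m N (Suc r) j (x j)"
      "\<And>j. c \<le> j \<Longrightarrow> j \<le> c + w \<Longrightarrow> d (Suc r) (x j) = d (Suc r) (y j)"
      "\<And>j. c \<le> j \<Longrightarrow> j < c + w \<Longrightarrow> d' (Suc j) (x j) = d' (Suc j) (x (Suc j))"
      "d' c (x c) = s (Suc r) v"
  shows "\<exists>W. (\<forall>j. c \<le> j \<and> j \<le> c + w \<longrightarrow> prism_filler k m N r j (x j) (y j) (W j)) \<and>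
    (\<forall>j. c \<le> j \<and> j < c + w \<longrightarrow> d' (Suc j) (W j) = d' (Suc j) (W (Suc j))) \<and>
    d' c (W c) = s r (s (Suc r) v)"
proof -
  define P where "P j z \<longleftrightarrow> prism_filler k m N r j (x j) (y j) z" for j z
  note P_defs = P_def prism_filler_def
  define S where "S z \<longleftrightarrow> (\<forall>l\<le>N - 1. 0 < N - 1 \<longrightarrow> d' l z = st (m + 2) (N - 1 - 1))" for z
  \<comment> \<open>\<open>B j z\<close>: over \<open>z\<close>, the filler in column \<open>j\<close> can be constructed. For this purpose \<open>z\<close> must
    have trivial boundary in the second direction, which \<open>S z\<close> says.\<close>
  define B where "B j z \<longleftrightarrow> z \<in> U \<and> D z = m + 2 \<and> D' z = N - 1 \<and>
      (\<forall>l\<le>m + 2. l < r \<or> r + 3 < l \<longrightarrow> d l z = st (Suc m) (N - 1)) \<and> S z \<and>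
      d (r + 1) z = d' j (x j) \<and> d (r + 2) z = d' j (y j) \<and>
      (k \<noteq> 0 \<longrightarrow> d r z = s (Suc r) (d' j (d r (y j)))) \<and>
      (k \<noteq> 3 \<longrightarrow> d (r + 3) z = s r (d' j (d (r + 2) (x j))))" for j z
  have xy_in: "x j \<in> U" "D (x j) = Suc m" "D' (x j) = N" "y j \<in> U" "D (y j) = Suc m" "D' (y j) = N"
    if "c \<le> j" "j \<le> c + w" for j
    using x(1)[OF that] y(1)[OF that] by (auto simp: prism_cell_def)
  have C: "\<exists>z. P j z \<and> d' j z = z'" if j: "c \<le> j" "j \<le> c + w" and B: "B j z'" for j z'
  proof -
    have "j < N" using j cN by simp
    moreover have "l \<le> N - 1 \<Longrightarrow> l \<noteq> j \<Longrightarrow> 0 < N - 1" for l using \<open>j < N\<close> by auto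
    ultimately show ?thesis
      using lift_column[OF r \<open>j < N\<close> x(1)[OF j] y(1)[OF j] x(2)[OF j], of z' k] B k r
      unfolding B_def S_def P_def by auto
  qed
  have A: "B c (s r (s (Suc r) v))"
  proof -
    have c: "c \<le> c" "c \<le> c + w" by auto
    note [simp] = v xy_in[OF c] cell_simps
    have x2: "d' c (d (Suc (Suc r)) (x c)) = v"
      using d_d'[of "x c" "Suc (Suc r)" c] x(4) r cN by simp
    show ?thesis unfolding B_def S_def using r cN y(2)[OF c] y(4) x(4) x2
      by (auto simp: numeral_3_eq_3)
  qed
  have B': "B (Suc j) (d' (Suc j) z)" if j: "c \<le> j" "j < c + w" and z: "P j z" "S (d' j z)" for j z
  proof -
    have j': "c \<le> j" "j \<le> c + w" "c \<le> Suc j" "Suc j \<le> c + w" "Suc j < N" using j cN by auto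
    have z': "z \<in> U" "D z = m + 2" "D' z = N" using z(1) unfolding P_defs by auto
    note [simp] = v xy_in[OF j'(1,2)] xy_in[OF j'(3,4)] cell_simps z' y(2)[OF j'(1,2)] y(2)[OF j'(3,4)]
    have "S (d' (Suc j) z)" unfolding S_def
    proof (intro allI impI)
      fix l assume l: "l \<le> N - 1" "0 < N - 1"
      consider "l < j" | "l = j" | "l > j" by linarith
      then show "d' l (d' (Suc j) z) = st (m + 2) (N - 1 - 1)"
      proof cases
        case 1
        then have "d' l (d' (Suc j) z) = d' j (d' l z)" using j' l by simp
        then show ?thesis using 1 z(1) j' unfolding P_defs by simp
      next
        case 2
        then have "d' l (d' (Suc j) z) = d' j (d' j z)" using j' l by simp
        then show ?thesis using 2 z(2) j' unfolding S_def by simp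
      next
        case 3
        then have "d' l (d' (Suc j) z) = d' (Suc j) (d' (Suc l) z)"
          using snd.d_d[of z "Suc j" "Suc l"] l by simp
        then show ?thesis using 3 z(1) j' l unfolding P_defs by simp
      qed
    qed
    moreover have "d (Suc (Suc r)) (d' (Suc j) (x j)) = d (Suc (Suc r)) (d' (Suc j) (x (Suc j)))"
      using x(3)[OF j] by simp
    then have "d' (Suc j) (d (Suc (Suc r)) (x j)) = d' (Suc j) (d (Suc (Suc r)) (x (Suc j)))"
      using j' r by simp
    ultimately show ?thesis unfolding B_def
      using z(1) x(3)[OF j] y(3)[OF j] j' r unfolding P_defs by auto
  qed
  have "\<exists>f. \<forall>i. (i \<le> w \<longrightarrow> P (c + i) (f i) \<and> S (d' (c + i) (f i)) \<and>
    (i = 0 \<longrightarrow> d' c (f i) = s r (s (Suc r) v))) \<and>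
     (i < w \<longrightarrow> d' (Suc (c + i)) (f i) = d' (Suc (c + i)) (f (Suc i)))"
  proof (rule dependent_nat_choice)
    have "S (s r (s (Suc r) v))" using A unfolding B_def by blast
    moreover obtain z where "P c z" "d' c z = s r (s (Suc r) v)" using C[OF _ _ A] by auto
    ultimately show "\<exists>z. 0 \<le> w \<longrightarrow> P (c + 0) z \<and> S (d' (c + 0) z) \<and>
      (0 = (0::nat) \<longrightarrow> d' c z = s r (s (Suc r) v))"
      by (intro exI[of _ z]) simp
  next
    fix z i
    assume z: "i \<le> w \<longrightarrow> P (c + i) z \<and> S (d' (c + i) z) \<and> (i = 0 \<longrightarrow> d' c z = s r (s (Suc r) v))"
    show "\<exists>z'. (Suc i \<le> w \<longrightarrow> P (c + Suc i) z' \<and> S (d' (c + Suc i) z') \<and>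
      (Suc i = 0 \<longrightarrow> d' c z' = s r (s (Suc r) v))) \<and>
        (i < w \<longrightarrow> d' (Suc (c + i)) z = d' (Suc (c + i)) z')"
    proof (cases "i < w")
      case True
      have B: "B (Suc (c + i)) (d' (Suc (c + i)) z)" using True z by (intro B') auto
      obtain z' where "P (Suc (c + i)) z'" "d' (Suc (c + i)) z' = d' (Suc (c + i)) z"
        using C[OF _ _ B] True by auto
      then show ?thesis using True B unfolding B_def by (intro exI[of _ z']) auto
    qed auto
  qed
  then obtain f where f: "\<And>i. i \<le> w \<Longrightarrow> P (c + i) (f i)" "d' c (f 0) = s r (s (Suc r) v)"
    "\<And>i. i < w \<Longrightarrow> d' (Suc (c + i)) (f i) = d' (Suc (c + i)) (f (Suc i))" by blast
  have "P j (f (j - c))" if "c \<le> j" "j \<le> c + w" for j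
    using f(1)[of "j - c"] that by simp
  moreover have "d' (Suc j) (f (j - c)) = d' (Suc j) (f (Suc j - c))" if "c \<le> j" "j < c + w" for j
    using f(3)[of "j - c"] that by (simp add: Suc_diff_le)
  ultimately show ?thesis
    using f(2) unfolding P_def by (intro exI[of _ "\<lambda>j. f (j - c)"] conjI allI impI) auto
qed

text \<open>The rows \<open>x 0, \<dots>, x m\<close>, where \<open>x i\<close> joins its faces \<open>i\<close> and \<open>i + 1\<close>, form a prism over the
  row of columns from \<open>c\<close> to \<open>c + w\<close>. They are merged into a single row \<open>y\<close> which joins the
  start of the prism to its end as faces \<open>m - 1\<close> and \<open>m\<close>: the position of the factor \<open>\<alpha>\<close> and of
  the value in a filler for \<open>\<alpha>\<close> and \<open>*\<close>.\<close>

lemma collapse_prism: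
  assumes m: "0 < m" and cN: "c + w < N"
    and v: "v \<in> U" "D v = m" "D' v = N - 1" "\<And>l. l \<le> m \<Longrightarrow> d l v = st (m - 1) (N - 1)"
      "\<And>l. l \<le> N - 1 \<Longrightarrow> 0 < N - 1 \<Longrightarrow> d' l v = st m (N - 1 - 1)"
    and x: "\<And>i j. i \<le> m \<Longrightarrow> c \<le> j \<Longrightarrow> j \<le> c + w \<Longrightarrow> prism_cell m N i j (x i j)"
      "\<And>i j. i < m \<Longrightarrow> c \<le> j \<Longrightarrow> j \<le> c + w \<Longrightarrow> d (Suc i) (x i j) = d (Suc i) (x (Suc i) j)"
      "\<And>i j. i \<le> m \<Longrightarrow> c \<le> j \<Longrightarrow> j < c + w \<Longrightarrow> d' (Suc j) (x i j) = d' (Suc j) (x i (Suc j))"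
      "\<And>j. c \<le> j \<Longrightarrow> j \<le> c + w \<Longrightarrow> d 0 (x 0 j) = s' j v"
      "\<And>i. i \<le> m \<Longrightarrow> d' c (x i c) = s i v"
  shows "\<exists>y. (\<forall>j. c \<le> j \<and> j \<le> c + w \<longrightarrow> prism_cell m N (m - 1) j (y j) \<and>
      d (m - 1) (y j) = s' j v \<and> d m (y j) = d (Suc m) (x m j)) \<and>
    (\<forall>j. c \<le> j \<and> j < c + w \<longrightarrow> d' (Suc j) (y j) = d' (Suc j) (y (Suc j))) \<and>
    d' c (y c) = s (m - 1) v"
proof -
  \<comment> \<open>\<open>R r y\<close>: the row \<open>y\<close>, with nontrivial faces \<open>r\<close> and \<open>r + 1\<close>, merges the rows
    \<open>x 0, \<dots>, x r\<close>.\<close>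
  define R where "R r y \<longleftrightarrow> (\<forall>j. c \<le> j \<and> j \<le> c + w \<longrightarrow> prism_cell m N r j (y j) \<and>
      d r (y j) = s' j v \<and> d (Suc r) (y j) = d (Suc r) (x r j)) \<and>
    (\<forall>j. c \<le> j \<and> j < c + w \<longrightarrow> d' (Suc j) (y j) = d' (Suc j) (y (Suc j))) \<and>
    d' c (y c) = s r v" for r y
  have R0: "R 0 (x 0)" unfolding R_def using x m by auto
  have "\<exists>y. R r y" if "r < m" for r
    using that
  proof (induction r)
    case 0 then show ?case using R0 by blast
  next
    case (Suc r)
    then obtain y where y: "R r y" by auto
    have r: "r < m" "Suc r < m" using Suc.prems by auto
    have "\<exists>W. (\<forall>j. c \<le> j \<and> j \<le> c + w \<longrightarrow> prism_filler 0 m N r j (x (Suc r) j) (y j) (W j)) \<and>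
      (\<forall>j. c \<le> j \<and> j < c + w \<longrightarrow> d' (Suc j) (W j) = d' (Suc j) (W (Suc j))) \<and>
      d' c (W c) = s r (s (Suc r) v)"
      by (rule lift_row) (use r cN v x y in \<open>auto simp: R_def\<close>)
    then obtain W where W': "\<And>j. c \<le> j \<Longrightarrow> j \<le> c + w \<Longrightarrow>
      prism_filler 0 m N r j (x (Suc r) j) (y j) (W j)"
      and WW: "\<And>j. c \<le> j \<Longrightarrow> j < c + w \<Longrightarrow> d' (Suc j) (W j) = d' (Suc j) (W (Suc j))"
      "d' c (W c) = s r (s (Suc r) v)"
      by blast
    note W = W'[unfolded prism_filler_def, simplified] WW
    have "R (Suc r) (\<lambda>j. d r (W j))"
      unfolding R_def
    proof (intro conjI allI impI; (elim conjE)?)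
      fix j assume j: "c \<le> j" "j \<le> c + w"
      note Wj = W(1)[OF j]
      have px: "prism_cell m N (Suc r) j (x (Suc r) j)" using x(1) r j by simp
      have py: "prism_cell m N r j (y j)" "d r (y j) = s' j v" using y j unfolding R_def by auto
      have e1: "d (Suc r) (d r (W j)) = d r (d (r + 2) (W j))"
        using fst.d_d[of "W j" r "r + 2"] Wj r by simp
      then show "d (Suc r) (d r (W j)) = s' j v" using Wj py by simp
      have e2: "d (Suc (Suc r)) (d r (W j)) = d r (d (r + 3) (W j))"
        using fst.d_d[of "W j" r "r + 3"] Wj r by simp
      also have "\<dots> = d (r + 2) (x (Suc r) j)"
        using px r Wj by (simp add: prism_cell_def cell_simps)
      finally show "d (Suc (Suc r)) (d r (W j)) = d (Suc (Suc r)) (x (Suc r) j)" by simp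
      show "prism_cell m N (Suc r) j (d r (W j))"
        unfolding prism_cell_def
      proof (intro conjI allI impI; (elim conjE)?)
        show "d r (W j) \<in> U" "D (d r (W j)) = Suc m" "D' (d r (W j)) = N"
          using Wj r by (simp_all add: cell_simps)
        fix l
        show "d l (d r (W j)) = st m N" if l: "l \<le> Suc m" "l \<noteq> Suc r" "l \<noteq> Suc (Suc r)"
        proof -
          consider "l < r" | "l = r" | "r + 3 < Suc l" using l by linarith
          then show ?thesis
          proof cases
            case 1
            then have "d l (d r (W j)) = d (r - 1) (d l (W j))" using fst.d_d[of "W j" l r] Wj r
              by simp
            then show ?thesis using 1 Wj r by (simp add: cell_simps)
          next
            case 2
            then have "d l (d r (W j)) = d r (d (r + 1) (W j))"
              using fst.d_d[of "W j" r "r + 1"] Wj r by simp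
            also have "\<dots> = d r (x (Suc r) j)" using Wj by simp
            finally show ?thesis using px r by (simp add: prism_cell_def)
          next
            case 3
            then have "d l (d r (W j)) = d r (d (Suc l) (W j))"
              using fst.d_d[of "W j" r "Suc l"] Wj r l by simp
            then show ?thesis using 3 Wj r l by (simp add: cell_simps)
          qed
        qed
        show "d' l (d r (W j)) = st (Suc m) (N - 1)" if l: "l \<le> N" "l \<noteq> j" "l \<noteq> Suc j"
        proof -
          have "0 < N" using cN by simp
          then have "d' l (d r (W j)) = d r (d' l (W j))"
            using Wj l r by (intro d_d'[symmetric]) auto
          then show ?thesis using Wj l r by (simp add: cell_simps)
        qed
      qed
    next
      fix j assume j: "c \<le> j" "j < c + w"
      have "d' (Suc j) (d r (W j)) = d r (d' (Suc j) (W j))"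
        "d' (Suc j) (d r (W (Suc j))) = d r (d' (Suc j) (W (Suc j)))"
        using W(1)[of j] W(1)[of "Suc j"] j r cN by (simp_all add: cell_simps)
      then show "d' (Suc j) (d r (W j)) = d' (Suc j) (d r (W (Suc j)))" using W(2)[OF j] by simp
    next
      have "d' c (d r (W c)) = d r (d' c (W c))" using W(1)[of c] r cN
        by (intro d_d'[symmetric]) auto
      then show "d' c (d r (W c)) = s (Suc r) v" using W(3) r v by (simp add: cell_simps)
    qed
    then show ?case by blast
  qed
  \<comment> \<open>The last row is merged by the other kind of tetrahedron, so that the result keeps the
    position \<open>m - 1\<close>.\<close>
  define r where "r = m - 1"
  have r: "r < m" "m = Suc r" using m by (auto simp: r_def)
  obtain y where y: "R r y" using \<open>\<And>r. r < m \<Longrightarrow> \<exists>y. R r y\<close> r by blast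
  have "\<exists>W. (\<forall>j. c \<le> j \<and> j \<le> c + w \<longrightarrow> prism_filler 3 m N r j (x (Suc r) j) (y j) (W j)) \<and>
      (\<forall>j. c \<le> j \<and> j < c + w \<longrightarrow> d' (Suc j) (W j) = d' (Suc j) (W (Suc j))) \<and>
      d' c (W c) = s r (s (Suc r) v)"
    by (rule lift_row) (use r(1) r(2)[symmetric] cN v x y in \<open>auto simp: R_def\<close>)
  then obtain W where W': "\<And>j. c \<le> j \<Longrightarrow> j \<le> c + w \<Longrightarrow> prism_filler 3 m N r j (x (Suc r) j) (y j) (W j)"
      and WW: "\<And>j. c \<le> j \<Longrightarrow> j < c + w \<Longrightarrow> d' (Suc j) (W j) = d' (Suc j) (W (Suc j))"
      "d' c (W c) = s r (s (Suc r) v)"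
    by blast
  note W = W'[unfolded prism_filler_def, simplified] WW
  let ?y = "\<lambda>j. d (r + 3) (W j)"
  have "prism_cell m N r j (?y j) \<and> d r (?y j) = s' j v \<and>
    d (Suc r) (?y j) = d (r + 2) (x (Suc r) j)"
    if j: "c \<le> j" "j \<le> c + w" for j
  proof -
    note Wj = W(1)[OF j]
    have px: "prism_cell m N (Suc r) j (x (Suc r) j)" using x(1) r j by simp
    have py: "prism_cell m N r j (y j)" "d r (y j) = s' j v" using y j unfolding R_def by auto
    have yc: "s' j v \<in> U" "D (s' j v) = m" using v j cN by (simp_all add: cell_simps)
    have comm: "d l (?y j) = d (r + 2) (d l (W j))" if "l \<le> m" for l
      using fst.d_d[of "W j" l "r + 3"] Wj r that by simp
    have e1: "d r (?y j) = s' j v"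
      using comm[of r] Wj py yc r(2) by (simp add: d_s_next)
    have e2: "d (Suc r) (?y j) = d (r + 2) (x (Suc r) j)"
      using comm[of "r + 1"] Wj r by simp
    have e3: "d (r + 2) (?y j) = st m N"
      using fst.d_d[of "W j" "r + 2" "r + 3"] Wj r py by (simp add: prism_cell_def)
    have "d l (?y j) = st m N" if "l < r" for l
      using comm[of l] Wj r that by (simp add: cell_simps)
    then have "\<forall>l\<le>Suc m. l \<noteq> r \<and> l \<noteq> Suc r \<longrightarrow> d l (?y j) = st m N"
      using e3 r by (metis One_nat_def Suc_1 add.commute linorder_neqE_nat not_less_eq order_le_less plus_1_eq_Suc add_Suc)
    moreover have "d' l (?y j) = st (Suc m) (N - 1)" if l: "l \<le> N" "l \<noteq> j" "l \<noteq> Suc j" for l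
    proof -
      have "0 < N" using cN by simp
      then have "d' l (?y j) = d (r + 3) (d' l (W j))"
        using Wj l r by (intro d_d'[symmetric]) auto
      then show ?thesis using Wj l r by (simp add: cell_simps)
    qed
    ultimately show ?thesis using e1 e2 Wj r unfolding prism_cell_def by (simp add: cell_simps)
  qed
  moreover have "d' (Suc j) (?y j) = d' (Suc j) (?y (Suc j))" if j: "c \<le> j" "j < c + w" for j
  proof -
    have "d' (Suc j) (?y j) = d (r + 3) (d' (Suc j) (W j))"
      "d' (Suc j) (?y (Suc j)) = d (r + 3) (d' (Suc j) (W (Suc j)))"
      using W(1)[of j] W(1)[of "Suc j"] j r cN by (simp_all add: cell_simps)
    then show ?thesis using W(2)[OF j] by simp
  qed
  moreover have "d' c (?y c) = s r v"
  proof -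
    have "d' c (?y c) = d (r + 3) (d' c (W c))" using W(1)[of c] r cN
      by (intro d_d'[symmetric]) auto
    also have "\<dots> = d (r + 3) (s r (s (Suc r) v))" using W(3) by simp
    also have "\<dots> = s r v" using r v by (simp add: cell_simps)
    finally show ?thesis .
  qed
  ultimately show ?thesis using r by (intro exI[of _ ?y]) simp
qed

end

section \<open>Spheres and products in all dimensions\<close>

context fibrant_cells
begin

text \<open>The maps \<open>\<Delta>\<^sup>m\<^sup>,\<^sup>n \<rightarrow> X\<close> relative to the boundary, the fillers of the Bott-Chern product,
  and the product itself, in terms of cells. These are the spheres, fillers and products of
  dimensions \<open>(1,1)\<close> in the window of the last two vertices of \<open>[m]\<close> and of \<open>[n]\<close>.\<close>

definition sphere_at :: "nat \<Rightarrow> nat \<Rightarrow> 'c \<Rightarrow> bool" where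
  "sphere_at m n a \<longleftrightarrow> a \<in> U \<and> D a = m \<and> D' a = n \<and>
     (\<forall>i\<le>m. d i a = st (m - 1) n) \<and> (\<forall>j\<le>n. d' j a = st m (n - 1))"

definition filler_at :: "nat \<Rightarrow> nat \<Rightarrow> 'c \<Rightarrow> 'c \<Rightarrow> 'c \<Rightarrow> bool" where
  "filler_at m n a b x \<longleftrightarrow> x \<in> U \<and> D x = m + 1 \<and> D' x = n + 1 \<and>
     (\<forall>i. i + 1 < m \<longrightarrow> d i x = st m (n + 1)) \<and> (\<forall>j. j + 1 < n \<longrightarrow> d' j x = st (m + 1) n) \<and>
     d (m - 1) x = s' (n - 1) a \<and> d' (n - 1) x = s (m - 1) a \<and>
     d (m + 1) x = s' n b \<and> d' (n + 1) x = s m b"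

definition product_at :: "nat \<Rightarrow> nat \<Rightarrow> 'c \<Rightarrow> 'c \<Rightarrow> 'c \<Rightarrow> bool" where
  "product_at m n a b c \<longleftrightarrow>
     sphere_at m n a \<and> sphere_at m n b \<and> (\<exists>x. filler_at m n a b x \<and> c = d m (d' n x))"

lemma product_at_window:
  assumes "1 \<le> m" "1 \<le> n"
  defines "W \<equiv> window2 (m - 1) 0 (n - 1) 0"
  shows "fibrant_cells.sphere W (\<lambda>x. D x - (m - 1) - 0) (\<lambda>x. D' x - (n - 1) - 0)
      (\<lambda>i. d (m - 1 + i)) (\<lambda>j. d' (n - 1 + j)) (\<lambda>a b. st (m - 1 + a + 0) (n - 1 + b + 0)) a \<longleftrightarrow>
        sphere_at m n a"
    and "fibrant_cells.product_rel W (\<lambda>x. D x - (m - 1) - 0) (\<lambda>x. D' x - (n - 1) - 0)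
      (\<lambda>i. d (m - 1 + i)) (\<lambda>i. s (m - 1 + i)) (\<lambda>j. d' (n - 1 + j)) (\<lambda>j. s' (n - 1 + j))
      (\<lambda>a b. st (m - 1 + a + 0) (n - 1 + b + 0)) a b c \<longleftrightarrow> product_at m n a b c"
proof -
  interpret Z: fibrant_cells W "\<lambda>x. D x - (m - 1) - 0" "\<lambda>x. D' x - (n - 1) - 0"
    "\<lambda>i. d (m - 1 + i)" "\<lambda>i. s (m - 1 + i)" "\<lambda>j. d' (n - 1 + j)" "\<lambda>j. s' (n - 1 + j)"
    "\<lambda>a b. st (m - 1 + a + 0) (n - 1 + b + 0)"
    unfolding W_def by (rule window2_fibrant_cells)
  obtain p q where pq: "m = Suc p" "n = Suc q" using assms by (metis Suc_le_D One_nat_def)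
  have le: "i \<le> Suc p \<longleftrightarrow> i < p \<or> i = p \<or> i = Suc p" for i p :: nat by auto
  have diff: "i - p = Suc 0 \<longleftrightarrow> i = Suc p" "i - p = 2 \<longleftrightarrow> i = Suc (Suc p)" for i p :: nat by auto
  show sph: "Z.sphere a \<longleftrightarrow> sphere_at m n a" for a
    unfolding Z.sphere_def sphere_at_def unfolding W_def window2_def unfolding pq
      by (auto simp: le diff)
  have less: "Suc i < Suc p \<longleftrightarrow> i < p" for i p by auto
  have fil: "Z.filler a b x \<longleftrightarrow> filler_at m n a b x" if "sphere_at m n a" "sphere_at m n b" for a b x
    unfolding Z.filler_def filler_at_def unfolding W_def window2_def unfolding pq
      by (auto simp: less diff)
  have eq: "m - 1 + 1 = m" "n - 1 + 1 = n" using assms by auto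
  show "Z.product_rel a b c \<longleftrightarrow> product_at m n a b c"
    unfolding Z.product_rel_def product_at_def sph eq using fil by blast
qed

context
  fixes m n :: nat
  assumes mn: "1 \<le> m" "1 \<le> n"
begin

interpretation Z: fibrant_cells "window2 (m - 1) 0 (n - 1) 0" "\<lambda>x. D x - (m - 1) - 0"
  "\<lambda>x. D' x - (n - 1) - 0"
    "\<lambda>i. d (m - 1 + i)" "\<lambda>i. s (m - 1 + i)" "\<lambda>j. d' (n - 1 + j)" "\<lambda>j. s' (n - 1 + j)"
    "\<lambda>a b. st (m - 1 + a + 0) (n - 1 + b + 0)"
  by (rule window2_fibrant_cells)

lemma product_at_sphere: "product_at m n a b c \<Longrightarrow> sphere_at m n c"
  using Z.product_rel_sphere[unfolded product_at_window[OF mn]] .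

lemma product_at_exists: "sphere_at m n a \<Longrightarrow> sphere_at m n b \<Longrightarrow> \<exists>c. product_at m n a b c"
  using Z.filler_exists[unfolded product_at_window[OF mn], of a b]
  unfolding product_at_window(2)[OF mn, symmetric] Z.product_rel_def product_at_window(1)[OF mn]
    by blast

lemma product_at_unit_left: "sphere_at m n a \<Longrightarrow> product_at m n (st m n) a a"
  using Z.product_rel_unit_left[unfolded product_at_window[OF mn], of a] mn by simp

lemma product_at_unit_right: "sphere_at m n a \<Longrightarrow> product_at m n a (st m n) a"
  using Z.product_rel_unit_right[unfolded product_at_window[OF mn], of a] mn by simp

lemma product_at_assoc_right:
  "product_at m n a b e \<Longrightarrow> product_at m n b c f \<Longrightarrow> product_at m n e c g \<Longrightarrow> product_at m n a f g"
  using Z.product_rel_assoc_right[unfolded product_at_window[OF mn]] .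

lemma product_at_assoc_left:
  "product_at m n a b e \<Longrightarrow> product_at m n b c f \<Longrightarrow> product_at m n a f g \<Longrightarrow> product_at m n e c g"
  using Z.product_rel_assoc_left[unfolded product_at_window[OF mn]] .

end

text \<open>After the \<open>m + 1\<close> rows have been merged, a single row of \<open>n + 1\<close> cells remains. With the
  directions exchanged, it is a prism over one column, which is merged in the same way.\<close>

lemma collapse_grid:
  assumes mn: "1 \<le> m" "1 \<le> n" and v: "sphere_at m n v"
    and x: "\<And>i j. i \<le> m \<Longrightarrow> j \<le> n \<Longrightarrow> prism_cell m (Suc n) i j (x i j)"
      "\<And>i j. i < m \<Longrightarrow> j \<le> n \<Longrightarrow> d (Suc i) (x i j) = d (Suc i) (x (Suc i) j)"
      "\<And>i j. i \<le> m \<Longrightarrow> j < n \<Longrightarrow> d' (Suc j) (x i j) = d' (Suc j) (x i (Suc j))"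
      "\<And>j. j \<le> n \<Longrightarrow> d 0 (x 0 j) = s' j v"
      "\<And>i. i \<le> m \<Longrightarrow> d' 0 (x i 0) = s i v"
  shows "product_at m n v (st m n) (d (Suc m) (d' (Suc n) (x m n)))"
proof -
  interpret tr: fibrant_cells U D' D d' s' d s "\<lambda>a b. st b a" by (rule transpose)
  have tr_cell: "tr.prism_cell n (Suc m) j i z \<longleftrightarrow> prism_cell m (Suc n) i j z" for i j z
    unfolding tr.prism_cell_def prism_cell_def by auto
  note v' = v[unfolded sphere_at_def]
  have "\<exists>y. (\<forall>j. 0 \<le> j \<and> j \<le> 0 + n \<longrightarrow> prism_cell m (Suc n) (m - 1) j (y j) \<and>
      d (m - 1) (y j) = s' j v \<and> d m (y j) = d (Suc m) (x m j)) \<and>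
    (\<forall>j. 0 \<le> j \<and> j < 0 + n \<longrightarrow> d' (Suc j) (y j) = d' (Suc j) (y (Suc j))) \<and>
    d' 0 (y 0) = s (m - 1) v"
    by (rule collapse_prism) (use v' x mn in auto)
  then obtain y where y: "\<And>j. j \<le> n \<Longrightarrow> prism_cell m (Suc n) (m - 1) j (y j)"
      "\<And>j. j \<le> n \<Longrightarrow> d (m - 1) (y j) = s' j v" "\<And>j. j \<le> n \<Longrightarrow> d m (y j) = d (Suc m) (x m j)"
      "\<And>j. j < n \<Longrightarrow> d' (Suc j) (y j) = d' (Suc j) (y (Suc j))" "d' 0 (y 0) = s (m - 1) v"
    by auto
  have "\<exists>z. (\<forall>i. m - 1 \<le> i \<and> i \<le> m - 1 + 0 \<longrightarrow> tr.prism_cell n (Suc m) (n - 1) i (z i) \<and>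
      d' (n - 1) (z i) = s i v \<and> d' n (z i) = d' (Suc n) (y n)) \<and>
    (\<forall>i. m - 1 \<le> i \<and> i < m - 1 + 0 \<longrightarrow> d (Suc i) (z i) = d (Suc i) (z (Suc i))) \<and>
    d (m - 1) (z (m - 1)) = s' (n - 1) v"
    by (rule tr.collapse_prism[where x = "\<lambda>j i. y j"]) (use v' y mn in \<open>auto simp: tr_cell\<close>)
  then obtain z where z: "prism_cell m (Suc n) (m - 1) (n - 1) z" "d' (n - 1) z = s (m - 1) v"
      "d' n z = d' (Suc n) (y n)" "d (m - 1) z = s' (n - 1) v"
    unfolding tr_cell by auto
  have "sphere_at m n (st m n)" using mn by (simp add: sphere_at_def cell_simps)
  moreover have "filler_at m n v (st m n) z"
    using z mn unfolding filler_at_def prism_cell_def by (auto simp: cell_simps)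
  moreover have "d m (d' n z) = d (Suc m) (d' (Suc n) (x m n))"
    using y(1)[of n] y(3)[of n] x(1)[of m n] z(3) d_d'[of "y n" m "Suc n"] d_d'[of "x m n" "Suc m"
      "Suc n"]
    unfolding prism_cell_def by simp
  ultimately show ?thesis using v unfolding product_at_def by (auto intro!: exI[of _ z])
qed

end

section \<open>The cells of a bisimplicial set\<close>

text \<open>Morphisms \<open>[p] \<rightarrow> [m]\<close> of the simplex category are represented by functions, of which only
  the values on \<open>{..p}\<close> matter; \<open>vals p f\<close> is the list of these values.\<close>

definition monotone_map :: "nat \<Rightarrow> nat \<Rightarrow> (nat \<Rightarrow> nat) \<Rightarrow> bool" where
  "monotone_map p m f \<longleftrightarrow> (\<forall>i j. i \<le> j \<longrightarrow> j \<le> p \<longrightarrow> f i \<le> f j) \<and> (\<forall>i\<le>p. f i \<le> m)"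

definition vals :: "nat \<Rightarrow> (nat \<Rightarrow> nat) \<Rightarrow> nat list" where
  "vals p f = map f [0..<Suc p]"

lemma length_vals [simp]: "length (vals p f) = Suc p"
  by (simp add: vals_def)

lemma nth_vals [simp]: "i \<le> p \<Longrightarrow> vals p f ! i = f i"
  by (simp add: vals_def nth_append del: upt_Suc)

lemma set_vals: "set (vals p f) = f ` {..p}"
  by (auto simp: vals_def atLeast0LessThan lessThan_Suc_atMost simp del: upt_Suc)

lemma vals_in_simplex_mor [simp]: "vals p f \<in> simplex_mor p m \<longleftrightarrow> monotone_map p m f"
  unfolding simplex_mor_def monotone_map_def
  by (auto simp: set_vals sorted_iff_nth_mono less_Suc_eq_le)

lemma vals_cong: "(\<And>i. i \<le> p \<Longrightarrow> f i = g i) \<Longrightarrow> vals p f = vals p g"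
  by (auto simp: vals_def simp del: upt_Suc)

lemma vals_nth: "u \<in> simplex_mor p m \<Longrightarrow> vals p ((!) u) = u"
  unfolding simplex_mor_def by (auto intro!: nth_equalityI simp: less_Suc_eq_le)

lemma monotone_map_nth: "u \<in> simplex_mor p m \<Longrightarrow> monotone_map p m ((!) u)"
  using vals_in_simplex_mor[of p "(!) u" m] vals_nth by simp

lemma simplex_comp_vals: "monotone_map p m g \<Longrightarrow> simplex_comp (vals m f) (vals p g) = vals p (f \<circ> g)"
  by (auto simp: simplex_comp_def vals_def[of p] monotone_map_def simp del: upt_Suc)

lemma simplex_id_vals: "simplex_id m = vals m id"
  by (simp add: simplex_id_def vals_def)

lemma map_vals: "map g (vals p f) = vals p (g \<circ> f)"
  by (simp add: vals_def)

lemma monotone_map_comp: "monotone_map p m f \<Longrightarrow> monotone_map q p g \<Longrightarrow> monotone_map q m (f \<circ> g)"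
  unfolding monotone_map_def by (metis comp_apply)

lemma monotone_map_id [simp]: "monotone_map p m id \<longleftrightarrow> p \<le> m" "monotone_map p m (\<lambda>x. x) \<longleftrightarrow> p \<le> m"
  unfolding monotone_map_def by auto

lemma monotone_map_0 [simp]: "monotone_map p m (\<lambda>_. 0)"
  unfolding monotone_map_def by auto

lemma monotone_map_coface: "0 < m \<Longrightarrow> monotone_map (m - Suc 0) m (coface i)"
  unfolding monotone_map_def coface_def by auto

lemma monotone_map_codegen: "i \<le> m \<Longrightarrow> monotone_map (Suc m) m (codegen i)"
  unfolding monotone_map_def codegen_def by auto

lemma bact_in:
  assumes "bisimplicial_set K" "u \<in> simplex_mor p m" "v \<in> simplex_mor q n" "x \<in> bcells K m n"
  shows "bact K m n u v x \<in> bcells K p q"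
  using assms(1)[unfolded bisimplicial_set_def, THEN conjunct1, rule_format] assms(2-) by simp

lemma bact_id:
  assumes "bisimplicial_set K" "x \<in> bcells K m n"
  shows "bact K m n (simplex_id m) (simplex_id n) x = x"
  using assms(1)[unfolded bisimplicial_set_def, THEN conjunct2, THEN conjunct1, rule_format] assms(2) by simp

lemma bact_comp:
  assumes "bisimplicial_set K" "u \<in> simplex_mor p m" "v \<in> simplex_mor q n" "x \<in> bcells K m n"
    "w \<in> simplex_mor r p" "z \<in> simplex_mor t q"
  shows "bact K p q w z (bact K m n u v x) = bact K m n (simplex_comp u w) (simplex_comp v z) x"
  using assms(1)[unfolded bisimplicial_set_def, THEN conjunct2, THEN conjunct2, rule_format] assms(2-) by simp

text \<open>A cell together with its two dimensions. On such cells, operators need no dimensions of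
  their source as arguments, and equality of cells includes equality of dimensions.\<close>

type_synonym 'a tagged = "nat \<times> nat \<times> 'a"

locale bisset =
  fixes X :: "'a bisset"
  assumes X: "bisimplicial_set X"
begin

definition cells :: "'a tagged set" where
  "cells = {(m, n, x). x \<in> bcells X m n}"

definition dim1 :: "'a tagged \<Rightarrow> nat" where "dim1 c = fst c"
definition dim2 :: "'a tagged \<Rightarrow> nat" where "dim2 c = fst (snd c)"

text \<open>The action of the pair \<open>f : [p] \<rightarrow> [m]\<close>, \<open>g : [q] \<rightarrow> [n]\<close> on a cell of dimensions \<open>(m, n)\<close>.\<close>

definition act :: "nat \<Rightarrow> nat \<Rightarrow> (nat \<Rightarrow> nat) \<Rightarrow> (nat \<Rightarrow> nat) \<Rightarrow> 'a tagged \<Rightarrow> 'a tagged" where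
  "act p q f g = (\<lambda>(m, n, x). (p, q, bact X m n (vals p f) (vals q g) x))"

lemma dim_act [simp]: "dim1 (act p q f g c) = p" "dim2 (act p q f g c) = q"
  by (auto simp: act_def dim1_def dim2_def split: prod.splits)

lemma act_in: "c \<in> cells \<Longrightarrow> monotone_map p (dim1 c) f \<Longrightarrow> monotone_map q (dim2 c) g \<Longrightarrow>
  act p q f g c \<in> cells"
  using X unfolding bisimplicial_set_def by (auto simp: cells_def act_def dim1_def dim2_def)

lemma act_act:
  assumes "c \<in> cells" "monotone_map p (dim1 c) f" "monotone_map q (dim2 c) g"
    "monotone_map p' p f'" "monotone_map q' q g'"
  shows "act p' q' f' g' (act p q f g c) = act p' q' (f \<circ> f') (g \<circ> g') c"
proof -
  obtain m n x where c: "c = (m, n, x)" "x \<in> bcells X m n"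
    using assms(1) by (auto simp: cells_def)
  have "bact X p q (vals p' f') (vals q' g') (bact X m n (vals p f) (vals q g) x) =
    bact X m n (simplex_comp (vals p f) (vals p' f')) (simplex_comp (vals q g) (vals q' g')) x"
    using assms c by (intro bact_comp[OF X, where r = p' and t = q']) (simp_all add: dim1_def dim2_def)
  then show ?thesis using assms c by (simp add: act_def simplex_comp_vals)
qed

lemma act_cong:
  "(\<And>i. i \<le> p \<Longrightarrow> f i = f' i) \<Longrightarrow> (\<And>i. i \<le> q \<Longrightarrow> g i = g' i) \<Longrightarrow> act p q f g c = act p q f' g' c"
  unfolding act_def using vals_cong[of p f f'] vals_cong[of q g g'] by simp

lemma act_id:
  assumes "c \<in> cells" "p = dim1 c" "q = dim2 c" "\<And>i. i \<le> p \<Longrightarrow> f i = i" "\<And>i. i \<le> q \<Longrightarrow> g i = i"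
  shows "act p q f g c = c"
proof -
  have "act p q f g c = act p q id id c" using assms by (intro act_cong) auto
  also have "\<dots> = c"
    using X assms(1-3) unfolding bisimplicial_set_def
    by (auto simp: act_def cells_def dim1_def dim2_def simplex_id_vals)
  finally show ?thesis .
qed

definition face :: "nat \<Rightarrow> 'a tagged \<Rightarrow> 'a tagged" where
  "face i c = act (dim1 c - 1) (dim2 c) (coface i) id c"
definition face' :: "nat \<Rightarrow> 'a tagged \<Rightarrow> 'a tagged" where
  "face' j c = act (dim1 c) (dim2 c - 1) id (coface j) c"
definition degen :: "nat \<Rightarrow> 'a tagged \<Rightarrow> 'a tagged" where
  "degen i c = act (Suc (dim1 c)) (dim2 c) (codegen i) id c"
definition degen' :: "nat \<Rightarrow> 'a tagged \<Rightarrow> 'a tagged" where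
  "degen' j c = act (dim1 c) (Suc (dim2 c)) id (codegen j) c"

lemmas op_defs = face_def face'_def degen_def degen'_def

lemma dim_ops [simp]:
  "dim1 (face i c) = dim1 c - 1" "dim2 (face i c) = dim2 c"
  "dim1 (face' i c) = dim1 c" "dim2 (face' i c) = dim2 c - 1"
  "dim1 (degen i c) = Suc (dim1 c)" "dim2 (degen i c) = dim2 c"
  "dim1 (degen' i c) = dim1 c" "dim2 (degen' i c) = Suc (dim2 c)"
  by (simp_all add: op_defs)

lemma ops_in:
  "c \<in> cells \<Longrightarrow> 0 < dim1 c \<Longrightarrow> face i c \<in> cells"
  "c \<in> cells \<Longrightarrow> 0 < dim2 c \<Longrightarrow> face' i c \<in> cells"
  "c \<in> cells \<Longrightarrow> i \<le> dim1 c \<Longrightarrow> degen i c \<in> cells"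
  "c \<in> cells \<Longrightarrow> i \<le> dim2 c \<Longrightarrow> degen' i c \<in> cells"
  by (auto simp: op_defs intro!: act_in monotone_map_coface monotone_map_codegen)

lemma act_ops:
  assumes "c \<in> cells" "monotone_map p (dim1 c) f" "monotone_map q (dim2 c) g"
  shows "0 < p \<Longrightarrow> face i (act p q f g c) = act (p - Suc 0) q (f \<circ> coface i) g c"
    "0 < q \<Longrightarrow> face' j (act p q f g c) = act p (q - Suc 0) f (g \<circ> coface j) c"
    "i \<le> p \<Longrightarrow> degen i (act p q f g c) = act (Suc p) q (f \<circ> codegen i) g c"
    "j \<le> q \<Longrightarrow> degen' j (act p q f g c) = act p (Suc q) f (g \<circ> codegen j) c"
  using assms unfolding op_defs
  by (simp_all add: act_act monotone_map_coface monotone_map_codegen)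

lemma simplicial_direction_1: "simplicial_direction cells dim1 face degen"
proof
  fix x and i j :: nat
  assume x: "x \<in> cells"
  note cc = coface_def codegen_def
  note mm = monotone_map_coface monotone_map_codegen
  { assume "0 < dim1 x" then show "face i x \<in> cells" using x by (rule ops_in(1)[rotated]) }
  { assume "i \<le> dim1 x" then show "degen i x \<in> cells" using x ops_in by blast }
  { assume "i < j" "j \<le> dim1 x" "1 < dim1 x"
    then show "face i (face j x) = face (j - 1) (face i x)"
      using x unfolding face_def[of _ x]
      by (simp add: act_ops mm) (auto intro!: act_cong simp: cc) }
  { assume "i < j" "j \<le> dim1 x"
    then show "face i (degen j x) = degen (j - 1) (face i x)"
      using x unfolding face_def[of _ x] degen_def[of _ x]
      by (simp add: act_ops mm) (auto intro!: act_cong simp: cc) }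
  { assume "i \<le> dim1 x"
    then show "face i (degen i x) = x" "face (Suc i) (degen i x) = x"
      using x unfolding degen_def[of _ x]
      by (simp_all add: act_ops mm) (auto intro!: act_id simp: cc) }
  { assume "Suc j < i" "i \<le> Suc (dim1 x)"
    then show "face i (degen j x) = degen j (face (i - 1) x)"
      using x unfolding face_def[of _ x] degen_def[of _ x]
      by (simp add: act_ops mm) (auto intro!: act_cong simp: cc) }
  { assume "i \<le> j" "j \<le> dim1 x"
    then show "degen i (degen j x) = degen (Suc j) (degen i x)"
      using x unfolding degen_def[of _ x]
      by (simp add: act_ops mm) (auto intro!: act_cong simp: cc) }
qed simp_all

lemma simplicial_direction_2: "simplicial_direction cells dim2 face' degen'"
proof
  fix x and i j :: nat
  assume x: "x \<in> cells"
  note cc = coface_def codegen_def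
  note mm = monotone_map_coface monotone_map_codegen
  { assume "0 < dim2 x" then show "face' i x \<in> cells" using x by (rule ops_in(2)[rotated]) }
  { assume "i \<le> dim2 x" then show "degen' i x \<in> cells" using x ops_in by blast }
  { assume "i < j" "j \<le> dim2 x" "1 < dim2 x"
    then show "face' i (face' j x) = face' (j - 1) (face' i x)"
      using x unfolding face'_def[of _ x]
      by (simp add: act_ops mm) (auto intro!: act_cong simp: cc) }
  { assume "i < j" "j \<le> dim2 x"
    then show "face' i (degen' j x) = degen' (j - 1) (face' i x)"
      using x unfolding face'_def[of _ x] degen'_def[of _ x]
      by (simp add: act_ops mm) (auto intro!: act_cong simp: cc) }
  { assume "i \<le> dim2 x"
    then show "face' i (degen' i x) = x" "face' (Suc i) (degen' i x) = x"
      using x unfolding degen'_def[of _ x]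
      by (simp_all add: act_ops mm) (auto intro!: act_id simp: cc) }
  { assume "Suc j < i" "i \<le> Suc (dim2 x)"
    then show "face' i (degen' j x) = degen' j (face' (i - 1) x)"
      using x unfolding face'_def[of _ x] degen'_def[of _ x]
      by (simp add: act_ops mm) (auto intro!: act_cong simp: cc) }
  { assume "i \<le> j" "j \<le> dim2 x"
    then show "degen' i (degen' j x) = degen' (Suc j) (degen' i x)"
      using x unfolding degen'_def[of _ x]
      by (simp add: act_ops mm) (auto intro!: act_cong simp: cc) }
qed simp_all

lemma commuting_directions_cells: "commuting_directions cells dim1 dim2 face degen face' degen'"
proof
  fix x and i j :: nat
  assume x: "x \<in> cells"
  note mm = monotone_map_coface monotone_map_codegen
  { assume "0 < dim1 x" "i \<le> dim1 x" "0 < dim2 x" "j \<le> dim2 x"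
    then show "face i (face' j x) = face' j (face i x)"
      using x unfolding face_def[of _ x] face'_def[of _ x] by (simp add: act_ops mm) }
  { assume "0 < dim1 x" "i \<le> dim1 x" "j \<le> dim2 x"
    then show "face i (degen' j x) = degen' j (face i x)"
      using x unfolding face_def[of _ x] degen'_def[of _ x] by (simp add: act_ops mm) }
  { assume "i \<le> dim1 x" "0 < dim2 x" "j \<le> dim2 x"
    then show "degen i (face' j x) = face' j (degen i x)"
      using x unfolding degen_def[of _ x] face'_def[of _ x] by (simp add: act_ops mm) }
  { assume "i \<le> dim1 x" "j \<le> dim2 x"
    then show "degen i (degen' j x) = degen' j (degen i x)"
      using x unfolding degen_def[of _ x] degen'_def[of _ x] by (simp add: act_ops mm) }
qed simp_all

end

section \<open>Maps out of bisimplices as cells\<close>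

lemma bcells_std [simp]: "bcells (std_bisimplex m n) p q = simplex_mor p m \<times> simplex_mor q n"
  by (simp add: std_bisimplex_def box_def std_simplex_def)

lemma bact_std [simp]: "bact (std_bisimplex m n) p q u v (a, b) = (simplex_comp a u, simplex_comp b v)"
  by (simp add: std_bisimplex_def box_def std_simplex_def)

lemma simplex_id_in [simp]: "simplex_id m \<in> simplex_mor m m"
  by (simp add: simplex_id_vals)

lemma simplex_comp_in:
  assumes "u \<in> simplex_mor p m" "w \<in> simplex_mor q p"
  shows "simplex_comp u w \<in> simplex_mor q m"
proof -
  have "simplex_comp (vals p ((!) u)) (vals q ((!) w)) \<in> simplex_mor q m"
    using monotone_map_comp[OF monotone_map_nth[OF assms(1)] monotone_map_nth[OF assms(2)]] assms
    by (simp add: simplex_comp_vals monotone_map_nth)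
  then show ?thesis using assms by (simp add: vals_nth)
qed

lemma simplex_comp_assoc:
  assumes "u \<in> simplex_mor p m" "w \<in> simplex_mor q p" "z \<in> simplex_mor r q"
  shows "simplex_comp (simplex_comp u w) z = simplex_comp u (simplex_comp w z)"
proof -
  have "set z \<subseteq> {..q}" "length w = Suc q" using assms by (auto simp: simplex_mor_def)
  then show ?thesis by (auto simp: simplex_comp_def)
qed

lemma simplex_comp_id [simp]:
  "u \<in> simplex_mor p m \<Longrightarrow> simplex_comp u (simplex_id p) = u"
  "u \<in> simplex_mor p m \<Longrightarrow> simplex_comp (simplex_id m) u = u"
proof -
  assume u: "u \<in> simplex_mor p m"
  then have "length u = Suc p" "set u \<subseteq> {..m}" by (auto simp: simplex_mor_def)
  then show "simplex_comp u (simplex_id p) = u"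
    using map_nth[of u] unfolding simplex_comp_def simplex_id_def by simp
  have "simplex_comp (simplex_id m) u = map id u"
    using \<open>set u \<subseteq> {..m}\<close> unfolding simplex_comp_def simplex_id_def
    by (intro map_cong) (auto simp: nth_append simp del: upt_Suc)
  then show "simplex_comp (simplex_id m) u = u" by simp
qed

lemma bisimplicial_set_std: "bisimplicial_set (std_bisimplex m n)"
  unfolding bisimplicial_set_def
  by (auto simp: simplex_comp_in intro: simplex_comp_assoc)

lemma map_in_simplex_mor:
  "monotone_map m m' f \<Longrightarrow> u \<in> simplex_mor p m \<Longrightarrow> map f u \<in> simplex_mor p m'"
  using map_vals[of f p "(!) u"]
  by (metis monotone_map_comp monotone_map_nth vals_in_simplex_mor vals_nth)

lemma map_simplex_comp:
  "u \<in> simplex_mor p m \<Longrightarrow> w \<in> simplex_mor q p \<Longrightarrow> map f (simplex_comp u w) = simplex_comp (map f u) w"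
  by (auto simp: simplex_comp_def simplex_mor_def)

context bisset
begin

text \<open>The cell that corresponds to a map out of \<open>\<Delta>\<^sup>m\<^sup>,\<^sup>n\<close> by the Yoneda lemma; \<open>tag_inj\<close> and
  \<open>tag_surj\<close> say that this is a bijection, and \<open>precompose\<close> that it is natural.\<close>

definition tag :: "nat \<Rightarrow> nat \<Rightarrow> (bisimplex, 'a) bmap \<Rightarrow> 'a tagged" where
  "tag m n h = (m, n, h m n (simplex_id m, simplex_id n))"

lemma dim_tag [simp]: "dim1 (tag m n h) = m" "dim2 (tag m n h) = n"
  by (simp_all add: tag_def dim1_def dim2_def)

lemma tag_in: "h \<in> bis_hom (std_bisimplex m n) X \<Longrightarrow> tag m n h \<in> cells"
  unfolding bis_hom_def tag_def cells_def using simplex_id_in[of m] simplex_id_in[of n]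
  by (fastforce simp: PiE_def Pi_def)

lemma hom_apply:
  assumes "h \<in> bis_hom (std_bisimplex m n) X" "u \<in> simplex_mor p m" "v \<in> simplex_mor q n"
  shows "h p q (u, v) = bact X m n u v (h m n (simplex_id m, simplex_id n))"
proof -
  have "h p q (bact (std_bisimplex m n) m n u v (simplex_id m, simplex_id n)) =
      bact X m n u v (h m n (simplex_id m, simplex_id n))"
    using assms unfolding bis_hom_def by (fastforce simp del: bact_std)
  then show ?thesis using assms by simp
qed

lemma hom_apply_act:
  assumes "h \<in> bis_hom (std_bisimplex m n) X" "u \<in> simplex_mor p m" "v \<in> simplex_mor q n"
  shows "(p, q, h p q (u, v)) = act p q ((!) u) ((!) v) (tag m n h)"
  using hom_apply[OF assms] vals_nth[OF assms(2)] vals_nth[OF assms(3)]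
    by (simp add: act_def tag_def)

lemma hom_ext:
  assumes "f \<in> bis_hom K Y" "g \<in> bis_hom K Y" "\<And>p q x. x \<in> bcells K p q \<Longrightarrow> f p q x = g p q x"
  shows "f = g"
proof (intro ext)
  fix p q x
  have "f p q \<in> extensional (bcells K p q)" "g p q \<in> extensional (bcells K p q)"
    using assms unfolding bis_hom_def by (auto simp: PiE_def)
  then show "f p q x = g p q x"
    using assms(3) by (cases "x \<in> bcells K p q") (auto simp: extensional_def)
qed

lemma tag_inj:
  assumes "f \<in> bis_hom (std_bisimplex m n) X" "g \<in> bis_hom (std_bisimplex m n) X"
    "tag m n f = tag m n g"
  shows "f = g"
  using assms(1,2)
proof (rule hom_ext)
  fix p q x assume "x \<in> bcells (std_bisimplex m n) p q"
  then obtain u v where x: "x = (u, v)" "u \<in> simplex_mor p m" "v \<in> simplex_mor q n" by auto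
  have "f m n (simplex_id m, simplex_id n) = g m n (simplex_id m, simplex_id n)"
    using assms(3) by (simp add: tag_def)
  then show "f p q x = g p q x"
    unfolding x(1) hom_apply[OF assms(1) x(2,3)] hom_apply[OF assms(2) x(2,3)] by (rule arg_cong)
qed

lemma tag_surj:
  assumes "c \<in> cells" "dim1 c = m" "dim2 c = n"
  shows "\<exists>h\<in>bis_hom (std_bisimplex m n) X. tag m n h = c"
proof -
  obtain x where c: "c = (m, n, x)" "x \<in> bcells X m n"
    using assms by (auto simp: cells_def dim1_def dim2_def)
  define h where "h p q = (\<lambda>(u, v)\<in>bcells (std_bisimplex m n) p q. bact X m n u v x)" for p q
  have 1: "h p q \<in> bcells (std_bisimplex m n) p q \<rightarrow>\<^sub>E bcells X p q" for p q
    using X c(2) unfolding h_def bisimplicial_set_def by auto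
  have 2: "h p' q' (bact (std_bisimplex m n) p q u v y) = bact X p q u v (h p q y)"
    if "u \<in> simplex_mor p' p" "v \<in> simplex_mor q' q" "y \<in> bcells (std_bisimplex m n) p q"
      for p q p' q' u v y
  proof -
    from that obtain a b where y: "y = (a, b)" "a \<in> simplex_mor p m" "b \<in> simplex_mor q n" by auto
    show ?thesis
      using y that bact_comp[OF X y(2,3) c(2) that(1,2)]
      by (simp add: h_def simplex_comp_in[of _ p] simplex_comp_in[of _ q])
  qed
  have "h \<in> bis_hom (std_bisimplex m n) X"
    unfolding bis_hom_def using 1 2 by blast
  moreover have "tag m n h = c"
    using c X unfolding bisimplicial_set_def by (simp add: tag_def h_def)
  ultimately show ?thesis by blast
qed

lemma precompose:
  assumes h: "h \<in> bis_hom (std_bisimplex m' n') X"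
    and f: "monotone_map m m' f" and g: "monotone_map n n' g"
  defines "h' \<equiv> bis_comp (std_bisimplex m n) h (simplex_map f g)"
  shows "h' \<in> bis_hom (std_bisimplex m n) X" "tag m n h' = act m n f g (tag m' n' h)"
proof -
  have h': "h' p q (u, v) = h p q (map f u, map g v)"
    if "u \<in> simplex_mor p m" "v \<in> simplex_mor q n" for p q u v
    using that by (simp add: h'_def bis_comp_def compose_def simplex_map_def)
  have fg: "map f u \<in> simplex_mor p m'" "map g v \<in> simplex_mor q n'"
    if "u \<in> simplex_mor p m" "v \<in> simplex_mor q n" for p q u v
    using that f g map_in_simplex_mor by blast+
  have 1: "h' p q \<in> bcells (std_bisimplex m n) p q \<rightarrow>\<^sub>E bcells X p q" for p q
  proof (rule PiE_I)
    fix x assume "x \<in> bcells (std_bisimplex m n) p q"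
    then obtain u v where x: "x = (u, v)" "u \<in> simplex_mor p m" "v \<in> simplex_mor q n" by auto
    have "h p q \<in> bcells (std_bisimplex m' n') p q \<rightarrow>\<^sub>E bcells X p q"
      using h unfolding bis_hom_def by blast
    then show "h' p q x \<in> bcells X p q" using x h' fg by (fastforce simp: PiE_def Pi_def)
  next
    fix x assume "x \<notin> bcells (std_bisimplex m n) p q"
    then show "h' p q x = undefined" by (simp add: h'_def bis_comp_def compose_def)
  qed
  have 2: "h' p' q' (bact (std_bisimplex m n) p q u v y) = bact X p q u v (h' p q y)"
    if "u \<in> simplex_mor p' p" "v \<in> simplex_mor q' q" "y \<in> bcells (std_bisimplex m n) p q"
      for p q p' q' u v y
  proof -
    from that obtain a b where y: "y = (a, b)" "a \<in> simplex_mor p m" "b \<in> simplex_mor q n" by auto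
    have "h p' q' (bact (std_bisimplex m' n') p q u v (map f a, map g b)) = bact X p q u v (h p q (map f a, map g b))"
      using h that fg[OF y(2,3)] unfolding bis_hom_def by (fastforce simp del: bact_std)
    then show ?thesis
      using y that by (simp add: h' simplex_comp_in[of _ p] simplex_comp_in[of _ q] map_simplex_comp)
  qed
  show h'_hom: "h' \<in> bis_hom (std_bisimplex m n) X"
    unfolding bis_hom_def using 1 2 by blast
  show "tag m n h' = act m n f g (tag m' n' h)"
  proof -
    have "(m, n, h m n (map f (simplex_id m), map g (simplex_id n))) = act m n f g (tag m' n' h)"
      using hom_apply[OF h, of "vals m f" m "vals n g" n] f g
      by (simp add: simplex_id_vals map_vals act_def tag_def)
    then show ?thesis using h' by (simp add: tag_def)
  qed
qed

end

section \<open>Extending maps along horns\<close>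

lemma bis_comp_hom:
  assumes "f \<in> bis_hom K L" "g \<in> bis_hom L Z" "bisimplicial_set K"
  shows "bis_comp K g f \<in> bis_hom K Z"
proof -
  have f: "f p q x \<in> bcells L p q" if "x \<in> bcells K p q" for p q x
    using assms(1) that unfolding bis_hom_def by (fastforce simp: PiE_def Pi_def)
  have g: "g p q x \<in> bcells Z p q" if "x \<in> bcells L p q" for p q x
    using assms(2) that unfolding bis_hom_def by (fastforce simp: PiE_def Pi_def)
  have K: "bact K m n u v x \<in> bcells K p q"
    if "u \<in> simplex_mor p m" "v \<in> simplex_mor q n" "x \<in> bcells K m n" for m n p q u v x
    using bact_in[OF assms(3)] that .
  have "bis_comp K g f p q \<in> bcells K p q \<rightarrow>\<^sub>E bcells Z p q" for p q
    using f g by (auto simp: bis_comp_def compose_def)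
  moreover have "bis_comp K g f p q (bact K m n u v x) = bact Z m n u v (bis_comp K g f m n x)"
    if uv: "u \<in> simplex_mor p m" "v \<in> simplex_mor q n" "x \<in> bcells K m n" for m n p q u v x
  proof -
    have "f p q (bact K m n u v x) = bact L m n u v (f m n x)"
      using assms(1) uv unfolding bis_hom_def by blast
    moreover have "g p q (bact L m n u v (f m n x)) = bact Z m n u v (g m n (f m n x))"
      using assms(2) uv f[OF uv(3)] unfolding bis_hom_def by blast
    ultimately show ?thesis using K[OF uv] uv by (simp add: bis_comp_def compose_def)
  qed
  ultimately show ?thesis unfolding bis_hom_def by blast
qed

lemma to_point_hom:
  assumes "bisimplicial_set K"
  shows "to_point K \<in> bis_hom K (std_bisimplex 0 0)"
proof -
  have r: "replicate (Suc p) 0 \<in> simplex_mor p 0" for p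
    by (auto simp: simplex_mor_def simp del: replicate.simps)
  have c: "simplex_comp (replicate (Suc p) 0) u = replicate (Suc q) 0" if "u \<in> simplex_mor q p"
    for p q u
  proof -
    have "simplex_comp (replicate (Suc p) 0) u = map (\<lambda>_. 0) u"
      using that unfolding simplex_comp_def simplex_mor_def
      by (intro map_cong refl nth_replicate) (auto simp: less_Suc_eq_le)
    then show ?thesis using that by (simp add: simplex_mor_def map_replicate_const)
  qed
  have K: "bact K m n u v x \<in> bcells K p q"
    if "u \<in> simplex_mor p m" "v \<in> simplex_mor q n" "x \<in> bcells K m n" for m n p q u v x
    using bact_in[OF assms] that .
  show ?thesis
    unfolding bis_hom_def using r c K by (auto simp: to_point_def simp del: replicate.simps)
qed

subsection \<open>Copies\<close>

text \<open>The copy of a bisimplicial set along an injection \<open>e\<close> of its cells into another type, with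
  the isomorphisms between both.\<close>

definition transport :: "('b \<Rightarrow> 'u) \<Rightarrow> 'b bisset \<Rightarrow> 'u bisset" where
  "transport e K = \<lparr>bcells = (\<lambda>p q. e ` bcells K p q),
     bact = (\<lambda>m n u v y. e (bact K m n u v (inv_into UNIV e y)))\<rparr>"

definition transport_back :: "('b \<Rightarrow> 'u) \<Rightarrow> 'b bisset \<Rightarrow> ('u, 'b) bmap" where
  "transport_back e K = (\<lambda>p q. \<lambda>y\<in>e ` bcells K p q. inv_into UNIV e y)"

definition transport_to :: "('b \<Rightarrow> 'u) \<Rightarrow> 'b bisset \<Rightarrow> ('b, 'u) bmap" where
  "transport_to e K = (\<lambda>p q. \<lambda>x\<in>bcells K p q. e x)"

lemma transport_iso:
  assumes e: "inj e" and K: "bisimplicial_set K"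
  shows "bisimplicial_set (transport e K)" "transport_back e K \<in> bis_hom (transport e K) K"
    "transport_to e K \<in> bis_hom K (transport e K)" "bis_iso (transport e K) K (transport_back e K)"
proof -
  have cl: "bact K m n u v x \<in> bcells K p q"
    if "u \<in> simplex_mor p m" "v \<in> simplex_mor q n" "x \<in> bcells K m n" for m n p q u v x
    using bact_in[OF K] that .
  have id: "bact K m n (simplex_id m) (simplex_id n) x = x" if "x \<in> bcells K m n" for m n x
    using bact_id[OF K] that .
  have comp: "bact K p q w z (bact K m n u v x) = bact K m n (simplex_comp u w) (simplex_comp v z) x"
    if "u \<in> simplex_mor p m" "v \<in> simplex_mor q n" "w \<in> simplex_mor r p" "z \<in> simplex_mor t q"
      "x \<in> bcells K m n"
    for m n p q r t u v w z x
    using bact_comp[OF K] that by simp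
  note [simp] = inv_f_f[OF e]
  show 1: "bisimplicial_set (transport e K)"
    unfolding bisimplicial_set_def transport_def
    by (auto intro: cl simp: id comp)
  show 2: "transport_back e K \<in> bis_hom (transport e K) K"
    unfolding bis_hom_def transport_def transport_back_def by (auto simp: cl)
  show 3: "transport_to e K \<in> bis_hom K (transport e K)"
    unfolding bis_hom_def transport_def transport_to_def by (auto simp: cl)
  have "bis_comp (transport e K) (transport_to e K) (transport_back e K) = bis_id (transport e K)"
    "bis_comp K (transport_back e K) (transport_to e K) = bis_id K"
    by (auto simp: bis_comp_def compose_def bis_id_def transport_def transport_back_def transport_to_def fun_eq_iff)
  then show "bis_iso (transport e K) K (transport_back e K)"
    unfolding bis_iso_def bis_arrow_def using 1 2 3 K by blast
qed

subsection \<open>Horns\<close>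

lemma bcells_std_horn:
  "bcells (std_horn m k n l) p q = {(u, v). u \<in> simplex_mor p m \<and> v \<in> simplex_mor q n \<and>
     ((\<exists>i\<le>m. i \<noteq> k \<and> i \<notin> set u) \<or> (\<exists>j\<le>n. j \<noteq> l \<and> j \<notin> set v))}"
  by (auto simp: std_horn_def bis_union_def box_def horn_def simplex_face_def std_simplex_def)

lemma bact_std_horn: "bact (std_horn m k n l) = bact (std_bisimplex m n)"
  by (simp add: std_horn_def bis_union_def box_def horn_def std_bisimplex_def std_simplex_def)

lemma set_simplex_comp:
  "u \<in> simplex_mor p m \<Longrightarrow> w \<in> simplex_mor q p \<Longrightarrow> set (simplex_comp u w) \<subseteq> set u"
  by (fastforce simp: simplex_comp_def simplex_mor_def)

lemma bisimplicial_set_horn: "bisimplicial_set (std_horn m k n l)"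
proof -
  have cl: "bact (std_horn m k n l) p q u v x \<in> bcells (std_horn m k n l) p' q'"
    if "u \<in> simplex_mor p' p" "v \<in> simplex_mor q' q" "x \<in> bcells (std_horn m k n l) p q"
      for p q p' q' u v x
  proof -
    from that obtain a b where x: "x = (a, b)" "a \<in> simplex_mor p m" "b \<in> simplex_mor q n"
      "(\<exists>i\<le>m. i \<noteq> k \<and> i \<notin> set a) \<or> (\<exists>j\<le>n. j \<noteq> l \<and> j \<notin> set b)"
      unfolding bcells_std_horn by auto
    then show ?thesis
      using that set_simplex_comp[OF x(2) that(1)] set_simplex_comp[OF x(3) that(2)]
      by (auto simp: bact_std_horn bcells_std_horn simplex_comp_in)
  qed
  have sub: "x \<in> bcells (std_bisimplex m n) p q" if "x \<in> bcells (std_horn m k n l) p q" for p q x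
    using that by (auto simp: bcells_std_horn)
  note S = bisimplicial_set_std[of m n]
  show ?thesis
    unfolding bisimplicial_set_def
  proof (intro conjI allI ballI)
    show "bact (std_horn m k n l) p q (simplex_id p) (simplex_id q) x = x"
      if "x \<in> bcells (std_horn m k n l) p q" for p q x
      using bact_id[OF S sub[OF that]] by (simp add: bact_std_horn)
    show "bact (std_horn m k n l) p q w z (bact (std_horn m k n l) m' n' u v x) =
        bact (std_horn m k n l) m' n' (simplex_comp u w) (simplex_comp v z) x"
      if "u \<in> simplex_mor p m'" "v \<in> simplex_mor q n'" "w \<in> simplex_mor r p" "z \<in> simplex_mor t q"
        "x \<in> bcells (std_horn m k n l) m' n'" for m' n' p q r t u v w z x
      using bact_comp[OF S that(1,2) sub[OF that(5)] that(3,4)] by (simp add: bact_std_horn)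
  qed (rule cl)
qed

text \<open>The cells of standard bisimplices form a countable type. So the generating horns have
  copies with cells in the infinite type \<open>'u\<close>, to which the lifting property applies.\<close>

lemma horn_extension:
  fixes X :: "'a bisset"
  assumes X: "fibrant TYPE('u :: infinite) X"
    and mn: "1 \<le> m" "1 \<le> n" "k \<le> m" "l \<le> n"
    and f: "f \<in> bis_hom (std_horn m k n l) X"
  shows "\<exists>h\<in>bis_hom (std_bisimplex m n) X. \<forall>p q. \<forall>x\<in>bcells (std_horn m k n l) p q. h p q x = f p q x"
proof -
  obtain g :: "nat \<Rightarrow> 'u" where "inj g"
    using infinite_countable_subset[OF infinite_UNIV] by auto
  define e :: "bisimplex \<Rightarrow> 'u" where "e = g \<circ> to_nat"
  have e: "inj e" unfolding e_def using \<open>inj g\<close> by (intro inj_compose) auto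
  let ?H = "std_horn m k n l" and ?S = "std_bisimplex m n"
  let ?A = "transport e ?H" and ?B = "transport e ?S"
  note iA = transport_iso[OF e bisimplicial_set_horn[of m k n l]]
  note iB = transport_iso[OF e bisimplicial_set_std[of m n]]
  have sub: "bcells ?H p q \<subseteq> bcells ?S p q" for p q by (auto simp: bcells_std_horn)
  define j where "j p q = (\<lambda>y\<in>bcells ?A p q. y)" for p q
  have clA: "bact ?A p q u v y \<in> bcells ?A p' q'"
    if "u \<in> simplex_mor p' p" "v \<in> simplex_mor q' q" "y \<in> bcells ?A p q" for p q p' q' u v y
    using bact_in[OF iA(1)] that .
  have subAB: "y \<in> bcells ?A p q \<Longrightarrow> y \<in> bcells ?B p q" for p q y
    using sub[of p q] by (auto simp: transport_def simp del: bcells_std)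
  have "bact ?A = bact ?B" by (simp add: transport_def bact_std_horn)
  then have jh: "j \<in> bis_hom ?A ?B"
    unfolding bis_hom_def using clA subAB by (auto simp: j_def)
  then have jarr: "bis_arrow ?A ?B j" unfolding bis_arrow_def using iA(1) iB(1) by blast
  have "bis_comp ?A (transport_back e ?S) j = transport_back e ?H"
    using sub by (auto simp: bis_comp_def compose_def j_def transport_def transport_back_def fun_eq_iff)
  with jarr iA(4) iB(4) have "anodyne_saturation ?A ?B j"
    using mn by (intro anodyne_saturation.generator)
  moreover have "bis_mono ?A ?B j"
    unfolding bis_mono_def using jarr by (auto simp: j_def inj_on_def)
  ultimately have "right_lifting_property ?A ?B j X (std_bisimplex 0 0) (to_point X)"
    using X unfolding fibrant_def fibration_def anodyne_extension_def by blast
  moreover define f' where "f' = bis_comp ?A f (transport_back e ?H)"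
  have f': "f' \<in> bis_hom ?A X" unfolding f'_def using iA f by (intro bis_comp_hom)
  moreover have "to_point ?B \<in> bis_hom ?B (std_bisimplex 0 0)" by (rule to_point_hom) (rule iB)
  moreover have "bis_comp ?A (to_point X) f' = bis_comp ?A (to_point ?B) j"
  proof -
    have "f' p q y \<in> bcells X p q" if "y \<in> bcells ?A p q" for p q y
      using f' that unfolding bis_hom_def by (fastforce simp: PiE_def Pi_def)
    moreover have "j p q y \<in> bcells ?B p q" if "y \<in> bcells ?A p q" for p q y
      using jh that unfolding bis_hom_def by (fastforce simp: PiE_def Pi_def)
    ultimately show ?thesis by (auto simp: bis_comp_def compose_def to_point_def fun_eq_iff)
  qed
  ultimately obtain h' where h': "h' \<in> bis_hom ?B X" "bis_comp ?A h' j = f'"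
    unfolding right_lifting_property_def by blast
  define h where "h = bis_comp ?S h' (transport_to e ?S)"
  have "h \<in> bis_hom ?S X"
    unfolding h_def using iB h' bisimplicial_set_std by (intro bis_comp_hom)
  moreover have "h p q x = f p q x" if x: "x \<in> bcells ?H p q" for p q x
  proof -
    have "h p q x = h' p q (e x)"
      using x sub by (auto simp: h_def bis_comp_def compose_def transport_to_def)
    also have "\<dots> = bis_comp ?A h' j p q (e x)"
      using x by (auto simp: bis_comp_def compose_def j_def transport_def)
    also have "\<dots> = f' p q (e x)" using h' by simp
    also have "\<dots> = f p q x"
      using x inv_f_f[OF e] by (auto simp: f'_def bis_comp_def compose_def transport_def transport_back_def)
    finally show ?thesis .
  qed
  ultimately show ?thesis by blast
qed

section \<open>Horn filling for the cells of a fibrant bisimplicial set\<close>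

locale pointed_bisset = bisset X for X :: "'a bisset" +
  fixes pt :: "(bisimplex, 'a) bmap"
  assumes pt: "pt \<in> bis_hom (std_bisimplex 0 0) X"
begin

text \<open>The multiple of the base point of dimensions \<open>(a, b)\<close>.\<close>

definition star :: "nat \<Rightarrow> nat \<Rightarrow> 'a tagged" where
  "star a b = act a b (\<lambda>_. 0) (\<lambda>_. 0) (tag 0 0 pt)"

lemma act_star:
  "monotone_map p a f \<Longrightarrow> monotone_map q b g \<Longrightarrow> act p q f g (star a b) = star p q"
  unfolding star_def using tag_in[OF pt] by (simp add: act_act comp_def)

lemma star_in [simp]: "star a b \<in> cells"
  unfolding star_def using tag_in[OF pt] by (intro act_in) auto

lemma dim_star [simp]: "dim1 (star a b) = a" "dim2 (star a b) = b"
  by (simp_all add: star_def)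

lemma base_cells_1: "base_cells cells dim1 dim2 face degen star"
  by unfold_locales (simp_all add: face_def degen_def act_star monotone_map_coface monotone_map_codegen)

lemma base_cells_2: "base_cells cells dim2 dim1 face' degen' (\<lambda>a b. star b a)"
  by unfold_locales (simp_all add: face'_def degen'_def act_star monotone_map_coface monotone_map_codegen)

lemma const_map_star: "x \<in> bcells K p q \<Longrightarrow> (p, q, const_map K pt p q x) = star p q"
proof -
  assume x: "x \<in> bcells K p q"
  have r: "replicate (Suc p) 0 \<in> simplex_mor p 0" for p
    by (auto simp: simplex_mor_def simp del: replicate.simps)
  have "(p, q, const_map K pt p q x) = (p, q, pt p q (replicate (Suc p) 0, replicate (Suc q) 0))"
    using x by (simp add: const_map_def bis_comp_def compose_def to_point_def)
  also have "\<dots> = act p q ((!) (replicate (Suc p) 0)) ((!) (replicate (Suc q) 0)) (tag 0 0 pt)"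
    by (rule hom_apply_act[OF pt r r])
  also have "\<dots> = star p q"
    unfolding star_def by (rule act_cong) (auto simp: less_Suc_eq_le simp del: replicate.simps)
  finally show ?thesis .
qed

lemma const_map_hom: "bisimplicial_set K \<Longrightarrow> const_map K pt \<in> bis_hom K X"
  unfolding const_map_def by (rule bis_comp_hom[OF to_point_hom pt])

lemma tag_const_map: "tag m n (const_map (std_bisimplex m n) pt) = star m n"
  using const_map_star[of "(simplex_id m, simplex_id n)" "std_bisimplex m n" m n]
    by (simp add: tag_def)

end

text \<open>A map \<open>u\<close> that omits the value \<open>i\<close> factors as \<open>coface i \<circ> (codegen i \<circ> u)\<close>, and the second
  factor is a morphism of the simplex category.\<close>

lemma monotone_map_codegen_comp:
  assumes "monotone_map p (Suc m) u" "i \<le> Suc m" "\<And>x. x \<le> p \<Longrightarrow> u x \<noteq> i"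
  shows "monotone_map p m (codegen i \<circ> u)"
proof -
  have "codegen i (u x) \<le> m" if "x \<le> p" for x
  proof -
    have "u x \<le> Suc m" "u x \<noteq> i" using assms that unfolding monotone_map_def by auto
    then show ?thesis using assms(2) unfolding codegen_def by auto
  qed
  moreover have "codegen i a \<le> codegen i b" if "a \<le> b" for a b
    using that unfolding codegen_def by auto
  ultimately show ?thesis using assms unfolding monotone_map_def by auto
qed

context bisset
begin

text \<open>Compatible faces \<open>F i\<close>, \<open>G j\<close> define a map \<open>f\<close> on the horn: a pair \<open>(u, v)\<close> in which \<open>u\<close>
  omits \<open>i\<close> is sent to the image of \<open>F i\<close>, and a pair in which \<open>v\<close> omits \<open>j\<close> to the image of
  \<open>G j\<close>. The compatibility conditions say precisely that the result does not depend on the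
  omitted value chosen.\<close>

lemma horn_filling_cells:
  assumes fib: "fibrant TYPE('u :: infinite) X"
  shows "horn_filling cells dim1 dim2 face face'"
  unfolding horn_filling_def
proof (intro allI impI, goal_cases)
  case (1 M N k l F G)
  note MN = 1(1-4) and F = 1(5)[rule_format] and G = 1(6)[rule_format]
    and FF = 1(7)[rule_format] and GG = 1(8)[rule_format] and FG = 1(9)[rule_format]
  obtain M' N' where MN': "M = Suc M'" "N = Suc N'" using MN by (metis gr0_implies_Suc)
  let ?A = "\<lambda>p q i u v. act p q (codegen i \<circ> (!) u) ((!) v) (F i)"
  let ?B = "\<lambda>p q j u v. act p q ((!) u) (codegen j \<circ> (!) v) (G j)"
  have cg: "monotone_map p M' (codegen i \<circ> (!) u)" if "u \<in> simplex_mor p M" "i \<le> M" "i \<notin> set u"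
    for p u i
    using that monotone_map_nth[OF that(1)] unfolding MN'
    by - (rule monotone_map_codegen_comp; auto simp: simplex_mor_def less_Suc_eq_le)
  have cg': "monotone_map p N' (codegen i \<circ> (!) u)" if "u \<in> simplex_mor p N" "i \<le> N" "i \<notin> set u"
    for p u i
    using that monotone_map_nth[OF that(1)] unfolding MN'
    by - (rule monotone_map_codegen_comp; auto simp: simplex_mor_def less_Suc_eq_le)
  have AA: "?A p q i u v = ?A p q i' u v"
    if uv: "u \<in> simplex_mor p M" "v \<in> simplex_mor q N" and i: "i < i'" "i' \<le> M" "i \<noteq> k" "i' \<noteq> k"
      "i \<notin> set u" "i' \<notin> set u"
    for p q u v i i'
  proof -
    obtain M'' where M'': "M' = Suc M''" using i MN MN' by (cases M') auto
    define w where "w = codegen i \<circ> (codegen i' \<circ> (!) u)"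
    have len: "x \<le> p \<Longrightarrow> x < length u" for x using uv by (auto simp: simplex_mor_def)
    have ne: "u ! x \<noteq> i" "u ! x \<noteq> i'" if "x \<le> p" for x using i len[OF that] by auto
    have w: "monotone_map p M'' w"
      unfolding w_def using cg[OF uv(1) i(2) i(6)] i MN' ne unfolding M''
      by - (rule monotone_map_codegen_comp; auto simp: codegen_def)
    have "?A p q i' u v = act p q (coface i \<circ> w) (id \<circ> (!) v) (F i')"
      using ne i by (intro act_cong) (force simp: w_def codegen_def coface_def)+
    also have "\<dots> = act p q w ((!) v) (face i (F i'))"
      unfolding face_def using F[OF i(2,4)] MN' M'' w monotone_map_nth[OF uv(2)]
      by (subst act_act) (auto intro: monotone_map_coface[of "Suc M''", simplified])
    also have "\<dots> = act p q w ((!) v) (face (i' - 1) (F i))" using FF[OF i(1,2,3,4)] by simp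
    also have "\<dots> = act p q (coface (i' - 1) \<circ> w) (id \<circ> (!) v) (F i)"
      unfolding face_def using F[of i] i MN' M'' w monotone_map_nth[OF uv(2)]
      by (subst act_act) (auto intro: monotone_map_coface[of "Suc M''", simplified])
    also have "\<dots> = ?A p q i u v"
    proof (rule act_cong)
      fix x assume "x \<le> p"
      then show "(coface (i' - 1) \<circ> w) x = (codegen i \<circ> (!) u) x"
        using ne[of x] i(1) by (auto simp: w_def codegen_def coface_def)
    qed simp
    finally show ?thesis by simp
  qed
  have BB: "?B p q j u v = ?B p q j' u v"
    if uv: "u \<in> simplex_mor p M" "v \<in> simplex_mor q N" and j: "j < j'" "j' \<le> N" "j \<noteq> l" "j' \<noteq> l"
      "j \<notin> set v" "j' \<notin> set v"
    for p q u v j j'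
  proof -
    obtain N'' where N'': "N' = Suc N''" using j MN MN' by (cases N') auto
    define w where "w = codegen j \<circ> (codegen j' \<circ> (!) v)"
    have len: "x \<le> q \<Longrightarrow> x < length v" for x using uv by (auto simp: simplex_mor_def)
    have ne: "v ! x \<noteq> j" "v ! x \<noteq> j'" if "x \<le> q" for x using j len[OF that] by auto
    have w: "monotone_map q N'' w"
      unfolding w_def using cg'[OF uv(2) j(2) j(6)] j MN' ne unfolding N''
      by - (rule monotone_map_codegen_comp; auto simp: codegen_def)
    have "?B p q j' u v = act p q (id \<circ> (!) u) (coface j \<circ> w) (G j')"
      using ne j by (intro act_cong) (force simp: w_def codegen_def coface_def)+
    also have "\<dots> = act p q ((!) u) w (face' j (G j'))"
      unfolding face'_def using G[OF j(2,4)] MN' N'' w monotone_map_nth[OF uv(1)]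
      by (subst act_act) (auto intro: monotone_map_coface[of "Suc N''", simplified])
    also have "\<dots> = act p q ((!) u) w (face' (j' - 1) (G j))" using GG[OF j(1,2,3,4)] by simp
    also have "\<dots> = act p q (id \<circ> (!) u) (coface (j' - 1) \<circ> w) (G j)"
      unfolding face'_def using G[of j] j MN' N'' w monotone_map_nth[OF uv(1)]
      by (subst act_act) (auto intro: monotone_map_coface[of "Suc N''", simplified])
    also have "\<dots> = ?B p q j u v"
    proof (rule act_cong)
      fix x assume "x \<le> q"
      then show "(coface (j' - 1) \<circ> w) x = (codegen j \<circ> (!) v) x"
        using ne[of x] j(1) by (auto simp: w_def codegen_def coface_def)
    qed simp
    finally show ?thesis by simp
  qed
  have AB: "?A p q i u v = ?B p q j u v"
    if uv: "u \<in> simplex_mor p M" "v \<in> simplex_mor q N" and ij: "i \<le> M" "i \<noteq> k" "i \<notin> set u" "j \<le> N"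
      "j \<noteq> l" "j \<notin> set v"
    for p q u v i j
  proof -
    have len: "x \<le> p \<Longrightarrow> x < length u" "x \<le> q \<Longrightarrow> x < length v" for x using uv
      by (auto simp: simplex_mor_def)
    have ne: "x \<le> p \<Longrightarrow> u ! x \<noteq> i" "x \<le> q \<Longrightarrow> v ! x \<noteq> j" for x using ij len[of x] by auto
    have "?A p q i u v = act p q (id \<circ> (codegen i \<circ> (!) u)) (coface j \<circ> (codegen j \<circ> (!) v)) (F i)"
      using ne by (intro act_cong) (force simp: codegen_def coface_def)+
    also have "\<dots> = act p q (codegen i \<circ> (!) u) (codegen j \<circ> (!) v) (face' j (F i))"
      unfolding face'_def using F[OF ij(1,2)] MN' cg[OF uv(1) ij(1,3)] cg'[OF uv(2) ij(4,6)]
      by (subst act_act) (auto intro: monotone_map_coface[of "Suc N'", simplified])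
    also have "\<dots> = act p q (codegen i \<circ> (!) u) (codegen j \<circ> (!) v) (face i (G j))" using FG ij
      by simp
    also have "\<dots> = act p q (coface i \<circ> (codegen i \<circ> (!) u)) (id \<circ> (codegen j \<circ> (!) v)) (G j)"
      unfolding face_def using G[OF ij(4,5)] MN' cg[OF uv(1) ij(1,3)] cg'[OF uv(2) ij(4,6)]
      by (subst act_act) (auto intro: monotone_map_coface[of "Suc M'", simplified])
    also have "\<dots> = ?B p q j u v"
      using ne by (intro act_cong) (force simp: codegen_def coface_def)+
    finally show ?thesis .
  qed
  let ?H = "std_horn M k N l"
  define val where "val p q u v z \<longleftrightarrow>
    (\<exists>i\<le>M. i \<noteq> k \<and> i \<notin> set u \<and> z = ?A p q i u v) \<or> (\<exists>j\<le>N. j \<noteq> l \<and> j \<notin> set v \<and> z = ?B p q j u v)"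
    for p q u v z
  have AA': "?A p q i u v = ?A p q i' u v"
    if uv: "u \<in> simplex_mor p M" "v \<in> simplex_mor q N"
      and i: "i \<le> M" "i' \<le> M" "i \<noteq> k" "i' \<noteq> k" "i \<notin> set u" "i' \<notin> set u" for p q u v i i'
  proof (cases i i' rule: linorder_cases)
    case less then show ?thesis using AA[OF uv _ i(2-6)] by blast
  next
    case greater then show ?thesis using AA[OF uv _ i(1) i(4) i(3) i(6) i(5)] by simp
  qed simp
  have BB': "?B p q j u v = ?B p q j' u v"
    if uv: "u \<in> simplex_mor p M" "v \<in> simplex_mor q N"
      and j: "j \<le> N" "j' \<le> N" "j \<noteq> l" "j' \<noteq> l" "j \<notin> set v" "j' \<notin> set v" for p q u v j j'
  proof (cases j j' rule: linorder_cases)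
    case less then show ?thesis using BB[OF uv _ j(2-6)] by blast
  next
    case greater then show ?thesis using BB[OF uv _ j(1) j(4) j(3) j(6) j(5)] by simp
  qed simp
  have val_unique: "z = z'" if uv: "u \<in> simplex_mor p M" "v \<in> simplex_mor q N"
      and z: "val p q u v z" "val p q u v z'" for p q u v z z'
    using z unfolding val_def
  proof (elim disjE exE conjE)
    fix i i' assume "i \<le> M" "i \<noteq> k" "i \<notin> set u" "z = ?A p q i u v" "i' \<le> M" "i' \<noteq> k" "i' \<notin> set u"
      "z' = ?A p q i' u v"
    then show ?thesis using AA'[OF uv] by blast
  next
    fix i j assume "i \<le> M" "i \<noteq> k" "i \<notin> set u" "z = ?A p q i u v" "j \<le> N" "j \<noteq> l" "j \<notin> set v"
      "z' = ?B p q j u v"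
    then show ?thesis using AB[OF uv] by blast
  next
    fix i j assume "i \<le> M" "i \<noteq> k" "i \<notin> set u" "z' = ?A p q i u v" "j \<le> N" "j \<noteq> l" "j \<notin> set v"
      "z = ?B p q j u v"
    then show ?thesis using AB[OF uv] by metis
  next
    fix j j' assume "j \<le> N" "j \<noteq> l" "j \<notin> set v" "z = ?B p q j u v" "j' \<le> N" "j' \<noteq> l" "j' \<notin> set v"
      "z' = ?B p q j' u v"
    then show ?thesis using BB'[OF uv] by blast
  qed
  have val_ex: "\<exists>z. val p q u v z" if "(u, v) \<in> bcells ?H p q" for p q u v
    using that unfolding bcells_std_horn val_def by blast
  have val_cell: "z \<in> cells \<and> dim1 z = p \<and> dim2 z = q"
    if "u \<in> simplex_mor p M" "v \<in> simplex_mor q N" "val p q u v z" for p q u v z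
    using that(3) unfolding val_def
  proof (elim disjE exE conjE)
    fix i assume "i \<le> M" "i \<noteq> k" "i \<notin> set u" "z = ?A p q i u v"
    then show ?thesis using F[of i] cg[OF that(1)] monotone_map_nth[OF that(2)] MN'
      by (auto intro!: act_in)
  next
    fix j assume "j \<le> N" "j \<noteq> l" "j \<notin> set v" "z = ?B p q j u v"
    then show ?thesis using G[of j] cg'[OF that(2)] monotone_map_nth[OF that(1)] MN'
      by (auto intro!: act_in)
  qed
  have val_act: "val p' q' (simplex_comp u a) (simplex_comp v b) (act p' q' ((!) a) ((!) b) z)"
    if u: "u \<in> simplex_mor p M" and v: "v \<in> simplex_mor q N" and z: "val p q u v z"
      and a: "a \<in> simplex_mor p' p" and b: "b \<in> simplex_mor q' q" for p q u v z p' q' a b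
  proof -
    note ma = monotone_map_nth[OF a] and mb = monotone_map_nth[OF b]
    have la: "x \<le> p' \<Longrightarrow> x < length a" and lb: "x \<le> q' \<Longrightarrow> x < length b" for x
      using a b by (auto simp: simplex_mor_def)
    have nu: "simplex_comp u a ! x = u ! (a ! x)" if "x \<le> p'" for x
      using la[OF that] by (simp add: simplex_comp_def)
    have nv: "simplex_comp v b ! x = v ! (b ! x)" if "x \<le> q'" for x
      using lb[OF that] by (simp add: simplex_comp_def)
    show ?thesis using z unfolding val_def
    proof (elim disjE exE conjE)
      fix i assume i: "i \<le> M" "i \<noteq> k" "i \<notin> set u" "z = ?A p q i u v"
      have "act p' q' ((!) a) ((!) b) z = act p' q' ((codegen i \<circ> (!) u) \<circ> (!) a) ((!) v \<circ> (!) b) (F i)"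
        unfolding i(4) using F[OF i(1,2)] cg[OF u i(1,3)] monotone_map_nth[OF v] MN' ma mb
        by (subst act_act) auto
      also have "\<dots> = ?A p' q' i (simplex_comp u a) (simplex_comp v b)"
        using nu nv by (intro act_cong) auto
      finally have "act p' q' ((!) a) ((!) b) z = ?A p' q' i (simplex_comp u a) (simplex_comp v b)" .
      moreover have "i \<notin> set (simplex_comp u a)" using set_simplex_comp[OF u a] i by blast
      ultimately show "(\<exists>i\<le>M. i \<noteq> k \<and> i \<notin> set (simplex_comp u a) \<and>
           act p' q' ((!) a) ((!) b) z = ?A p' q' i (simplex_comp u a) (simplex_comp v b)) \<or>
        (\<exists>j\<le>N. j \<noteq> l \<and> j \<notin> set (simplex_comp v b) \<and>
           act p' q' ((!) a) ((!) b) z = ?B p' q' j (simplex_comp u a) (simplex_comp v b))"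
        using i by blast
    next
      fix j assume j: "j \<le> N" "j \<noteq> l" "j \<notin> set v" "z = ?B p q j u v"
      have "act p' q' ((!) a) ((!) b) z = act p' q' ((!) u \<circ> (!) a) ((codegen j \<circ> (!) v) \<circ> (!) b) (G j)"
        unfolding j(4) using G[OF j(1,2)] cg'[OF v j(1,3)] monotone_map_nth[OF u] MN' ma mb
        by (subst act_act) auto
      also have "\<dots> = ?B p' q' j (simplex_comp u a) (simplex_comp v b)"
        using nu nv by (intro act_cong) auto
      finally have "act p' q' ((!) a) ((!) b) z = ?B p' q' j (simplex_comp u a) (simplex_comp v b)" .
      moreover have "j \<notin> set (simplex_comp v b)" using set_simplex_comp[OF v b] j by blast
      ultimately show "(\<exists>i\<le>M. i \<noteq> k \<and> i \<notin> set (simplex_comp u a) \<and>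
           act p' q' ((!) a) ((!) b) z = ?A p' q' i (simplex_comp u a) (simplex_comp v b)) \<or>
        (\<exists>j\<le>N. j \<noteq> l \<and> j \<notin> set (simplex_comp v b) \<and>
           act p' q' ((!) a) ((!) b) z = ?B p' q' j (simplex_comp u a) (simplex_comp v b))"
        using j by blast
    qed
  qed
  define f where "f p q = (\<lambda>(u, v)\<in>bcells ?H p q. snd (snd (THE z. val p q u v z)))" for p q
  have f: "(p, q, f p q (u, v)) = z" if "(u, v) \<in> bcells ?H p q" "val p q u v z" for p q u v z
  proof -
    have uv: "u \<in> simplex_mor p M" "v \<in> simplex_mor q N" using that by (auto simp: bcells_std_horn)
    have "(THE z. val p q u v z) = z" using val_unique[OF uv] that by blast
    then show ?thesis using val_cell[OF uv that(2)] that(1)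
      by (cases z) (auto simp: f_def dim1_def dim2_def)
  qed
  have "f \<in> bis_hom ?H X"
    unfolding bis_hom_def
  proof (intro CollectI conjI allI ballI)
    fix p q
    show "f p q \<in> bcells ?H p q \<rightarrow>\<^sub>E bcells X p q"
    proof (rule PiE_I)
      fix x assume x: "x \<in> bcells ?H p q"
      then obtain u v where uv: "x = (u, v)" "u \<in> simplex_mor p M" "v \<in> simplex_mor q N"
        by (auto simp: bcells_std_horn)
      obtain z where z: "val p q u v z" using val_ex x uv by blast
      then show "f p q x \<in> bcells X p q"
        using f[OF x[unfolded uv(1)] z] val_cell[OF uv(2,3) z] uv(1) by (auto simp: cells_def)
    qed (simp add: f_def)
  next
    fix p q p' q' a b x
    assume a: "a \<in> simplex_mor p' p" and b: "b \<in> simplex_mor q' q" and x: "x \<in> bcells ?H p q"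
    then obtain u v where uv: "x = (u, v)" "u \<in> simplex_mor p M" "v \<in> simplex_mor q N"
      by (auto simp: bcells_std_horn)
    obtain z where z: "val p q u v z" using val_ex x uv by blast
    have x': "bact ?H p q a b x = (simplex_comp u a, simplex_comp v b)"
      using uv by (simp add: bact_std_horn)
    have "(simplex_comp u a, simplex_comp v b) \<in> bcells ?H p' q'"
      using bact_in[OF bisimplicial_set_horn a b x] x' by simp
    from f[OF this val_act[OF uv(2,3) z a b]]
    have "(p', q', f p' q' (bact ?H p q a b x)) = act p' q' ((!) a) ((!) b) z" unfolding x' .
    also have "z = (p, q, f p q x)" using f[OF x[unfolded uv(1)] z] uv by simp
    finally show "f p' q' (bact ?H p q a b x) = bact X p q a b (f p q x)"
      using a b by (simp add: act_def vals_nth)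
  qed
  then obtain h where h: "h \<in> bis_hom (std_bisimplex M N) X" "\<And>p q x. x \<in> bcells ?H p q \<Longrightarrow>
    h p q x = f p q x"
    using horn_extension[OF fib, of M N k l f] MN by auto
  have hval: "act p q g g' (tag M N h) = z"
    if "monotone_map p M g" "monotone_map q N g'" "(vals p g, vals q g') \<in> bcells ?H p q"
      "val p q (vals p g) (vals q g') z" for p q g g' z
  proof -
    have "act p q g g' (tag M N h) = (p, q, h p q (vals p g, vals q g'))"
      using hom_apply[OF h(1), of "vals p g" p "vals q g'" q] that by (simp add: act_def tag_def)
    then show ?thesis using h(2) f that by simp
  qed
  have "face i (tag M N h) = F i" if i: "i \<le> M" "i \<noteq> k" for i
  proof -
    let ?u = "vals M' (coface i)" and ?v = "vals N id"
    have mon: "monotone_map M' M (coface i)" "monotone_map N N id"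
      using monotone_map_coface[of M i] MN' by auto
    have iu: "i \<notin> set ?u" by (auto simp: set_vals coface_def)
    have "?A M' N i ?u ?v = F i"
      using F[OF i] MN' by (intro act_id) (auto simp: codegen_def coface_def)
    then have "val M' N ?u ?v (F i)" unfolding val_def using i iu by metis
    moreover have "(?u, ?v) \<in> bcells ?H M' N" using mon i iu by (auto simp: bcells_std_horn)
    ultimately show ?thesis using hval[OF mon] MN' by (simp add: face_def)
  qed
  moreover have "face' j (tag M N h) = G j" if j: "j \<le> N" "j \<noteq> l" for j
  proof -
    let ?u = "vals M id" and ?v = "vals N' (coface j)"
    have mon: "monotone_map M M id" "monotone_map N' N (coface j)"
      using monotone_map_coface[of N j] MN' by auto
    have jv: "j \<notin> set ?v" by (auto simp: set_vals coface_def)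
    have "?B M N' j ?u ?v = G j"
      using G[OF j] MN' by (intro act_id) (auto simp: codegen_def coface_def)
    then have "val M N' ?u ?v (G j)" unfolding val_def using j jv by metis
    moreover have "(?u, ?v) \<in> bcells ?H M N'" using mon j jv by (auto simp: bcells_std_horn)
    ultimately show ?thesis using hval[OF mon] MN' by (simp add: face'_def)
  qed
  ultimately show ?case using tag_in[OF h(1)] by (intro bexI[of _ "tag M N h"]) auto
qed

end

section \<open>Bott-Chern maps and fillers as cells\<close>

lemma bcells_std_boundary:
  "bcells (std_boundary m n) p q = {(u, v). u \<in> simplex_mor p m \<and> v \<in> simplex_mor q n \<and>
     ((\<exists>i\<le>m. i \<notin> set u) \<or> (\<exists>j\<le>n. j \<notin> set v))}"
  by (auto simp: std_boundary_def bis_union_def box_def boundary_def simplex_face_def std_simplex_def)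

context pointed_bisset
begin

text \<open>If \<open>f\<close> omits the value \<open>i\<close>, then the action of \<open>f\<close> and \<open>g\<close> on a cell depends only on its
  face \<open>i\<close>.\<close>

lemma act_missing:
  assumes "c \<in> cells" "0 < dim1 c" "i \<le> dim1 c" "monotone_map p (dim1 c) f"
    "monotone_map q (dim2 c) g"
    "\<And>x. x \<le> p \<Longrightarrow> f x \<noteq> i"
  shows "act p q f g c = act p q (codegen i \<circ> f) g (face i c)"
proof -
  obtain m where m: "dim1 c = Suc m" using assms(2) gr0_implies_Suc by blast
  have "act p q f g c = act p q (coface i \<circ> (codegen i \<circ> f)) (id \<circ> g) c"
    using assms(6) by (intro act_cong) (force simp: codegen_def coface_def)+
  also have "\<dots> = act p q (codegen i \<circ> f) g (face i c)"
    unfolding face_def using assms m monotone_map_codegen_comp[of p m f i] monotone_map_coface[of "Suc m" i]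
    by (subst act_act) auto
  finally show ?thesis .
qed

lemma act_missing':
  assumes "c \<in> cells" "0 < dim2 c" "j \<le> dim2 c" "monotone_map p (dim1 c) f"
    "monotone_map q (dim2 c) g"
    "\<And>x. x \<le> q \<Longrightarrow> g x \<noteq> j"
  shows "act p q f g c = act p q f (codegen j \<circ> g) (face' j c)"
proof -
  obtain n where n: "dim2 c = Suc n" using assms(2) gr0_implies_Suc by blast
  have "act p q f g c = act p q (id \<circ> f) (coface j \<circ> (codegen j \<circ> g)) c"
    using assms(6) by (intro act_cong) (force simp: codegen_def coface_def)+
  also have "\<dots> = act p q f (codegen j \<circ> g) (face' j c)"
    unfolding face'_def using assms n monotone_map_codegen_comp[of q n g j] monotone_map_coface[of "Suc n" j]
    by (subst act_act) auto
  finally show ?thesis .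
qed

lemma codegen_comp_monotone:
  assumes "c \<in> cells" "0 < dim1 c" "i \<le> dim1 c" "monotone_map p (dim1 c) f" "\<And>x. x \<le> p \<Longrightarrow> f x \<noteq> i"
  shows "monotone_map p (dim1 (face i c)) (codegen i \<circ> f)"
  using monotone_map_codegen_comp[of p "dim1 c - 1" f i] assms by simp

lemma codegen_comp_monotone':
  assumes "c \<in> cells" "0 < dim2 c" "i \<le> dim2 c" "monotone_map p (dim2 c) f" "\<And>x. x \<le> p \<Longrightarrow> f x \<noteq> i"
  shows "monotone_map p (dim2 (face' i c)) (codegen i \<circ> f)"
  using monotone_map_codegen_comp[of p "dim2 c - 1" f i] assms by simp

lemma act_missing_star:
  assumes "c \<in> cells" "0 < dim1 c" "i \<le> dim1 c" "monotone_map p (dim1 c) f"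
    "monotone_map q (dim2 c) g"
    "\<And>x. x \<le> p \<Longrightarrow> f x \<noteq> i" "face i c = star a b"
  shows "act p q f g c = star p q"
proof -
  have "act p q f g c = act p q (codegen i \<circ> f) g (star a b)"
    using act_missing[OF assms(1-6)] unfolding assms(7) .
  moreover have "monotone_map p a (codegen i \<circ> f)"
    using codegen_comp_monotone[OF assms(1-4,6)] unfolding assms(7) dim_star .
  moreover have "monotone_map q b g"
    using assms(5) dim_ops(2)[of i c] unfolding assms(7) dim_star by simp
  ultimately show ?thesis by (simp only: act_star)
qed

lemma act_missing_star':
  assumes "c \<in> cells" "0 < dim2 c" "j \<le> dim2 c" "monotone_map p (dim1 c) f"
    "monotone_map q (dim2 c) g"
    "\<And>x. x \<le> q \<Longrightarrow> g x \<noteq> j" "face' j c = star a b"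
  shows "act p q f g c = star p q"
proof -
  have "act p q f g c = act p q f (codegen j \<circ> g) (star a b)"
    using act_missing'[OF assms(1-6)] unfolding assms(7) .
  moreover have "monotone_map q b (codegen j \<circ> g)"
    using codegen_comp_monotone'[OF assms(1-3,5,6)] unfolding assms(7) dim_star .
  moreover have "monotone_map p a f"
    using assms(4) dim_ops(3)[of j c] unfolding assms(7) dim_star by simp
  ultimately show ?thesis by (simp only: act_star)
qed

lemma tag_faces:
  assumes "h \<in> bis_hom (std_bisimplex (Suc m) n) X"
  shows "face1 m n i h \<in> bis_hom (std_bisimplex m n) X"
    "tag m n (face1 m n i h) = face i (tag (Suc m) n h)"
  using precompose[OF assms, of m "coface i" n id] monotone_map_coface[of "Suc m" i]
  by (simp_all add: face1_def face_def)

lemma tag_faces':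
  assumes "h \<in> bis_hom (std_bisimplex m (Suc n)) X"
  shows "face2 m n j h \<in> bis_hom (std_bisimplex m n) X"
    "tag m n (face2 m n j h) = face' j (tag m (Suc n) h)"
  using precompose[OF assms, of m id n "coface j"] monotone_map_coface[of "Suc n" j]
  by (simp_all add: face2_def face'_def)

lemma tag_degens:
  assumes "h \<in> bis_hom (std_bisimplex m n) X" "i \<le> m"
  shows "degen1 m n i h \<in> bis_hom (std_bisimplex (Suc m) n) X"
    "tag (Suc m) n (degen1 m n i h) = degen i (tag m n h)"
  using precompose[OF assms(1), of "Suc m" "codegen i" n id] monotone_map_codegen[OF assms(2)]
  by (simp_all add: degen1_def degen_def)

lemma tag_degens':
  assumes "h \<in> bis_hom (std_bisimplex m n) X" "j \<le> n"
  shows "degen2 m n j h \<in> bis_hom (std_bisimplex m (Suc n)) X"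
    "tag m (Suc n) (degen2 m n j h) = degen' j (tag m n h)"
  using precompose[OF assms(1), of m id "Suc n" "codegen j"] monotone_map_codegen[OF assms(2)]
  by (simp_all add: degen2_def degen'_def)

lemma hom_eq_iff:
  assumes "f \<in> bis_hom (std_bisimplex m n) X" "g \<in> bis_hom (std_bisimplex m n) X"
  shows "f = g \<longleftrightarrow> tag m n f = tag m n g"
  using tag_inj[OF assms] by auto

lemma rel_const_iff:
  assumes "\<And>p q. bcells L p q \<subseteq> bcells K p q" and "h \<in> bis_hom K X"
  shows "bis_restrict h L = const_map L pt \<longleftrightarrow> (\<forall>p q. \<forall>x\<in>bcells L p q. (p, q, h p q x) = star p q)"
proof -
  have c: "const_map L pt p q x = undefined" if "x \<notin> bcells L p q" for p q x
    using that by (simp add: const_map_def bis_comp_def compose_def)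
  have "bis_restrict h L = const_map L pt \<longleftrightarrow> (\<forall>p q. \<forall>x\<in>bcells L p q. h p q x = const_map L pt p q x)"
    unfolding bis_restrict_def fun_eq_iff using c by (auto simp: restrict_def)
  also have "\<dots> \<longleftrightarrow> (\<forall>p q. \<forall>x\<in>bcells L p q. (p, q, h p q x) = star p q)"
    using const_map_star[of _ L] by (metis Pair_inject)
  finally show ?thesis .
qed

end

text \<open>Only this consequence of fibrancy is used from here on; it does not mention the type of
  the cells of anodyne extensions.\<close>

locale fibrant_bisset = pointed_bisset X pt for X :: "'a bisset" and pt +
  assumes fillC: "horn_filling cells dim1 dim2 face face'"

sublocale fibrant_bisset \<subseteq> K: fibrant_cells cells dim1 dim2 face degen face' degen' star
proof -
  interpret simplicial_direction cells dim1 face degen by (rule simplicial_direction_1)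
  interpret snd: simplicial_direction cells dim2 face' degen' by (rule simplicial_direction_2)
  interpret commuting_directions cells dim1 dim2 face degen face' degen'
    by (rule commuting_directions_cells)
  interpret base_cells cells dim1 dim2 face degen star by (rule base_cells_1)
  interpret snd: base_cells cells dim2 dim1 face' degen' "\<lambda>a b. star b a" by (rule base_cells_2)
  show "fibrant_cells cells dim1 dim2 face degen face' degen' star"
    by unfold_locales (rule fillC)
qed

context fibrant_bisset
begin

lemma BC_maps_iff:
  assumes "1 \<le> m" "1 \<le> n"
  shows "f \<in> BC_maps X pt m n \<longleftrightarrow> f \<in> bis_hom (std_bisimplex m n) X \<and> K.sphere_at m n (tag m n f)"
proof (cases "f \<in> bis_hom (std_bisimplex m n) X")
  case hom: True
  have sub: "bcells (std_boundary m n) p q \<subseteq> bcells (std_bisimplex m n) p q" for p q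
    by (auto simp: bcells_std_boundary)
  obtain m' n' where mn': "m = Suc m'" "n = Suc n'" using assms by (metis Suc_le_D One_nat_def)
  have "(\<forall>p q. \<forall>x\<in>bcells (std_boundary m n) p q. (p, q, f p q x) = star p q) \<longleftrightarrow>
    K.sphere_at m n (tag m n f)"
  proof
    assume *: "\<forall>p q. \<forall>x\<in>bcells (std_boundary m n) p q. (p, q, f p q x) = star p q"
    have "face i (tag m n f) = star m' n" if i: "i \<le> m" for i
    proof -
      have mon: "monotone_map m' m (coface i)" using monotone_map_coface[of m i] mn' by simp
      have "(vals m' (coface i), vals n id) \<in> bcells (std_boundary m n) m' n"
        using mon i by (auto simp: bcells_std_boundary set_vals coface_def intro!: exI[of _ i])
      then have "(m', n, f m' n (vals m' (coface i), vals n id)) = star m' n" using * by blast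
      moreover have "face i (tag m n f) = (m', n, f m' n (vals m' (coface i), vals n id))"
        using hom_apply[OF hom, of "vals m' (coface i)" m' "vals n id" n] mon mn'
        by (simp add: face_def act_def tag_def dim1_def dim2_def)
      ultimately show ?thesis by simp
    qed
    moreover have "face' j (tag m n f) = star m n'" if j: "j \<le> n" for j
    proof -
      have mon: "monotone_map n' n (coface j)" using monotone_map_coface[of n j] mn' by simp
      have "(vals m id, vals n' (coface j)) \<in> bcells (std_boundary m n) m n'"
        using mon j by (auto simp: bcells_std_boundary set_vals coface_def intro!: exI[of _ j])
      then have "(m, n', f m n' (vals m id, vals n' (coface j))) = star m n'" using * by blast
      moreover have "face' j (tag m n f) = (m, n', f m n' (vals m id, vals n' (coface j)))"
        using hom_apply[OF hom, of "vals m id" m "vals n' (coface j)" n'] mon mn'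
        by (simp add: face'_def act_def tag_def dim1_def dim2_def)
      ultimately show ?thesis by simp
    qed
    ultimately show "K.sphere_at m n (tag m n f)"
      using tag_in[OF hom] mn' by (simp add: K.sphere_at_def)
  next
    assume S: "K.sphere_at m n (tag m n f)"
    show "\<forall>p q. \<forall>x\<in>bcells (std_boundary m n) p q. (p, q, f p q x) = star p q"
    proof (intro allI ballI)
      fix p q x assume "x \<in> bcells (std_boundary m n) p q"
      then obtain u v where x: "x = (u, v)" "u \<in> simplex_mor p m" "v \<in> simplex_mor q n"
        and miss: "(\<exists>i\<le>m. i \<notin> set u) \<or> (\<exists>j\<le>n. j \<notin> set v)" by (auto simp: bcells_std_boundary)
      have eq: "(p, q, f p q x) = act p q ((!) u) ((!) v) (tag m n f)"
        unfolding x(1) by (rule hom_apply_act[OF hom x(2,3)])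
      have len: "y \<le> p \<Longrightarrow> u ! y \<in> set u" "y \<le> q \<Longrightarrow> v ! y \<in> set v" for y
        using x by (auto simp: simplex_mor_def)
      note mon = monotone_map_nth[OF x(2)] monotone_map_nth[OF x(3)]
      from miss show "(p, q, f p q x) = star p q"
      proof (elim disjE exE conjE)
        fix i assume i: "i \<le> m" "i \<notin> set u"
        show ?thesis unfolding eq
          by (rule act_missing_star[where i = i]) (use S i assms mon len in \<open>auto simp: K.sphere_at_def\<close>)
      next
        fix j assume j: "j \<le> n" "j \<notin> set v"
        show ?thesis unfolding eq
          by (rule act_missing_star'[where j = j]) (use S j assms mon len in \<open>auto simp: K.sphere_at_def\<close>)
      qed
    qed
  qed
  then show ?thesis
    using rel_const_iff[OF sub hom] hom unfolding BC_maps_def maps_rel_def by simp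
qed (simp add: BC_maps_def maps_rel_def)

lemma BC_fillers_iff:
  assumes mn: "1 \<le> m" "1 \<le> n" and a: "a \<in> bis_hom (std_bisimplex m n) X" and b: "b \<in> bis_hom (std_bisimplex m n) X"
  shows "t \<in> BC_fillers X pt m n a b \<longleftrightarrow>
    t \<in> bis_hom (std_bisimplex (Suc m) (Suc n)) X \<and>
      K.filler_at m n (tag m n a) (tag m n b) (tag (Suc m) (Suc n) t)"
proof (cases "t \<in> bis_hom (std_bisimplex (Suc m) (Suc n)) X")
  case t: True
  note c1 = const_map_hom[OF bisimplicial_set_std[of m "Suc n"]]
  note c2 = const_map_hom[OF bisimplicial_set_std[of "Suc m" n]]
  note f1 = tag_faces[OF t] and f2 = tag_faces'[OF t]
  have e1: "face1 m (Suc n) i t = const_map (std_bisimplex m (Suc n)) pt \<longleftrightarrow>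
    face i (tag (Suc m) (Suc n) t) = star m (Suc n)" for i
    using hom_eq_iff[OF f1(1) c1] by (simp add: f1 tag_const_map)
  have e2: "face2 (Suc m) n i t = const_map (std_bisimplex (Suc m) n) pt \<longleftrightarrow>
    face' i (tag (Suc m) (Suc n) t) = star (Suc m) n" for i
    using hom_eq_iff[OF f2(1) c2] by (simp add: f2 tag_const_map)
  have e3: "face1 m (Suc n) i t = degen2 m n j c \<longleftrightarrow>
    face i (tag (Suc m) (Suc n) t) = degen' j (tag m n c)"
    if "c \<in> bis_hom (std_bisimplex m n) X" "j \<le> n" for i j c
    using hom_eq_iff[OF f1(1) tag_degens'(1)[OF that]] by (simp add: f1 tag_degens'[OF that])
  have e4: "face2 (Suc m) n i t = degen1 m n j c \<longleftrightarrow>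
    face' i (tag (Suc m) (Suc n) t) = degen j (tag m n c)"
    if "c \<in> bis_hom (std_bisimplex m n) X" "j \<le> m" for i j c
    using hom_eq_iff[OF f2(1) tag_degens(1)[OF that]] by (simp add: f2 tag_degens[OF that])
  show ?thesis
    using t tag_in[OF t] a b by (simp add: BC_fillers_def K.filler_at_def e1 e2 e3 e4)
qed (simp add: BC_fillers_def)

text \<open>The Bott-Chern product as a relation between two factors and a value.\<close>

definition product_map :: "nat \<Rightarrow> nat \<Rightarrow> (bisimplex, 'a) bmap \<Rightarrow> (bisimplex, 'a) bmap \<Rightarrow> (bisimplex, 'a) bmap \<Rightarrow> bool" where
  "product_map m n a b c \<longleftrightarrow> a \<in> BC_maps X pt m n \<and> b \<in> BC_maps X pt m n \<and>
     (\<exists>t\<in>BC_fillers X pt m n a b. c = face1 m n m (face2 (m + 1) n n t))"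

lemma product_map_iff:
  assumes mn: "1 \<le> m" "1 \<le> n"
  shows "product_map m n a b c \<longleftrightarrow> a \<in> bis_hom (std_bisimplex m n) X \<and>
    b \<in> bis_hom (std_bisimplex m n) X \<and>
    c \<in> bis_hom (std_bisimplex m n) X \<and> K.product_at m n (tag m n a) (tag m n b) (tag m n c)"
proof -
  have val: "face1 m n m (face2 (m + 1) n n t) \<in> bis_hom (std_bisimplex m n) X"
     "tag m n (face1 m n m (face2 (m + 1) n n t)) = face m (face' n (tag (Suc m) (Suc n) t))"
    if "t \<in> bis_hom (std_bisimplex (Suc m) (Suc n)) X" for t
    using tag_faces'[OF that, of n] tag_faces[of "face2 (m + 1) n n t" m n m] by simp_all
  show ?thesis (is "?l \<longleftrightarrow> ?r")
  proof
    assume l: ?l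
    then obtain t where t: "t \<in> BC_fillers X pt m n a b" "c = face1 m n m (face2 (m + 1) n n t)"
      and ab: "a \<in> BC_maps X pt m n" "b \<in> BC_maps X pt m n" unfolding product_map_def by blast
    note ab' = ab[unfolded BC_maps_iff[OF mn]]
    have t': "t \<in> bis_hom (std_bisimplex (Suc m) (Suc n)) X"
      "K.filler_at m n (tag m n a) (tag m n b) (tag (Suc m) (Suc n) t)"
      using t(1) BC_fillers_iff[OF mn, of a b t] ab' by auto
    show ?r using ab' val[OF t'(1)] t'(2) t(2) unfolding K.product_at_def
      by (intro conjI exI[of _ "tag (Suc m) (Suc n) t"]) auto
  next
    assume r: ?r
    then obtain x where x: "K.filler_at m n (tag m n a) (tag m n b) x"
      "tag m n c = face m (face' n x)"
      unfolding K.product_at_def by blast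
    obtain t where t: "t \<in> bis_hom (std_bisimplex (Suc m) (Suc n)) X" "tag (Suc m) (Suc n) t = x"
      using tag_surj[of x "Suc m" "Suc n"] x(1) unfolding K.filler_at_def by auto
    have "c = face1 m n m (face2 (m + 1) n n t)"
      using r val[OF t(1)] t x by (intro tag_inj) auto
    then show ?l
      using r x t BC_fillers_iff[OF mn, of a b t]
        unfolding product_map_def BC_maps_iff[OF mn] K.product_at_def
      by blast
  qed
qed

end

section \<open>Bott-Chern homotopies as products with the constant map\<close>

lemma bcells_prod [simp]: "bcells (K \<times>\<^sub>b L) p q = bcells K p q \<times> bcells L p q"
  by (simp add: bis_prod_def)

lemma bact_prod [simp]: "bact (K \<times>\<^sub>b L) p q u v (x, y) = (bact K p q u v x, bact L p q u v y)"
  by (simp add: bis_prod_def)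

lemma simplex_mor_0_iff: "w \<in> simplex_mor p 0 \<longleftrightarrow> w = vals p (\<lambda>_. 0)"
proof
  assume w: "w \<in> simplex_mor p 0"
  then have "w = vals p ((!) w)" by (simp add: vals_nth)
  also have "\<dots> = vals p (\<lambda>_. 0)"
    using monotone_map_nth[OF w] by (intro vals_cong) (auto simp: monotone_map_def)
  finally show "w = vals p (\<lambda>_. 0)" .
qed simp

text \<open>The composite of \<open>(u, w) : [p] \<rightarrow> [m] \<times> [1]\<close> with the order preserving map
  \<open>[m] \<times> [1] \<rightarrow> [m + 1]\<close> that is \<open>coface m\<close> on \<open>[m] \<times> {0}\<close> and \<open>coface (m - 1)\<close> on \<open>[m] \<times> {1}\<close>.\<close>

definition prism_map :: "nat \<Rightarrow> (nat \<Rightarrow> nat) \<Rightarrow> (nat \<Rightarrow> nat) \<Rightarrow> nat \<Rightarrow> nat" where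
  "prism_map m u w x = (if w x = 0 then coface m (u x) else coface (m - 1) (u x))"

lemma monotone_prism_map:
  assumes u: "monotone_map p m u" and w: "monotone_map p 1 w"
  shows "monotone_map p (Suc m) (prism_map m u w)"
  unfolding monotone_map_def
proof (intro conjI allI impI)
  fix i j assume ij: "i \<le> j" "j \<le> p"
  have "u i \<le> u j" "w i \<le> w j" using u w ij unfolding monotone_map_def by auto
  then show "prism_map m u w i \<le> prism_map m u w j" unfolding prism_map_def coface_def by auto
next
  fix i assume "i \<le> p"
  then have "u i \<le> m" using u unfolding monotone_map_def by auto
  then show "prism_map m u w i \<le> Suc m" unfolding prism_map_def coface_def by auto
qed

lemma prism_map_missing:
  assumes "1 \<le> m" "u x \<le> m" "u x \<noteq> i"
  shows "i + 1 \<le> m \<Longrightarrow> prism_map m u w x \<noteq> i" "i = m \<Longrightarrow> prism_map m u w x \<noteq> m + 1"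
  using assms unfolding prism_map_def coface_def by auto

lemma codegen_prism_map: "1 \<le> m \<Longrightarrow> u x \<le> m \<Longrightarrow> codegen (m - 1) (prism_map m u w x) = u x"
  unfolding prism_map_def coface_def codegen_def by auto

text \<open>The second coordinate of the \<open>i\<close>th of the \<open>m + 1\<close> simplices of top dimension of
  \<open>\<Delta>\<^sup>m \<times> \<Delta>\<^sup>1\<close>, which is \<open>(0,0), \<dots>, (i,0), (i,1), \<dots>, (m,1)\<close>; its first coordinate is
  \<open>codegen i\<close>.\<close>

definition jump :: "nat \<Rightarrow> nat \<Rightarrow> nat" where
  "jump i x = (if x \<le> i then 0 else 1)"

context fibrant_bisset
begin

lemma sphere_act_star:
  assumes mn: "1 \<le> m" "1 \<le> n" and a: "K.sphere_at m n a"
    and u: "monotone_map p m u" and v: "monotone_map q n v"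
    and miss: "(\<exists>i\<le>m. \<forall>x\<le>p. u x \<noteq> i) \<or> (\<exists>j\<le>n. \<forall>x\<le>q. v x \<noteq> j)"
  shows "act p q u v a = star p q"
  using miss
proof (elim disjE exE conjE)
  fix i assume i: "i \<le> m" "\<forall>x\<le>p. u x \<noteq> i"
  show ?thesis
    by (rule act_missing_star[where i = i]) (use a i mn u v in \<open>auto simp: K.sphere_at_def\<close>)
next
  fix j assume j: "j \<le> n" "\<forall>x\<le>q. v x \<noteq> j"
  show ?thesis
    by (rule act_missing_star'[where j = j]) (use a j mn u v in \<open>auto simp: K.sphere_at_def\<close>)
qed

text \<open>The homotopy defined by a filler for \<open>a\<close> and \<open>*\<close> is constant on the boundary. If \<open>u\<close> omits
  \<open>i\<close>, then the composite with \<open>prism_map\<close> omits a vertex whose opposite face is \<open>*\<close>, except for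
  \<open>i = m - 1\<close>, where this face is a degeneracy of \<open>a\<close> and the claim follows from the boundary of
  \<open>a\<close>.\<close>

lemma filler_prism_star:
  assumes mn: "1 \<le> m" "1 \<le> n" and a: "K.sphere_at m n a" and x: "K.filler_at m n a (star m n) x"
    and u: "monotone_map p m u" "monotone_map p 1 w" and v: "monotone_map q n v"
      "monotone_map q 1 w'"
    and miss: "(\<exists>i\<le>m. \<forall>y\<le>p. u y \<noteq> i) \<or> (\<exists>j\<le>n. \<forall>y\<le>q. v y \<noteq> j)"
  shows "act p q (prism_map m u w) (prism_map n v w') x = star p q"
proof -
  let ?f = "prism_map m u w" and ?g = "prism_map n v w'"
  note f = monotone_prism_map[OF u] and g = monotone_prism_map[OF v]
  have xd: "x \<in> cells" "dim1 x = Suc m" "dim2 x = Suc n" using x by (auto simp: K.filler_at_def)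
  have ub: "u y \<le> m" if "y \<le> p" for y using u that unfolding monotone_map_def by auto
  have vb: "v y \<le> n" if "y \<le> q" for y using v that unfolding monotone_map_def by auto
  have cf: "codegen (m - 1) (?f y) = u y" if "y \<le> p" for y
    using codegen_prism_map[of m u y w] mn ub[OF that] by simp
  have cg: "codegen (n - 1) (?g y) = v y" if "y \<le> q" for y
    using codegen_prism_map[of n v y w'] mn vb[OF that] by simp
  have ad: "a \<in> cells" "dim1 a = m" "dim2 a = n" using a by (auto simp: K.sphere_at_def)
  from miss show ?thesis
  proof (elim disjE exE conjE)
    fix i assume i: "i \<le> m" "\<forall>y\<le>p. u y \<noteq> i"
    consider "i + 1 < m" | "i = m - 1" | "i = m" using i by linarith
    then show ?thesis
    proof cases
      case 1
      show ?thesis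
        by (rule act_missing_star[where i = i])
          (use 1 x xd f g i ub mn prism_map_missing(1)[of m u _ i w] in \<open>auto simp: K.filler_at_def\<close>)
    next
      case 2
      have ne: "?f y \<noteq> m - 1" if "y \<le> p" for y
        using prism_map_missing(1)[of m u y i w] 2 i ub[OF that] mn that by auto
      have "act p q ?f ?g x = act p q (codegen (m - 1) \<circ> ?f) ?g (face (m - 1) x)"
        using xd f g ne by (intro act_missing) auto
      also have "\<dots> = act p q u ?g (face (m - 1) x)"
        using cf by (intro act_cong) auto
      also have "face (m - 1) x = degen' (n - 1) a" using x by (simp add: K.filler_at_def)
      also have "act p q u ?g (degen' (n - 1) a) = act p q (id \<circ> u) (codegen (n - 1) \<circ> ?g) a"
        unfolding degen'_def using ad u g monotone_map_codegen[of "n - 1" n] mn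
          by (subst act_act) auto
      also have "\<dots> = act p q u v a" using cg by (intro act_cong) auto
      also have "\<dots> = star p q" using mn a u v i by (intro sphere_act_star) auto
      finally show ?thesis .
    next
      case 3
      have "face (Suc m) x = star m (Suc n)" using x by (simp add: K.filler_at_def K.snd.s_st)
      then show ?thesis
        by (intro act_missing_star[where i = "Suc m"])
          (use 3 xd f g i ub mn prism_map_missing(2)[of m u _ i w] in auto)
    qed
  next
    fix i assume i: "i \<le> n" "\<forall>y\<le>q. v y \<noteq> i"
    consider "i + 1 < n" | "i = n - 1" | "i = n" using i by linarith
    then show ?thesis
    proof cases
      case 1
      show ?thesis
        by (rule act_missing_star'[where j = i])
          (use 1 x xd f g i vb mn prism_map_missing(1)[of n v _ i w'] in \<open>auto simp: K.filler_at_def\<close>)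
    next
      case 2
      have ne: "?g y \<noteq> n - 1" if "y \<le> q" for y
        using prism_map_missing(1)[of n v y i w'] 2 i vb[OF that] mn that by auto
      have "act p q ?f ?g x = act p q ?f (codegen (n - 1) \<circ> ?g) (face' (n - 1) x)"
        using xd f g ne by (intro act_missing') auto
      also have "\<dots> = act p q ?f v (face' (n - 1) x)"
        using cg by (intro act_cong) auto
      also have "face' (n - 1) x = degen (m - 1) a" using x by (simp add: K.filler_at_def)
      also have "act p q ?f v (degen (m - 1) a) = act p q (codegen (m - 1) \<circ> ?f) (id \<circ> v) a"
        unfolding degen_def using ad v f monotone_map_codegen[of "m - 1" m] mn
          by (subst act_act) auto
      also have "\<dots> = act p q u v a" using cf by (intro act_cong) auto
      also have "\<dots> = star p q" using mn a u v i by (intro sphere_act_star) auto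
      finally show ?thesis .
    next
      case 3
      have "face' (Suc n) x = star (Suc m) n" using x by (simp add: K.filler_at_def K.fst.s_st)
      then show ?thesis
        by (intro act_missing_star'[where j = "Suc n"])
          (use 3 xd f g i vb mn prism_map_missing(2)[of n v _ i w'] in auto)
    qed
  qed
qed

text \<open>A homotopy starts, at the vertex \<open>1\<close> of each interval, with \<open>a\<close>, and ends at the vertex
  \<open>0\<close> of both intervals. There, the cofaces \<open>m\<close> and \<open>n\<close> select the corner of the filler that is
  the product.\<close>

lemma BC_homotopy_if_product:
  assumes mn: "1 \<le> m" "1 \<le> n" and prod: "product_map m n a (const_map (std_bisimplex m n) pt) c"
  shows "(a, c) \<in> BC_homotopy X pt m n"
proof -
  let ?S = "std_bisimplex m n" and ?I = "std_bisimplex 1 1"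
  note pr = prod[unfolded product_map_iff[OF mn] tag_const_map]
  then obtain x where x: "K.filler_at m n (tag m n a) (star m n) x" "tag m n c = face m (face' n x)"
    and a: "K.sphere_at m n (tag m n a)" unfolding K.product_at_def by blast
  have xd: "x \<in> cells" "dim1 x = Suc m" "dim2 x = Suc n" using x by (auto simp: K.filler_at_def)
  have hom: "a \<in> bis_hom ?S X" "c \<in> bis_hom ?S X" using pr by auto
  have "a \<in> BC_maps X pt m n" "c \<in> BC_maps X pt m n"
    using pr K.product_at_sphere[OF mn, of "tag m n a" "star m n" "tag m n c"] a
      by (auto simp: BC_maps_iff[OF mn])
  \<comment> \<open>\<open>V\<close> is the value of the homotopy \<open>h\<close>, as a cell with dimensions.\<close>
  define V where "V p q u v w w' = act p q (prism_map m ((!) u) ((!) w)) (prism_map n ((!) v) ((!) w')) x"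
    for p q and u v w w' :: "nat list"
  define h where "h p q = (\<lambda>((u, v), (w, w'))\<in>bcells (?S \<times>\<^sub>b ?I) p q. snd (snd (V p q u v w w')))"
    for p q
  have mon: "monotone_map p (Suc m) (prism_map m ((!) u) ((!) w))"
    if "u \<in> simplex_mor p m" "w \<in> simplex_mor p 1" for p u w
    using that by (intro monotone_prism_map monotone_map_nth)
  have mon': "monotone_map p (Suc n) (prism_map n ((!) u) ((!) w))"
    if "u \<in> simplex_mor p n" "w \<in> simplex_mor p 1" for p u w
    using that by (intro monotone_prism_map monotone_map_nth)
  have h: "(p, q, h p q ((u, v), (w, w'))) = V p q u v w w'"
    if "u \<in> simplex_mor p m" "v \<in> simplex_mor q n" "w \<in> simplex_mor p 1" "w' \<in> simplex_mor q 1"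
      for p q u v w w'
    using that by (simp add: h_def V_def act_def split: prod.splits)
  have V_in: "V p q u v w w' \<in> cells"
    if "u \<in> simplex_mor p m" "v \<in> simplex_mor q n" "w \<in> simplex_mor p 1" "w' \<in> simplex_mor q 1"
      for p q u v w w'
    unfolding V_def using xd mon[OF that(1,3)] mon'[OF that(2,4)] by (intro act_in) auto
  have hh: "h \<in> bis_hom (?S \<times>\<^sub>b ?I) X"
    unfolding bis_hom_def
  proof (intro CollectI conjI allI ballI)
    fix p q
    show "h p q \<in> bcells (?S \<times>\<^sub>b ?I) p q \<rightarrow>\<^sub>E bcells X p q"
    proof (rule PiE_I)
      fix y assume "y \<in> bcells (?S \<times>\<^sub>b ?I) p q"
      then obtain u v w w' where y: "y = ((u, v), (w, w'))" "u \<in> simplex_mor p m"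
        "v \<in> simplex_mor q n"
        "w \<in> simplex_mor p 1" "w' \<in> simplex_mor q 1" by auto
      show "h p q y \<in> bcells X p q"
        using h[OF y(2-5)] V_in[OF y(2-5)] unfolding y(1)
          by (metis (no_types, lifting) cells_def case_prod_conv mem_Collect_eq)
    qed (simp add: h_def)
  next
    fix p q p' q' b b' y
    assume b: "b \<in> simplex_mor p' p" and b': "b' \<in> simplex_mor q' q"
      and "y \<in> bcells (?S \<times>\<^sub>b ?I) p q"
    then obtain u v w w' where y: "y = ((u, v), (w, w'))" "u \<in> simplex_mor p m"
      "v \<in> simplex_mor q n"
      "w \<in> simplex_mor p 1" "w' \<in> simplex_mor q 1" by auto
    note in1 = simplex_comp_in[OF y(2) b] simplex_comp_in[OF y(3) b'] simplex_comp_in[OF y(4) b] simplex_comp_in[OF y(5) b']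
    have lb: "i \<le> p' \<Longrightarrow> i < length b" "i \<le> q' \<Longrightarrow> i < length b'" for i
      using b b' by (auto simp: simplex_mor_def)
    have "(p', q', bact X p q b b' (h p q y)) = act p' q' ((!) b) ((!) b') (p, q, h p q y)"
      using b b' by (simp add: act_def vals_nth)
    also have "\<dots> = act p' q' ((!) b) ((!) b') (V p q u v w w')" using h[OF y(2-5)] y(1) by simp
    also have "\<dots> = act p' q' (prism_map m ((!) u) ((!) w) \<circ> (!) b) (prism_map n ((!) v) ((!) w') \<circ> (!) b') x"
      unfolding V_def using xd mon[OF y(2,4)] mon'[OF y(3,5)] monotone_map_nth[OF b] monotone_map_nth[OF b']
      by (intro act_act) auto
    also have "\<dots> = V p' q' (simplex_comp u b) (simplex_comp v b') (simplex_comp w b) (simplex_comp w' b')"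
      unfolding V_def using lb by (intro act_cong) (auto simp: prism_map_def simplex_comp_def)
    also have "\<dots> = (p', q', h p' q' (bact (?S \<times>\<^sub>b ?I) p q b b' y))"
      using h[OF in1] unfolding y(1) by simp
    finally show "h p' q' (bact (?S \<times>\<^sub>b ?I) p q b b' y) = bact X p q b b' (h p q y)" by simp
  qed
  have vc: "map (coface i) (vals p (\<lambda>_. 0)) = vals p (\<lambda>_. coface i 0)" for i p
    by (simp add: map_vals comp_def)
  have one: "vals p (\<lambda>_. coface i 0) \<in> simplex_mor p 1" for i p
    by (auto simp: monotone_map_def coface_def)
  have one': "vals p (\<lambda>_. 0) \<in> simplex_mor p 1" for p by simp
  have ad: "tag m n a \<in> cells" using hom by (rule_tac tag_in)
  have c0: "codegen (m - 1) (prism_map m u w y) = u y" if "u y \<le> m" for u w y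
    using codegen_prism_map that mn by blast
  have c0': "codegen (n - 1) (prism_map n u w y) = u y" if "u y \<le> n" for u w y
    using codegen_prism_map that mn by blast
  have ub: "u ! y \<le> m'" if "u \<in> simplex_mor p m'" "y \<le> p" for u p y m'
    using monotone_map_nth[OF that(1)] that(2) unfolding monotone_map_def by auto
  \<comment> \<open>\<open>V1\<close>, \<open>V2\<close> and \<open>V0\<close> are the three conditions on the ends of a homotopy.\<close>
  have V1: "V p q u v w w' = (p, q, a p q (u, v))"
    if u: "u \<in> simplex_mor p m" and v: "v \<in> simplex_mor q n" and w: "\<And>i. i \<le> p \<Longrightarrow>
      w ! i = 1" and w': "w' \<in> simplex_mor q 1"
    for p q u v w w'
  proof -
    let ?g = "prism_map n ((!) v) ((!) w')"
    note mg = mon'[OF v w'] and mu = monotone_map_nth[OF u] and mv = monotone_map_nth[OF v]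
    have "V p q u v w w' = act p q (coface (m - 1) \<circ> (!) u) (id \<circ> ?g) x"
      unfolding V_def using w by (intro act_cong) (auto simp: prism_map_def)
    also have "\<dots> = act p q ((!) u) ?g (face (m - 1) x)"
      unfolding face_def using xd mu mg monotone_map_coface[of "Suc m" "m - 1"]
        by (subst act_act) auto
    also have "face (m - 1) x = degen' (n - 1) (tag m n a)" using x by (simp add: K.filler_at_def)
    also have "act p q ((!) u) ?g (degen' (n - 1) (tag m n a)) = act p q (id \<circ> (!) u) (codegen (n - 1) \<circ> ?g) (tag m n a)"
      unfolding degen'_def using ad mu mg monotone_map_codegen[of "n - 1" n] mn
        by (subst act_act) auto
    also have "\<dots> = act p q ((!) u) ((!) v) (tag m n a)"
      using c0' ub[OF v] by (intro act_cong) auto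
    finally show ?thesis using hom_apply_act[OF hom(1) u v] by simp
  qed
  have V2: "V p q u v w w' = (p, q, a p q (u, v))"
    if u: "u \<in> simplex_mor p m" and v: "v \<in> simplex_mor q n" and w': "\<And>i. i \<le> q \<Longrightarrow>
      w' ! i = 1" and w: "w \<in> simplex_mor p 1"
    for p q u v w w'
  proof -
    let ?f = "prism_map m ((!) u) ((!) w)"
    note mf = mon[OF u w] and mu = monotone_map_nth[OF u] and mv = monotone_map_nth[OF v]
    have "V p q u v w w' = act p q (id \<circ> ?f) (coface (n - 1) \<circ> (!) v) x"
      unfolding V_def using w' by (intro act_cong) (auto simp: prism_map_def)
    also have "\<dots> = act p q ?f ((!) v) (face' (n - 1) x)"
      unfolding face'_def using xd mv mf monotone_map_coface[of "Suc n" "n - 1"]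
        by (subst act_act) auto
    also have "face' (n - 1) x = degen (m - 1) (tag m n a)" using x by (simp add: K.filler_at_def)
    also have "act p q ?f ((!) v) (degen (m - 1) (tag m n a)) = act p q (codegen (m - 1) \<circ> ?f) (id \<circ> (!) v) (tag m n a)"
      unfolding degen_def using ad mv mf monotone_map_codegen[of "m - 1" m] mn
        by (subst act_act) auto
    also have "\<dots> = act p q ((!) u) ((!) v) (tag m n a)"
      using c0 ub[OF u] by (intro act_cong) auto
    finally show ?thesis using hom_apply_act[OF hom(1) u v] by simp
  qed
  have V0: "V p q u v (vals p (\<lambda>_. 0)) (vals q (\<lambda>_. 0)) = (p, q, c p q (u, v))"
    if u: "u \<in> simplex_mor p m" and v: "v \<in> simplex_mor q n" for p q u v
  proof -
    have "V p q u v (vals p (\<lambda>_. 0)) (vals q (\<lambda>_. 0)) = act p q (coface m \<circ> (!) u) (coface n \<circ> (!) v) x"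
      unfolding V_def by (intro act_cong) (auto simp: prism_map_def)
    also have "\<dots> = act p q ((!) u) ((!) v) (act m n (coface m) (coface n) x)"
      using xd monotone_map_nth[OF u] monotone_map_nth[OF v] monotone_map_coface[of "Suc m" m] monotone_map_coface[of "Suc n" n]
      by (subst act_act) auto
    also have "act m n (coface m) (coface n) x = face m (face' n x)"
      unfolding face_def face'_def
        using xd monotone_map_coface[of "Suc m" m] monotone_map_coface[of "Suc n" n]
      by (subst act_act) auto
    finally show ?thesis using hom_apply_act[OF hom(2) u v] x(2) by simp
  qed
  have "is_homotopy ?S X h a c"
    unfolding is_homotopy_def
  proof (intro conjI hh)
    show "hat_face1 ?S 0 1 0 h = via_proj ?S 0 1 a"
    proof (intro ext)
      fix p q y
      show "hat_face1 ?S 0 1 0 h p q y = via_proj ?S 0 1 a p q y"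
      proof (cases "y \<in> bcells (?S \<times>\<^sub>b std_bisimplex 0 1) p q")
        case True
        then obtain u v w' where y: "y = ((u, v), (vals p (\<lambda>_. 0), w'))" "u \<in> simplex_mor p m"
          "v \<in> simplex_mor q n"
          "w' \<in> simplex_mor q 1" by (auto simp: simplex_mor_0_iff)
        have "(p, q, h p q ((u, v), (vals p (\<lambda>_. coface 0 0), w'))) = (p, q, a p q (u, v))"
          using h[OF y(2,3) one y(4), of 0] V1[OF y(2,3) _ y(4), of "vals p (\<lambda>_. coface 0 0)"]
          by (simp add: coface_def)
        then show ?thesis
          using True unfolding y(1) hat_face1_def via_proj_def bis_comp_def
          by (simp add: compose_def simplex_map_def vc)
      qed (simp add: hat_face1_def via_proj_def bis_comp_def compose_def)
    qed
    show "hat_face2 ?S 1 0 0 h = via_proj ?S 1 0 a"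
    proof (intro ext)
      fix p q y
      show "hat_face2 ?S 1 0 0 h p q y = via_proj ?S 1 0 a p q y"
      proof (cases "y \<in> bcells (?S \<times>\<^sub>b std_bisimplex 1 0) p q")
        case True
        then obtain u v w where y: "y = ((u, v), (w, vals q (\<lambda>_. 0)))" "u \<in> simplex_mor p m"
          "v \<in> simplex_mor q n"
          "w \<in> simplex_mor p 1" by (auto simp: simplex_mor_0_iff)
        have "(p, q, h p q ((u, v), (w, vals q (\<lambda>_. coface 0 0)))) = (p, q, a p q (u, v))"
          using h[OF y(2,3,4) one, of 0] V2[OF y(2,3) _ y(4), of "vals q (\<lambda>_. coface 0 0)"]
          by (simp add: coface_def)
        then show ?thesis
          using True unfolding y(1) hat_face2_def via_proj_def bis_comp_def
          by (simp add: compose_def simplex_map_def vc)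
      qed (simp add: hat_face2_def via_proj_def bis_comp_def compose_def)
    qed
    show "hat_face1 ?S 0 0 1 (hat_face2 ?S 1 0 1 h) = via_proj ?S 0 0 c"
    proof (intro ext)
      fix p q y
      show "hat_face1 ?S 0 0 1 (hat_face2 ?S 1 0 1 h) p q y = via_proj ?S 0 0 c p q y"
      proof (cases "y \<in> bcells (?S \<times>\<^sub>b std_bisimplex 0 0) p q")
        case True
        then obtain u v where y: "y = ((u, v), (vals p (\<lambda>_. 0), vals q (\<lambda>_. 0)))"
          "u \<in> simplex_mor p m" "v \<in> simplex_mor q n"
          by (auto simp: simplex_mor_0_iff)
        have "(p, q, h p q ((u, v), (vals p (\<lambda>_. 0), vals q (\<lambda>_. 0)))) = (p, q, c p q (u, v))"
          using h[OF y(2,3) one' one'] V0[OF y(2,3)] by simp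
        then show ?thesis
          using True unfolding y(1) hat_face1_def hat_face2_def via_proj_def bis_comp_def
          by (simp add: compose_def simplex_map_def vc coface_def)
      qed (simp add: hat_face1_def via_proj_def bis_comp_def compose_def)
    qed
  qed
  moreover have "bis_restrict h (std_boundary m n \<times>\<^sub>b ?I) = const_map (std_boundary m n \<times>\<^sub>b ?I) pt"
  proof -
    have sub: "bcells (std_boundary m n \<times>\<^sub>b ?I) p q \<subseteq> bcells (?S \<times>\<^sub>b ?I) p q" for p q
      by (auto simp: bcells_std_boundary)
    have "(p, q, h p q y) = star p q" if "y \<in> bcells (std_boundary m n \<times>\<^sub>b ?I) p q" for p q y
    proof -
      from that obtain u v w w' where y: "y = ((u, v), (w, w'))" "u \<in> simplex_mor p m"
        "v \<in> simplex_mor q n"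
        "w \<in> simplex_mor p 1" "w' \<in> simplex_mor q 1"
        and miss: "(\<exists>i\<le>m. i \<notin> set u) \<or> (\<exists>j\<le>n. j \<notin> set v)"
        by (auto simp: bcells_std_boundary) blast+
      have len: "i \<le> p \<Longrightarrow> u ! i \<in> set u" "i \<le> q \<Longrightarrow> v ! i \<in> set v" for i
        using y by (auto simp: simplex_mor_def)
      have "V p q u v w w' = star p q"
        unfolding V_def
        by (rule filler_prism_star[OF mn a x(1)]) (use y miss len monotone_map_nth in \<open>blast+\<close>)
      then show ?thesis using h[OF y(2-5)] y(1) by simp
    qed
    then show ?thesis using rel_const_iff[OF sub hh] by blast
  qed
  ultimately show ?thesis
    using \<open>a \<in> BC_maps X pt m n\<close> \<open>c \<in> BC_maps X pt m n\<close>
    unfolding BC_homotopy_def homotopy_rel_def BC_maps_def by blast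
qed

text \<open>The cells of the grid are the values of the homotopy on pairs of simplices of top
  dimension in \<open>\<Delta>\<^sup>m \<times> \<Delta>\<^sup>1\<close> and \<open>\<Delta>\<^sup>n \<times> \<Delta>\<^sup>1\<close>.\<close>

lemma product_if_BC_homotopy:
  assumes mn: "1 \<le> m" "1 \<le> n" and ac: "(a, c) \<in> BC_homotopy X pt m n"
  shows "product_map m n a (const_map (std_bisimplex m n) pt) c"
proof -
  let ?S = "std_bisimplex m n" and ?I = "std_bisimplex 1 1"
  obtain h where h: "is_homotopy ?S X h a c"
      "bis_restrict h (std_boundary m n \<times>\<^sub>b ?I) = const_map (std_boundary m n \<times>\<^sub>b ?I) pt"
    and "a \<in> BC_maps X pt m n" "c \<in> BC_maps X pt m n"
    using ac unfolding BC_homotopy_def homotopy_rel_def BC_maps_def by blast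
  then have hom: "a \<in> bis_hom ?S X" "c \<in> bis_hom ?S X" and sph: "K.sphere_at m n (tag m n a)"
    by (auto simp: BC_maps_iff[OF mn])
  note h' = h(1)[unfolded is_homotopy_def]
  then have hh: "h \<in> bis_hom (?S \<times>\<^sub>b ?I) X" by blast
  \<comment> \<open>\<open>H\<close> is the value of the homotopy on a cell given by functions.\<close>
  define H where "H p q f g w w' = (p, q, h p q ((vals p f, vals q g), (vals p w, vals q w')))"
    for p q f g w w'
  have H_cong: "H p q f g w w' = H p q f1 g1 w1 w1'"
    if "\<And>x. x \<le> p \<Longrightarrow> f x = f1 x" "\<And>x. x \<le> q \<Longrightarrow> g x = g1 x"
      "\<And>x. x \<le> p \<Longrightarrow> w x = w1 x" "\<And>x. x \<le> q \<Longrightarrow> w' x = w1' x" for p q f g w w' f1 g1 w1 w1'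
    unfolding H_def using vals_cong[of p f f1] vals_cong[of q g g1] vals_cong[of p w w1] vals_cong[of q w' w1'] that
    by simp
  have H_in: "H p q f g w w' \<in> cells"
    if "monotone_map p m f" "monotone_map q n g" "monotone_map p 1 w" "monotone_map q 1 w'"
      for p q f g w w'
  proof -
    have "h p q \<in> bcells (?S \<times>\<^sub>b ?I) p q \<rightarrow>\<^sub>E bcells X p q"
      using hh unfolding bis_hom_def by blast
    then show ?thesis using that unfolding H_def cells_def by (auto simp: PiE_def Pi_def)
  qed
  have act_H: "act p' q' f' g' (H p q f g w w') = H p' q' (f \<circ> f') (g \<circ> g') (w \<circ> f') (w' \<circ> g')"
    if m1: "monotone_map p m f" "monotone_map q n g" "monotone_map p 1 w" "monotone_map q 1 w'"
      and m2: "monotone_map p' p f'" "monotone_map q' q g'" for p q f g w w' p' q' f' g'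
  proof -
    have y: "((vals p f, vals q g), (vals p w, vals q w')) \<in> bcells (?S \<times>\<^sub>b ?I) p q" using m1
      by simp
    have "\<forall>m n p q. \<forall>u\<in>simplex_mor p m. \<forall>v\<in>simplex_mor q n. \<forall>x\<in>bcells (?S \<times>\<^sub>b ?I) m n.
        h p q (bact (?S \<times>\<^sub>b ?I) m n u v x) = bact X m n u v (h m n x)"
      using hh unfolding bis_hom_def by blast
    then have "h p' q' (bact (?S \<times>\<^sub>b ?I) p q (vals p' f') (vals q' g') ((vals p f, vals q g), (vals p w, vals q w'))) =
      bact X p q (vals p' f') (vals q' g') (h p q ((vals p f, vals q g), (vals p w, vals q w')))"
      using y m2 by (meson vals_in_simplex_mor)
    then show ?thesis using m1 m2 by (simp add: H_def act_def simplex_comp_vals)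
  qed
  have H_star: "H p q f g w w' = star p q"
    if m1: "monotone_map p m f" "monotone_map q n g" "monotone_map p 1 w" "monotone_map q 1 w'"
      and miss: "(\<exists>i\<le>m. \<forall>x\<le>p. f x \<noteq> i) \<or> (\<exists>j\<le>n. \<forall>x\<le>q. g x \<noteq> j)" for p q f g w w'
  proof -
    have sub: "bcells (std_boundary m n \<times>\<^sub>b ?I) p q \<subseteq> bcells (?S \<times>\<^sub>b ?I) p q" for p q
      by (auto simp: bcells_std_boundary)
    have "((vals p f, vals q g), (vals p w, vals q w')) \<in> bcells (std_boundary m n \<times>\<^sub>b ?I) p q"
      using m1 miss by (auto simp: bcells_std_boundary set_vals)
    then show ?thesis using h(2) rel_const_iff[OF sub hh] unfolding H_def by blast
  qed
  have H1: "H p q f g w w' = act p q f g (tag m n a)"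
    if m1: "monotone_map p m f" "monotone_map q n g" "\<And>x. x \<le> p \<Longrightarrow> w x = 1" "monotone_map q 1 w'"
      for p q f g w w'
  proof -
    let ?y = "((vals p f, vals q g), (vals p (\<lambda>_. 0), vals q w'))"
    have y: "?y \<in> bcells (?S \<times>\<^sub>b std_bisimplex 0 1) p q" using m1 by simp
    have "hat_face1 ?S 0 1 0 h p q ?y = via_proj ?S 0 1 a p q ?y" using h' by simp
    then have "h p q ((vals p f, vals q g), (vals p (\<lambda>_. 1), vals q w')) = a p q (vals p f, vals q g)"
      using y m1 by (simp add: hat_face1_def via_proj_def bis_comp_def compose_def simplex_map_def map_vals comp_def coface_def)
    moreover have "vals p w = vals p (\<lambda>_. 1)" using m1 by (intro vals_cong)
    ultimately show ?thesis
      using hom_apply[OF hom(1), of "vals p f" p "vals q g" q] m1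
        by (simp add: H_def act_def tag_def)
  qed
  have H2: "H p q f g w w' = act p q f g (tag m n a)"
    if m1: "monotone_map p m f" "monotone_map q n g" "\<And>x. x \<le> q \<Longrightarrow> w' x = 1" "monotone_map p 1 w"
      for p q f g w w'
  proof -
    let ?y = "((vals p f, vals q g), (vals p w, vals q (\<lambda>_. 0)))"
    have y: "?y \<in> bcells (?S \<times>\<^sub>b std_bisimplex 1 0) p q" using m1 by simp
    have "hat_face2 ?S 1 0 0 h p q ?y = via_proj ?S 1 0 a p q ?y" using h' by simp
    then have "h p q ((vals p f, vals q g), (vals p w, vals q (\<lambda>_. 1))) = a p q (vals p f, vals q g)"
      using y m1 by (simp add: hat_face2_def via_proj_def bis_comp_def compose_def simplex_map_def map_vals comp_def coface_def)
    moreover have "vals q w' = vals q (\<lambda>_. 1)" using m1 by (intro vals_cong)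
    ultimately show ?thesis
      using hom_apply[OF hom(1), of "vals p f" p "vals q g" q] m1
        by (simp add: H_def act_def tag_def)
  qed
  have H0: "H m n id id (\<lambda>_. 0) (\<lambda>_. 0) = tag m n c"
  proof -
    let ?y = "((vals m id, vals n id), (vals m (\<lambda>_. 0), vals n (\<lambda>_. 0)))"
    have y: "?y \<in> bcells (?S \<times>\<^sub>b std_bisimplex 0 0) m n" by simp
    have "hat_face1 ?S 0 0 1 (hat_face2 ?S 1 0 1 h) m n ?y = via_proj ?S 0 0 c m n ?y" using h'
      by simp
    then show ?thesis
      using y by (simp add: hat_face1_def hat_face2_def via_proj_def bis_comp_def compose_def simplex_map_def
          map_vals comp_def coface_def H_def tag_def simplex_id_vals)
  qed
  have jump: "monotone_map p 1 (jump i)" for p i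
    unfolding monotone_map_def jump_def by auto
  have cg: "monotone_map (Suc m') m' (codegen i)" if "i \<le> m'" for i m'
    using monotone_map_codegen[OF that] .
  have cf: "monotone_map m' (Suc m') (coface i)" for i m' using monotone_map_coface[of "Suc m'" i]
    by simp
  have miss: "\<exists>i'\<le>m'. \<forall>x\<le>m'. (codegen i \<circ> coface l) x \<noteq> i'"
    if "l \<le> Suc m'" "i \<le> m'" "l \<noteq> i" "l \<noteq> Suc i" for i l m'
  proof (cases "l < i")
    case True then show ?thesis using that
      by (intro exI[of _ l]) (auto simp: codegen_def coface_def)
  next
    case False then show ?thesis using that
      by (intro exI[of _ "l - 1"]) (auto simp: codegen_def coface_def)
  qed
  define x where "x i j = H (Suc m) (Suc n) (codegen i) (codegen j) (jump i) (jump j)" for i j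
  have xd [simp]: "dim1 (x i j) = Suc m" "dim2 (x i j) = Suc n" for i j
    by (simp_all add: x_def H_def dim1_def dim2_def)
  have x_in: "x i j \<in> cells" if "i \<le> m" "j \<le> n" for i j
    unfolding x_def using cg that jump by (intro H_in)
  have fx: "face l (x i j) = H m (Suc n) (codegen i \<circ> coface l) (codegen j) (jump i \<circ> coface l) (jump j)"
    if "i \<le> m" "j \<le> n" for i j l
    unfolding face_def xd unfolding x_def
    using act_H[OF cg[OF that(1)] cg[OF that(2)] jump jump cf, of "Suc n" id l i j] by simp
  have fx': "face' l (x i j) = H (Suc m) n (codegen i) (codegen j \<circ> coface l) (jump i) (jump j \<circ> coface l)"
    if "i \<le> m" "j \<le> n" for i j l
    unfolding face'_def xd unfolding x_def
    using act_H[OF cg[OF that(1)] cg[OF that(2)] jump jump _ cf, of "Suc m" id l i j] by simp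
  have cc: "monotone_map m' m' (codegen i \<circ> coface l)" if "i \<le> m'" for i l m'
    using monotone_map_comp[OF cg[OF that] cf] .
  have sc: "monotone_map m' 1 (jump i \<circ> coface l)" for i l m'
    using monotone_map_comp[OF jump cf] .
  have "K.product_at m n (tag m n a) (star m n) (face (Suc m) (face' (Suc n) (x m n)))"
  proof (rule K.collapse_grid[OF mn sph])
    fix i j assume ij: "i \<le> m" "j \<le> n"
    have "face l (x i j) = star m (Suc n)" if l: "l \<le> Suc m" "l \<noteq> i" "l \<noteq> Suc i" for l
      unfolding fx[OF ij] using miss[OF l(1) ij(1) l(2,3)] ij
      by (intro H_star cc cg sc jump) auto
    moreover have "face' l (x i j) = star (Suc m) n" if l: "l \<le> Suc n" "l \<noteq> j" "l \<noteq> Suc j" for l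
      unfolding fx'[OF ij] using miss[OF l(1) ij(2) l(2,3)] ij
      by (intro H_star cc cg sc jump) auto
    ultimately show "K.prism_cell m (Suc n) i j (x i j)"
      unfolding K.prism_cell_def using x_in[OF ij] by simp
  next
    fix i j assume ij: "i < m" "j \<le> n"
    show "face (Suc i) (x i j) = face (Suc i) (x (Suc i) j)"
      using ij by (subst (1 2) fx) (auto intro!: H_cong simp: codegen_def coface_def jump_def)
  next
    fix i j assume ij: "i \<le> m" "j < n"
    show "face' (Suc j) (x i j) = face' (Suc j) (x i (Suc j))"
      using ij by (subst (1 2) fx') (auto intro!: H_cong simp: codegen_def coface_def jump_def)
  next
    fix j assume j: "j \<le> n"
    have "face 0 (x 0 j) = act m (Suc n) (codegen 0 \<circ> coface 0) (codegen j) (tag m n a)"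
      using j by (subst fx) (auto intro!: H1 cc cg sc jump simp: jump_def coface_def)
    also have "\<dots> = degen' j (tag m n a)"
      unfolding degen'_def by (simp, intro act_cong) (auto simp: codegen_def coface_def)
    finally show "face 0 (x 0 j) = degen' j (tag m n a)" .
  next
    fix i assume i: "i \<le> m"
    have "face' 0 (x i 0) = act (Suc m) n (codegen i) (codegen 0 \<circ> coface 0) (tag m n a)"
      using i by (subst fx') (auto intro!: H2 cc cg sc jump simp: jump_def coface_def)
    also have "\<dots> = degen i (tag m n a)"
      unfolding degen_def by (simp, intro act_cong) (auto simp: codegen_def coface_def)
    finally show "face' 0 (x i 0) = degen i (tag m n a)" .
  qed
  moreover have "face (Suc m) (face' (Suc n) (x m n)) = tag m n c"
  proof -
    have "face (Suc m) (face' (Suc n) (x m n)) =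
        act m n (coface (Suc m)) id (H (Suc m) n (codegen m) (codegen n \<circ> coface (Suc n)) (jump m) (jump n \<circ> coface (Suc n)))"
      unfolding face_def fx'[OF order_refl order_refl] by (simp add: H_def dim1_def dim2_def)
    also have "\<dots> = H m n (codegen m \<circ> coface (Suc m)) ((codegen n \<circ> coface (Suc n)) \<circ> id)
        (jump m \<circ> coface (Suc m)) ((jump n \<circ> coface (Suc n)) \<circ> id)"
      by (intro act_H cg cc sc jump cf) auto
    also have "\<dots> = H m n id id (\<lambda>_. 0) (\<lambda>_. 0)"
      by (intro H_cong) (auto simp: codegen_def coface_def jump_def)
    finally show ?thesis using H0 by simp
  qed
  ultimately show ?thesis
    using hom const_map_hom[OF bisimplicial_set_std]
      by (simp add: product_map_iff[OF mn] tag_const_map)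
qed

lemma BC_homotopy_eq_product:
  assumes mn: "1 \<le> m" "1 \<le> n"
  shows "BC_homotopy X pt m n = {(a, c). product_map m n a (const_map (std_bisimplex m n) pt) c}"
  using BC_homotopy_if_product[OF mn] product_if_BC_homotopy[OF mn] by blast

end

section \<open>The homotopy set is a monoid\<close>

theorem theorem3p15:
  fixes X :: "'a bisset" and pt :: "(bisimplex, 'a) bmap" and m n :: nat
  assumes "pointed_bisimplicial_set X pt"
    and "fibrant TYPE('u :: infinite) X"
    and "m \<ge> 1" and "n \<ge> 1"
  shows "\<exists>e. monoid \<lparr>carrier = BC_homotopy_set X pt m n, mult = BC_product X pt m n, one = e\<rparr>"
proof -
  note mn = assms(3,4)
  interpret bisset X
    by unfold_locales (use assms(1) in \<open>simp add: pointed_bisimplicial_set_def\<close>)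
  interpret fibrant_bisset X pt
    by unfold_locales (use assms(1) horn_filling_cells[OF assms(2)] in \<open>simp_all add: pointed_bisimplicial_set_def\<close>)
  let ?o = "const_map (std_bisimplex m n) pt"
  note iff = product_map_iff[OF mn] BC_maps_iff[OF mn]
  have o_hom: "?o \<in> bis_hom (std_bisimplex m n) X"
    by (rule const_map_hom[OF bisimplicial_set_std])
  have o: "?o \<in> BC_maps X pt m n"
    using mn o_hom unfolding iff tag_const_map by (simp add: K.sphere_at_def K.cell_simps)
  have "monoid \<lparr>carrier = BC_maps X pt m n // BC_homotopy X pt m n, mult = BC_product X pt m n,
      one = BC_homotopy X pt m n `` {?o}\<rparr>"
  proof (rule monoid_of_ternary_relation[where T = "product_map m n"])
    show "a \<in> BC_maps X pt m n \<and> b \<in> BC_maps X pt m n \<and> c \<in> BC_maps X pt m n"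
      if "product_map m n a b c" for a b c
      using that K.product_at_sphere[OF mn] unfolding iff K.product_at_def by blast
    show "\<exists>c. product_map m n a b c" if ab: "a \<in> BC_maps X pt m n" "b \<in> BC_maps X pt m n" for a b
    proof -
      obtain z where z: "K.product_at m n (tag m n a) (tag m n b) z"
        using K.product_at_exists[OF mn] ab unfolding iff by blast
      then have "z \<in> cells" "dim1 z = m" "dim2 z = n"
        using K.product_at_sphere[OF mn z] by (auto simp: K.sphere_at_def)
      then obtain c where "c \<in> bis_hom (std_bisimplex m n) X" "tag m n c = z"
        using tag_surj by blast
      then show ?thesis using z ab unfolding iff by blast
    qed
    show "product_map m n ?o b b" if "b \<in> BC_maps X pt m n" for b
      using that o_hom K.product_at_unit_left[OF mn] unfolding iff tag_const_map by blast
    show "product_map m n a ?o a" if "a \<in> BC_maps X pt m n" for a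
      using that o_hom K.product_at_unit_right[OF mn] unfolding iff tag_const_map by blast
    show "product_map m n a f g"
      if "product_map m n a b e" "product_map m n b c f" "product_map m n e c g" for a b c e f g
      using that K.product_at_assoc_right[OF mn] unfolding iff by blast
    show "product_map m n e c g"
      if "product_map m n a b e" "product_map m n b c f" "product_map m n a f g" for a b c e f g
      using that K.product_at_assoc_left[OF mn] unfolding iff by blast
    show "BC_homotopy X pt m n = {(a, b). product_map m n a ?o b}"
      by (rule BC_homotopy_eq_product[OF mn])
    show "BC_product X pt m n A B =
        (\<Union>a\<in>A. \<Union>b\<in>B. \<Union>c\<in>{c. product_map m n a b c}. BC_homotopy X pt m n `` {c})"
      if "A \<subseteq> BC_maps X pt m n" "B \<subseteq> BC_maps X pt m n" for A B
      using that unfolding BC_product_def product_map_def by blast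
  qed (rule o)
  then show ?thesis unfolding BC_homotopy_set_def by blast
qed

end
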